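(* Let $p\in[1,\infty)$, let $\omega_1$ and $\omega_2$ be fast majorants, and let $\phi$ be an analytic function of $\mathbb{D}$ into itself. Then the following conditions are equivalent. (F1) $\phi\in\mathscr{F}\big(\Lambda_{\omega_1,\infty}(\mathbb{D})\cap\mathscr{H}(\mathbb{D}),\ \Lambda_{\omega_2,p}(\mathbb{D})\cap\mathscr{H}(\mathbb{D})\big)$. (F2) There is a constant $M>0$ such that for all $z\in\mathbb{D}$, $$\left(\int_0^{2\pi}\left(|\phi'(ze^{i\theta})|\frac{\omega_1\big(d_{\mathbb{D}}(\phi(ze^{i\theta}))\big)}{d_{\mathbb{D}}(\phi(ze^{i\theta}))}\right)^p d\theta\right)^{1/p}\le M\frac{\omega_2(d_{\mathbb{D}}(z))}{d_{\mathbb{D}}(z)}.$$ Furthermore, assume that $\phi$ is continuous in $\overline{\mathbb{D}}$, that $\omega_1\in\mathscr{S}$ and that $\omega_2$ is regular. Then (F1) and (F2) are equivalent to each of the conditions (F3)–(F5). (F3) $\omega_1(d_{\mathbb{D}}(\phi))\in\Lambda_{\omega_2,p}(\overline{\mathbb{D}})$. (F4) $\omega_1(d_{\mathbb{D}}(\phi))\in\Lambda_{\omega_2,p}(\mathbb{T})$ and there is a constant $M>0$ such that for all $r\in(0,1)$, $$\left(\int_0^{2\pi}\left\{\omega_1(d_{\mathbb{D}}(\phi(re^{i\theta})))-\omega_1(d_{\mathbb{D}}(\phi(e^{i\theta})))\right\}_+^p d\theta\right)^{1/p}\le M\omega_2(d_{\mathbb{D}}(r)).$$ (F5) $\omega_1(d_{\mathbb{D}}(\phi))\in\Lambda_{\omega_2,p}(\mathbb{T})$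 and there is a constant $M>0$ such that for all $r\in(0,1)$, $$\left(\int_0^{2\pi}\left(\omega_1(d_{\mathbb{D}}(\phi(re^{i\theta})))-P[\omega_1(d_{\mathbb{D}}(\phi))](re^{i\theta})\right)^p d\theta\right)^{1/p}\le M\omega_2(d_{\mathbb{D}}(r)).$$
   Context: $\mathbb{D}$ is the open unit disk in $\mathbb{C}$, $\mathbb{T}=\partial\mathbb{D}$, $d_{\mathbb{D}}(z)=1-|z|$ (distance to $\mathbb{T}$, also for $z\in\overline{\mathbb{D}}$), $\{x\}_+=\max\{x,0\}$. $\mathscr{H}(\mathbb{D})$ is the set of complex-valued harmonic functions in $\mathbb{D}$. For analytic $\phi:\mathbb{D}\to\mathbb{D}$ the composition operator is $C_\phi(f)(z)=f(\phi(z))$; for $X,Y\subset\mathscr{H}(\mathbb{D})$, $\mathscr{F}(X,Y)$ is the set of all analytic $\phi:\mathbb{D}\to\mathbb{D}$ with $C_\phi(X)\subset Y$. $\omega_1(d_{\mathbb{D}}(\phi))$ is the function $z\mapsto\omega_1(1-|\phi(z)|)$. A majorant is a continuous increasing function $\omega:[0,\infty)\to[0,\infty)$ with $\omega(0)=0$ such that $\omega(t)/t$ is non-increasing for $t>0$. It is fast if, for some $\delta_0,M>0$, $\int_0^\delta\frac{\omega(t)}{t}\,dt\le M\omega(\delta)$ for $0<\delta<\delta_0$; slow if, for some $\delta_0,M>0$, $\delta\int_\delta^\infty\frac{\omega(t)}{t^2}\,dt\le M\omega(\delta)$ for $0<\delta<\delta_0$; regular if both fast and slow. $\mathscr{S}$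 is the set of majorants $\omega_1$ which are differentiable on $(0,1]$ with $\omega_1'$ non-increasing on $(0,1]$ and $\sup_{t\in(0,1]}\frac{\omega_1(t)}{t\omega_1'(t)}<\infty$. For $p\in(0,\infty)$ put $\mathcal{L}_p[F](z_1,z_2)=\left(\int_0^{2\pi}|F(e^{i\eta}z_1)-F(e^{i\eta}z_2)|^p\,d\eta\right)^{1/p}$, and $\mathcal{L}_\infty[F](z_1,z_2)=|F(z_1)-F(z_2)|$. For $\Omega=\mathbb{D}$ or $\overline{\mathbb{D}}$, $\Lambda_{\omega,p}(\Omega)$ is the class of Borel functions $F:\Omega\to\mathbb{C}$ for which there is $M>0$ with $\mathcal{L}_p[F](z_1,z_2)\le M\omega(|z_1-z_2|)$ for all $z_1,z_2\in\Omega$. $\Lambda_{\omega,p}(\mathbb{T})$ consists of those $F\in L^p(\mathbb{T})$ for which there is $M>0$ with $\mathcal{L}_p[F](\xi_1,\xi_2)\le M\omega(|\xi_1-\xi_2|)$ for all $\xi_1,\xi_2\in\mathbb{T}$. $P[\varphi](z)=\frac1{2\pi}\int_0^{2\pi}\varphi(e^{i\tau})\frac{1-|z|^2}{|e^{i\tau}-z|^2}\,d\tau$ is the Poisson integral; $P[\omega_1(d_{\mathbb{D}}(\phi))]$ is that of the boundary function of $\omega_1(d_{\mathbb{D}}(\phi))$. (The quantity $\omega_1(d_{\mathbb{D}}(\phi))-P[\omega_1(d_{\mathbb{D}}(\phi))]$ in (F5) is non-negative because $\omega_1(d_{\mathbb{D}}(\phi))$ is superharmonic.) *)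

theory Defs
  imports "HOL-Complex_Analysis.Complex_Analysis"
begin

abbreviation unit_disk :: "complex set" where "unit_disk \<equiv> ball 0 1"
abbreviation closed_unit_disk :: "complex set" where "closed_unit_disk \<equiv> cball 0 1"
abbreviation unit_circle :: "complex set" where "unit_circle \<equiv> sphere 0 1"

text \<open>The distance to the unit circle, for points of the closed unit disk.\<close>
definition disk_dist :: "complex \<Rightarrow> real" where
  "disk_dist z = 1 - norm z"


subsection \<open>Majorants\<close>

text \<open>Majorants live on \<open>[0,\<infinity>)\<close>; the values at negative arguments are irrelevant.
  ``Increasing'' is read in the weak sense.\<close>
definition majorant :: "(real \<Rightarrow> real) \<Rightarrow> bool" where
  "majorant \<omega> \<longleftrightarrow>
     continuous_on {0..} \<omega> \<and> mono_on {0..} \<omega> \<and> (\<forall>t\<ge>0. 0 \<le> \<omega> t) \<and> \<omega> 0 = 0 \<and>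
     antimono_on {0<..} (\<lambda>t. \<omega> t / t)"

text \<open>The integrals below may diverge, so they are taken in \<^typ>\<open>ennreal\<close>.\<close>
definition fast_majorant :: "(real \<Rightarrow> real) \<Rightarrow> bool" where
  "fast_majorant \<omega> \<longleftrightarrow> majorant \<omega> \<and>
     (\<exists>\<delta>\<^sub>0>0. \<exists>M>0. \<forall>\<delta>. 0 < \<delta> \<and> \<delta> < \<delta>\<^sub>0 \<longrightarrow>
        (\<integral>\<^sup>+ t\<in>{0<..<\<delta>}. ennreal (\<omega> t / t) \<partial>lborel) \<le> ennreal (M * \<omega> \<delta>))"

definition slow_majorant :: "(real \<Rightarrow> real) \<Rightarrow> bool" where
  "slow_majorant \<omega> \<longleftrightarrow> majorant \<omega> \<and>
     (\<exists>\<delta>\<^sub>0>0. \<exists>M>0. \<forall>\<delta>. 0 < \<delta> \<and> \<delta> < \<delta>\<^sub>0 \<longrightarrow>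
        ennreal \<delta> * (\<integral>\<^sup>+ t\<in>{\<delta><..}. ennreal (\<omega> t / t\<^sup>2) \<partial>lborel) \<le> ennreal (M * \<omega> \<delta>))"

definition regular_majorant :: "(real \<Rightarrow> real) \<Rightarrow> bool" where
  "regular_majorant \<omega> \<longleftrightarrow> fast_majorant \<omega> \<and> slow_majorant \<omega>"

text \<open>The class \<open>\<S>\<close>. The derivative is one-sided at 1. The quotient in the supremum is only
  meaningful where \<open>\<omega>'\<close> does not vanish; this is stated explicitly because division by zero
  would otherwise yield 0 instead of an infinite supremum.\<close>
definition class_S :: "(real \<Rightarrow> real) set" where
  "class_S = {\<omega>. majorant \<omega> \<and>
     (\<exists>\<omega>'. (\<forall>t\<in>{0<..1}. (\<omega> has_real_derivative \<omega>' t) (at t within {0<..1})) \<and>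
           antimono_on {0<..1} \<omega>' \<and>
           (\<forall>t\<in>{0<..1}. \<omega>' t \<noteq> 0) \<and>
           bdd_above ((\<lambda>t. \<omega> t / (t * \<omega>' t)) ` {0<..1}))}"


subsection \<open>Harmonic functions and composition operators\<close>

text \<open>The partial derivatives in the directions \<open>1\<close> and \<open>\<i>\<close> are those in \<open>x\<close> and \<open>y\<close>.\<close>
definition partial_deriv :: "complex \<Rightarrow> (complex \<Rightarrow> complex) \<Rightarrow> complex \<Rightarrow> complex" where
  "partial_deriv v f z = vector_derivative (\<lambda>t::real. f (z + t *\<^sub>R v)) (at 0)"

definition C1_on :: "(complex \<Rightarrow> complex) \<Rightarrow> complex set \<Rightarrow> bool" where
  "C1_on f S \<longleftrightarrow> (\<forall>v\<in>{1, \<i>}.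
     (\<forall>z\<in>S. (\<lambda>t::real. f (z + t *\<^sub>R v)) differentiable (at 0)) \<and>
     continuous_on S (partial_deriv v f))"

text \<open>\<open>C\<^sup>2\<close> with vanishing Laplacian, for \<open>S\<close> open.\<close>
definition harmonic_on :: "(complex \<Rightarrow> complex) \<Rightarrow> complex set \<Rightarrow> bool" where
  "harmonic_on f S \<longleftrightarrow>
     C1_on f S \<and> (\<forall>v\<in>{1, \<i>}. C1_on (partial_deriv v f) S) \<and>
     (\<forall>z\<in>S. partial_deriv 1 (partial_deriv 1 f) z
           + partial_deriv \<i> (partial_deriv \<i> f) z = 0)"

text \<open>Functions on a subset \<open>\<Omega>\<close> of the plane are represented by total functions. Membership in
  the function spaces below depends only on the values on \<open>\<Omega>\<close>.\<close>
definition harmonic_disk :: "(complex \<Rightarrow> complex) set" where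
  "harmonic_disk = {f. harmonic_on f unit_disk}"

definition comp_symbols ::
    "(complex \<Rightarrow> complex) set \<Rightarrow> (complex \<Rightarrow> complex) set \<Rightarrow> (complex \<Rightarrow> complex) set" where
  "comp_symbols X Y = {\<phi>. \<phi> holomorphic_on unit_disk \<and> \<phi> ` unit_disk \<subseteq> unit_disk \<and>
     (\<forall>f\<in>X. f \<circ> \<phi> \<in> Y)}"


subsection \<open>Lipschitz-type classes\<close>

definition ennreal_root :: "real \<Rightarrow> ennreal \<Rightarrow> ennreal" where
  "ennreal_root p x = (if x = top then top else ennreal (enn2real x powr (1 / p)))"

text \<open>\<open>(\<integral>\<^sub>0\<^sup>2\<^sup>\<pi> g(\<theta>)\<^sup>p d\<theta>)\<^sup>1\<^sup>/\<^sup>p\<close> for \<open>g \<ge> 0\<close> and \<open>0 < p < \<infinity>\<close>, possibly infinite.\<close>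
definition circle_Lp :: "real \<Rightarrow> (real \<Rightarrow> real) \<Rightarrow> ennreal" where
  "circle_Lp p g =
     ennreal_root p (\<integral>\<^sup>+ \<theta>\<in>{0..2 * pi}. ennreal (g \<theta> powr p) \<partial>lebesgue)"

definition osc :: "ereal \<Rightarrow> (complex \<Rightarrow> complex) \<Rightarrow> complex \<Rightarrow> complex \<Rightarrow> ennreal" where
  "osc p F z\<^sub>1 z\<^sub>2 =
     (if p = \<infinity> then ennreal (norm (F z\<^sub>1 - F z\<^sub>2))
      else circle_Lp (real_of_ereal p) (\<lambda>\<eta>. norm (F (cis \<eta> * z\<^sub>1) - F (cis \<eta> * z\<^sub>2))))"

text \<open>To be used for \<open>\<Omega>\<close> the open or the closed unit disk.\<close>
definition Lambda :: "(real \<Rightarrow> real) \<Rightarrow> ereal \<Rightarrow> complex set \<Rightarrow> (complex \<Rightarrow> complex) set" where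
  "Lambda \<omega> p \<Omega> = {F. F \<in> borel_measurable (restrict_space borel \<Omega>) \<and>
     (\<exists>M>0. \<forall>z\<^sub>1\<in>\<Omega>. \<forall>z\<^sub>2\<in>\<Omega>. osc p F z\<^sub>1 z\<^sub>2 \<le> ennreal (M * \<omega> (dist z\<^sub>1 z\<^sub>2)))}"

definition Lp_circle :: "ereal \<Rightarrow> (complex \<Rightarrow> complex) set" where
  "Lp_circle p = {F. (\<lambda>\<eta>. F (cis \<eta>)) \<in> borel_measurable (lebesgue_on {0..2 * pi}) \<and>
     (if p = \<infinity> then \<exists>C. AE \<eta> in lebesgue_on {0..2 * pi}. norm (F (cis \<eta>)) \<le> C
      else circle_Lp (real_of_ereal p) (\<lambda>\<eta>. norm (F (cis \<eta>))) < \<infinity>)}"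

definition Lambda_circle :: "(real \<Rightarrow> real) \<Rightarrow> ereal \<Rightarrow> (complex \<Rightarrow> complex) set" where
  "Lambda_circle \<omega> p = {F \<in> Lp_circle p.
     \<exists>M>0. \<forall>\<xi>\<^sub>1\<in>unit_circle. \<forall>\<xi>\<^sub>2\<in>unit_circle.
       osc p F \<xi>\<^sub>1 \<xi>\<^sub>2 \<le> ennreal (M * \<omega> (dist \<xi>\<^sub>1 \<xi>\<^sub>2))}"

definition poisson :: "(complex \<Rightarrow> real) \<Rightarrow> complex \<Rightarrow> real" where
  "poisson u z = 1 / (2 * pi) *
     (LINT \<tau>:{0..2 * pi}|lebesgue. u (cis \<tau>) * ((1 - (norm z)\<^sup>2) / (norm (cis \<tau> - z))\<^sup>2))"

end

theory Submission
  imports Defs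
begin

text \<open>Write \<open>m\<^sub>i t = \<omega>\<^sub>i t / t\<close>, \<open>d z = 1 - |z|\<close> and
  \<open>k z = |\<phi>' z| m\<^sub>1 (d (\<phi> z))\<close>. The second condition says that the \<open>L\<^sup>p\<close> means of \<open>k\<close> over
  the circle through \<open>z\<close> are \<open>O(m\<^sub>2 (d z))\<close>, and every other condition is compared with it.

  \<^bold>\<open>Slopes and composition.\<close> If \<open>f\<close> is harmonic with modulus of continuity \<open>\<omega>\<^sub>1\<close>, then its gradient at
  \<open>w\<close> is \<open>O(m\<^sub>1 (d w))\<close>, so the local Lipschitz constant of \<open>f \<circ> \<phi>\<close> at \<open>z\<close> is \<open>O(k z)\<close>. A bound on the
  means of a local Lipschitz constant becomes a modulus of continuity in the mean by integration
  along a path: for \<open>\<delta> = min 1 |z\<^sub>1 - z\<^sub>2|\<close>, move each point radially inwards by the factor \<open>1 - \<delta>\<close>,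
  and then along a segment. On the radial pieces the bound is \<open>\<integral> m\<^sub>2\<close> over \<open>(0, \<delta>)\<close>, which is
  \<open>O(\<omega>\<^sub>2 \<delta>)\<close> because \<open>\<omega>\<^sub>2\<close> is fast; on the segment it is \<open>\<delta> m\<^sub>2 \<delta> = \<omega>\<^sub>2 \<delta>\<close>. Minkowski's integral
  inequality passes from pointwise estimates to means (\<open>slope_le_imp_Lambda_p\<close>).

  Conversely there are two holomorphic functions \<open>f\<^sub>0\<close> and \<open>f\<^sub>1\<close>, lacunary series unless \<open>m\<^sub>1\<close> is
  bounded, with modulus of continuity \<open>\<omega>\<^sub>1\<close> and
  \<open>|f\<^sub>0'| + |f\<^sub>1'| \<ge> c m\<^sub>1 \<circ> d\<close> on the disk (\<open>test_functions\<close>); the former follows from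
  \<open>|f\<^sub>j'| \<le> C m\<^sub>1 \<circ> d\<close> by the same path argument, since \<open>\<omega>\<^sub>1\<close> is fast. If both \<open>f\<^sub>j \<circ> \<phi>\<close> have
  modulus of continuity \<open>\<omega>\<^sub>2\<close> in the mean, Cauchy's formula on circles of radius \<open>d z / 2\<close> bounds the means of
  \<open>|(f\<^sub>j \<circ> \<phi>)'| = |f\<^sub>j' \<circ> \<phi>| |\<phi>'|\<close> by \<open>m\<^sub>2 (d z)\<close>, and their sum dominates \<open>c k\<close>.

  \<^bold>\<open>The function \<open>u = \<omega>\<^sub>1 (1 - |\<phi>|)\<close>.\<close> Since \<open>\<omega>\<^sub>1\<close> has secant slopes at most \<open>m\<^sub>1\<close>, the local Lipschitz
  constant of \<open>u\<close> is also at most \<open>k\<close>, so the slope bound implies that \<open>u\<close> has modulus of continuity \<open>\<omega>\<^sub>2\<close> in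
  the mean on the closed disk; restricting it to the circle and to radii gives the fourth condition.
  For slow \<open>\<omega>\<^sub>2\<close> the Poisson integral \<open>P u\<close> approximates \<open>u\<close> in the mean within \<open>O(\<omega>\<^sub>2 (1 - r))\<close>
  (\<open>poisson_Lp_approximation\<close>), and \<open>u - P u \<ge> 0\<close> by concavity (\<open>poisson_dist_comp_le\<close>); this yields
  the fifth condition.

  To return from the fifth condition to the slope bound, put \<open>s = 1 - |\<phi> z|\<close>. The tangent line of \<open>\<omega>\<^sub>1\<close> at \<open>s\<close> shows that
  \<open>\<omega>\<^sub>1' s (|\<phi> \<zeta>| - |\<phi> z|) \<le> u z - u \<zeta>\<close>. The real part of a rotation of \<open>\<phi>\<close> is harmonic, is dominated by
  \<open>|\<phi>|\<close> and touches it at \<open>z\<close>, so its gradient \<open>|\<phi>' z|\<close> is controlled by the mean of its positive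
  increments over a circle around \<open>z\<close>, hence by the mean of \<open>max 0 (u z - u \<zeta>)\<close>. Finally
  \<open>u z - u \<zeta> \<le> |P u z - P u \<zeta>| + (u z - P u z)\<close>, because \<open>u \<zeta> \<ge> P u \<zeta>\<close>, and both terms on the
  right have means \<open>O(\<omega>\<^sub>2 (d z))\<close> (\<open>poisson_defect_imp_slope_bound\<close>).\<close>

section \<open>Minkowski and Fatou inequalities for means over circles\<close>

text \<open>Bounds on \<open>L\<^sup>p\<close> norms are used only in this form: on the right there is neither a root nor the
  completed measure, so the theory of nonnegative integrals over \<open>lborel\<close> applies.\<close>
lemma circle_Lp_le_iff:
  assumes "p \<ge> 1" "C \<ge> 0"
  shows "circle_Lp p g \<le> ennreal C \<longleftrightarrow>
    (\<integral>\<^sup>+ \<theta>\<in>{0..2 * pi}. ennreal (g \<theta> powr p) \<partial>lborel) \<le> ennreal (C powr p)"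
proof -
  define J where "J = (\<integral>\<^sup>+ \<theta>\<in>{0..2 * pi}. ennreal (g \<theta> powr p) \<partial>lborel)"
  have J: "circle_Lp p g = ennreal_root p J"
    unfolding circle_Lp_def J_def by (simp add: nn_integral_completion)
  show ?thesis
  proof (cases "J = top")
    case True
    then show ?thesis using J by (simp add: ennreal_root_def J_def[symmetric] top_unique)
  next
    case False
    then obtain j where j: "J = ennreal j" "j \<ge> 0" by (cases J) auto
    have "(j powr (1/p) \<le> C) = (j \<le> C powr p)"
    proof
      assume "j powr (1/p) \<le> C"
      then have "(j powr (1/p)) powr p \<le> C powr p" using assms by (intro powr_mono2) auto
      then show "j \<le> C powr p" using assms j by (simp add: powr_powr)
    next
      assume "j \<le> C powr p"
      then have "j powr (1/p) \<le> (C powr p) powr (1/p)" using assms j by (intro powr_mono2) auto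
      then show "j powr (1/p) \<le> C" using assms j by (simp add: powr_powr)
    qed
    then show ?thesis using J j assms by (simp add: ennreal_root_def J_def[symmetric])
  qed
qed

text \<open>The tangent of the convex function \<open>x powr p\<close> at \<open>a\<close>. It replaces the inequality of Hoelder in the
  proof of Minkowski's inequality.\<close>
lemma powr_tangent_le:
  fixes x a p :: real
  assumes "1 \<le> p" "0 \<le> x" "0 \<le> a"
  shows "p * a powr (p - 1) * x \<le> x powr p + (p - 1) * a powr p"
proof (cases "a = 0 \<or> x = 0")
  case True then show ?thesis using assms by auto
next
  case False
  then have a: "a > 0" and x: "x > 0" using assms by auto
  have "p * a powr (p - 1) * (x - a) \<le> x powr p - a powr p"
  proof (rule convex_on_imp_above_tangent[of "{0<..}" "\<lambda>x. x powr p"])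
    show "((\<lambda>x. x powr p) has_real_derivative p * a powr (p - 1)) (at a within {0<..})"
      using a by (auto intro!: derivative_eq_intros)
  qed (use a x assms powr_convex in \<open>auto intro: convex_connected simp: interior_open\<close>)
  moreover have "a powr p = a powr (p - 1) * a" using a by (simp add: powr_diff)
  ultimately show ?thesis by (simp add: algebra_simps)
qed

lemma circle_Lp_mono:
  assumes "p \<ge> 1" "C \<ge> 0" "circle_Lp p g \<le> ennreal C"
    and "\<And>\<theta>. \<theta> \<in> {0..2*pi} \<Longrightarrow> 0 \<le> f \<theta>" "\<And>\<theta>. \<theta> \<in> {0..2*pi} \<Longrightarrow> f \<theta> \<le> g \<theta>"
  shows "circle_Lp p f \<le> ennreal C"
proof -
  have "(\<integral>\<^sup>+ \<theta>\<in>{0..2 * pi}. ennreal (f \<theta> powr p) \<partial>lborel)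
     \<le> (\<integral>\<^sup>+ \<theta>\<in>{0..2 * pi}. ennreal (g \<theta> powr p) \<partial>lborel)"
    using assms by (intro nn_integral_mono) (auto simp: indicator_def intro!: ennreal_leI powr_mono2)
  then show ?thesis using assms circle_Lp_le_iff by (meson order_trans)
qed

text \<open>The measure \<open>h / H d\<mu>\<close> is a subprobability measure, so by convexity
  \<open>(\<integral> g d\<mu>)\<^sup>p = H\<^sup>p (\<integral> (g / h) (h / H) d\<mu>)\<^sup>p\<close> is at most \<open>H\<^sup>p\<^sup>-\<^sup>1 \<integral> g\<^sup>p h\<^sup>1\<^sup>-\<^sup>p d\<mu>\<close>. Integration over the circle and Tonelli's
  theorem reduce the claim to \<open>\<integral> h\<^sup>1\<^sup>-\<^sup>p h\<^sup>p d\<mu> \<le> H\<close>. Convexity enters through the tangent at the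
  normalised value \<open>G \<theta> / H\<close>.\<close>
lemma Minkowski_integral_pos:
  fixes g :: "'a \<Rightarrow> real \<Rightarrow> real"
  assumes p: "p \<ge> 1" and fin: "finite_measure \<mu>"
    and meas: "(\<lambda>(t, \<theta>). g t \<theta>) \<in> borel_measurable (\<mu> \<Otimes>\<^sub>M lborel)"
    and h: "h \<in> borel_measurable \<mu>" "\<And>t. t \<in> space \<mu> \<Longrightarrow> 0 < h t"
    and g: "\<And>t \<theta>. t \<in> space \<mu> \<Longrightarrow> 0 \<le> g t \<theta>"
    and le: "\<And>t. t \<in> space \<mu> \<Longrightarrow> circle_Lp p (g t) \<le> ennreal (h t)"
    and H: "(\<integral>\<^sup>+ t. ennreal (h t) \<partial>\<mu>) \<le> ennreal H" "0 < H"
    and G: "\<And>\<theta>. \<theta> \<in> {0..2*pi} \<Longrightarrow> 0 \<le> G \<theta>"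
      "\<And>\<theta>. \<theta> \<in> {0..2*pi} \<Longrightarrow> ennreal (G \<theta>) \<le> (\<integral>\<^sup>+ t. ennreal (g t \<theta>) \<partial>\<mu>)"
  shows "circle_Lp p G \<le> ennreal H"
proof -
  interpret finite_measure \<mu> by fact
  have sf: "sigma_finite_measure \<mu>" by unfold_locales
  interpret pair_sigma_finite \<mu> "lborel :: real measure" ..
  have [measurable]: "h \<in> borel_measurable \<mu>"
    "(\<lambda>z. g (fst z) (snd z)) \<in> borel_measurable (\<mu> \<Otimes>\<^sub>M lborel)"
    using h meas by (auto simp: split_beta')
  have [measurable]: "(\<lambda>z. g (snd z) (fst z)) \<in> borel_measurable (lborel \<Otimes>\<^sub>M \<mu>)"
    using measurable_pair_swap[OF meas] by (simp add: split_beta')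
  have pointwise: "ennreal (G \<theta> powr p)
      \<le> ennreal (H powr (p - 1)) * (\<integral>\<^sup>+ t. ennreal (g t \<theta> powr p * h t powr (1 - p)) \<partial>\<mu>)"
    if \<theta>: "\<theta> \<in> {0..2*pi}" for \<theta>
  proof -
    have [measurable]: "g' \<in> borel_measurable \<mu>" if "g' = (\<lambda>t. g t \<theta>)" for g'
      using measurable_compose[OF measurable_Pair2'[of \<theta> lborel \<mu>] meas] that by simp
    have gm[measurable]: "(\<lambda>t. g t \<theta>) \<in> borel_measurable \<mu>" by simp
    define a where "a = G \<theta> / H"
    have a: "a \<ge> 0" using G \<theta> H by (simp add: a_def)
    have "ennreal (p * a powr (p - 1)) * ennreal (G \<theta>)
        \<le> ennreal (p * a powr (p - 1)) * (\<integral>\<^sup>+ t. ennreal (g t \<theta>) \<partial>\<mu>)"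
      using G \<theta> by (intro mult_left_mono) auto
    also have "\<dots> = (\<integral>\<^sup>+ t. ennreal (p * a powr (p - 1) * g t \<theta>) \<partial>\<mu>)"
      using p g by (subst nn_integral_cmult[symmetric])
         (auto intro!: nn_integral_cong simp: ennreal_mult)
    also have "\<dots> \<le> (\<integral>\<^sup>+ t. ennreal (g t \<theta> powr p * h t powr (1 - p))
                           + ennreal ((p - 1) * a powr p) * ennreal (h t) \<partial>\<mu>)"
    proof (intro nn_integral_mono)
      fix t assume t: "t \<in> space \<mu>"
      have ht: "h t > 0" using h t by auto
      have "p * a powr (p - 1) * (g t \<theta> / h t) \<le> (g t \<theta> / h t) powr p + (p - 1) * a powr p"
        using p a g[OF t] ht by (intro powr_tangent_le) auto
      then have "p * a powr (p - 1) * (g t \<theta> / h t) * h t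
          \<le> ((g t \<theta> / h t) powr p + (p - 1) * a powr p) * h t"
        using ht by (intro mult_right_mono) auto
      also have "\<dots> = g t \<theta> powr p * h t powr (1 - p) + (p - 1) * a powr p * h t"
        using ht g[OF t] by (simp add: powr_divide powr_diff algebra_simps)
      finally have "p * a powr (p - 1) * g t \<theta>
          \<le> g t \<theta> powr p * h t powr (1 - p) + (p - 1) * a powr p * h t"
        using ht by simp
      then show "ennreal (p * a powr (p - 1) * g t \<theta>)
          \<le> ennreal (g t \<theta> powr p * h t powr (1 - p)) + ennreal ((p - 1) * a powr p) * ennreal (h t)"
        using ht p by (simp flip: ennreal_plus ennreal_mult) 
    qed
    also have "\<dots> = (\<integral>\<^sup>+ t. ennreal (g t \<theta> powr p * h t powr (1 - p)) \<partial>\<mu>)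
        + ennreal ((p - 1) * a powr p) * (\<integral>\<^sup>+ t. ennreal (h t) \<partial>\<mu>)"
      by (subst nn_integral_add) (auto simp: nn_integral_cmult)
    also have "\<dots> \<le> (\<integral>\<^sup>+ t. ennreal (g t \<theta> powr p * h t powr (1 - p)) \<partial>\<mu>)
        + ennreal ((p - 1) * a powr p) * ennreal H"
      using H by (intro add_left_mono mult_left_mono) auto
    finally have *: "ennreal (p * a powr (p - 1) * G \<theta>)
        \<le> (\<integral>\<^sup>+ t. ennreal (g t \<theta> powr p * h t powr (1 - p)) \<partial>\<mu>) + ennreal ((p - 1) * a powr p * H)"
      using p G \<theta> H by (simp add: ennreal_mult)
    have "p * a powr (p - 1) * G \<theta> = a powr p * H + (p - 1) * a powr p * H"
    proof (cases "a = 0")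
      case True then show ?thesis using H p by (simp add: a_def)
    next
      case False
      then have "a powr p = a powr (p - 1) * a" using a by (simp add: powr_diff)
      moreover have "G \<theta> = a * H" using H by (simp add: a_def)
      ultimately show ?thesis by (simp add: algebra_simps)
    qed
    then have "ennreal (a powr p * H) + ennreal ((p - 1) * a powr p * H)
        \<le> (\<integral>\<^sup>+ t. ennreal (g t \<theta> powr p * h t powr (1 - p)) \<partial>\<mu>) + ennreal ((p - 1) * a powr p * H)"
      using * p H by (simp flip: ennreal_plus)
    then have "ennreal (a powr p * H) \<le> (\<integral>\<^sup>+ t. ennreal (g t \<theta> powr p * h t powr (1 - p)) \<partial>\<mu>)"
      by (subst (asm) add.commute, subst (asm) (2) add.commute, subst (asm) ennreal_add_left_cancel_le) auto
    then have "ennreal (H powr (p - 1)) * ennreal (a powr p * H)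
       \<le> ennreal (H powr (p - 1)) * (\<integral>\<^sup>+ t. ennreal (g t \<theta> powr p * h t powr (1 - p)) \<partial>\<mu>)"
      by (intro mult_left_mono) auto
    moreover have "H powr (p - 1) * (a powr p * H) = G \<theta> powr p"
      using H G \<theta> by (simp add: a_def powr_divide powr_diff)
    ultimately show ?thesis using H by (simp flip: ennreal_mult)
  qed
  have inner_meas: "(\<lambda>\<theta>. \<integral>\<^sup>+ t. ennreal (g t \<theta> powr p * h t powr (1 - p)) * indicator {0..2*pi} \<theta> \<partial>\<mu>)
      \<in> borel_measurable lborel"
  proof (rule sigma_finite_measure.borel_measurable_nn_integral[OF sf])
    show "(\<lambda>(\<theta>, t). ennreal (g t \<theta> powr p * h t powr (1 - p)) * indicator {0..2*pi} \<theta>)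
        \<in> borel_measurable (lborel \<Otimes>\<^sub>M \<mu>)"
      unfolding split_beta' by measurable
  qed
  have "(\<integral>\<^sup>+ \<theta>\<in>{0..2 * pi}. ennreal (G \<theta> powr p) \<partial>lborel)
    \<le> (\<integral>\<^sup>+ \<theta>. ennreal (H powr (p - 1)) *
         (\<integral>\<^sup>+ t. ennreal (g t \<theta> powr p * h t powr (1 - p)) * indicator {0..2*pi} \<theta> \<partial>\<mu>) \<partial>lborel)"
  proof (intro nn_integral_mono)
    fix \<theta> :: real
    show "ennreal (G \<theta> powr p) * indicator {0..2 * pi} \<theta> \<le> ennreal (H powr (p - 1)) *
         (\<integral>\<^sup>+ t. ennreal (g t \<theta> powr p * h t powr (1 - p)) * indicator {0..2*pi} \<theta> \<partial>\<mu>)"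
      using pointwise[of \<theta>] by (auto simp: indicator_def)
  qed
  also have "\<dots> = ennreal (H powr (p - 1)) * (\<integral>\<^sup>+ \<theta>. 
         (\<integral>\<^sup>+ t. ennreal (g t \<theta> powr p * h t powr (1 - p)) * indicator {0..2*pi} \<theta> \<partial>\<mu>) \<partial>lborel)"
    by (rule nn_integral_cmult) (rule inner_meas)
  finally have outer: "(\<integral>\<^sup>+ \<theta>\<in>{0..2 * pi}. ennreal (G \<theta> powr p) \<partial>lborel) \<le> \<dots>" .
  have "(\<integral>\<^sup>+ \<theta>. (\<integral>\<^sup>+ t. ennreal (g t \<theta> powr p * h t powr (1 - p)) * indicator {0..2*pi} \<theta> \<partial>\<mu>) \<partial>lborel)
     = (\<integral>\<^sup>+ t. (\<integral>\<^sup>+ \<theta>. ennreal (g t \<theta> powr p * h t powr (1 - p)) * indicator {0..2*pi} \<theta> \<partial>lborel) \<partial>\<mu>)"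
    by (rule Fubini') auto
  also have "\<dots> \<le> (\<integral>\<^sup>+ t. ennreal (h t) \<partial>\<mu>)"
  proof (intro nn_integral_mono)
    fix t assume t: "t \<in> space \<mu>"
    have ht: "h t > 0" using h t by auto
    have gm[measurable]: "g t \<in> borel_measurable borel"
      using measurable_compose[OF measurable_Pair1'[OF t, of lborel] meas] by simp
    have "(\<integral>\<^sup>+ \<theta>. ennreal (g t \<theta> powr p * h t powr (1 - p)) * indicator {0..2*pi} \<theta> \<partial>lborel)
       = (\<integral>\<^sup>+ \<theta>. ennreal (h t powr (1 - p)) * (ennreal (g t \<theta> powr p) * indicator {0..2*pi} \<theta>) \<partial>lborel)"
      by (intro nn_integral_cong) (auto simp: ennreal_mult ac_simps)
    also have "\<dots> = ennreal (h t powr (1 - p)) * (\<integral>\<^sup>+ \<theta>\<in>{0..2*pi}. ennreal (g t \<theta> powr p) \<partial>lborel)"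
      by (rule nn_integral_cmult) auto
    also have "\<dots> \<le> ennreal (h t powr (1 - p)) * ennreal (h t powr p)"
      using le[OF t] p ht by (intro mult_left_mono) (auto simp: circle_Lp_le_iff)
    also have "\<dots> = ennreal (h t)" using ht by (simp flip: ennreal_mult powr_add)
    finally show "(\<integral>\<^sup>+ \<theta>. ennreal (g t \<theta> powr p * h t powr (1 - p)) * indicator {0..2*pi} \<theta> \<partial>lborel)
       \<le> ennreal (h t)" .
  qed
  also have "\<dots> \<le> ennreal H" by (rule H)
  finally have "(\<integral>\<^sup>+ \<theta>\<in>{0..2 * pi}. ennreal (G \<theta> powr p) \<partial>lborel)
      \<le> ennreal (H powr (p - 1)) * ennreal H"
    by (intro order_trans[OF outer] mult_left_mono) auto
  also have "\<dots> = ennreal (H powr p)"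
    using H by (simp flip: ennreal_mult add: powr_diff)
  finally show ?thesis using p H by (subst circle_Lp_le_iff) auto
qed

lemma circle_Lp_le_add_eps:
  assumes p: "p \<ge> 1" and H: "H \<ge> 0" "c > 0"
    and le: "\<And>e. e > 0 \<Longrightarrow> circle_Lp p G \<le> ennreal (H + e * c)"
  shows "circle_Lp p G \<le> ennreal H"
proof (rule ennreal_le_epsilon)
  fix e :: real assume "0 < e"
  then show "circle_Lp p G \<le> ennreal H + ennreal e"
    using le[of "e / c"] H by (simp flip: ennreal_plus)
qed

text \<open>Minkowski's integral inequality: the norm of an integral is at most the integral of the norms. A bound \<open>h\<close>
  that vanishes somewhere is replaced by \<open>h + e\<close> with \<open>e\<close> tending to \<open>0\<close>, which the finiteness
  of \<open>\<mu>\<close> allows.\<close>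
lemma circle_Lp_Minkowski_integral:
  fixes g :: "'a \<Rightarrow> real \<Rightarrow> real"
  assumes p: "p \<ge> 1" and fin: "finite_measure \<mu>"
    and meas: "(\<lambda>(t, \<theta>). g t \<theta>) \<in> borel_measurable (\<mu> \<Otimes>\<^sub>M lborel)"
    and h: "h \<in> borel_measurable \<mu>" "\<And>t. t \<in> space \<mu> \<Longrightarrow> 0 \<le> h t"
    and g: "\<And>t \<theta>. t \<in> space \<mu> \<Longrightarrow> 0 \<le> g t \<theta>"
    and le: "\<And>t. t \<in> space \<mu> \<Longrightarrow> circle_Lp p (g t) \<le> ennreal (h t)"
    and H: "(\<integral>\<^sup>+ t. ennreal (h t) \<partial>\<mu>) \<le> ennreal H" "0 \<le> H"
    and G: "\<And>\<theta>. \<theta> \<in> {0..2*pi} \<Longrightarrow> 0 \<le> G \<theta>"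
      "\<And>\<theta>. \<theta> \<in> {0..2*pi} \<Longrightarrow> ennreal (G \<theta>) \<le> (\<integral>\<^sup>+ t. ennreal (g t \<theta>) \<partial>\<mu>)"
  shows "circle_Lp p G \<le> ennreal H"
proof -
  interpret finite_measure \<mu> by fact
  have sf: "sigma_finite_measure \<mu>" by unfold_locales
  define c where "c = measure \<mu> (space \<mu>) + 1"
  have c: "c > 0" by (simp add: c_def add_nonneg_pos)
  show ?thesis
  proof (rule circle_Lp_le_add_eps[OF p H(2) c])
    fix e :: real assume e: "e > 0"
    show "circle_Lp p G \<le> ennreal (H + e * c)"
    proof (rule Minkowski_integral_pos[OF p fin meas, of "\<lambda>t. h t + e"])
      have "(\<integral>\<^sup>+ t. ennreal (h t + e) \<partial>\<mu>) = (\<integral>\<^sup>+ t. ennreal (h t) + ennreal e \<partial>\<mu>)"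
        using h e by (intro nn_integral_cong) auto
      also have "\<dots> = (\<integral>\<^sup>+ t. ennreal (h t) \<partial>\<mu>) + ennreal e * emeasure \<mu> (space \<mu>)"
        using h by (subst nn_integral_add) auto
      also have "\<dots> \<le> ennreal H + ennreal e * ennreal c"
        by (intro add_mono H mult_left_mono) (auto simp: emeasure_eq_measure c_def)
      also have "\<dots> = ennreal (H + e * c)" using H e c by (simp flip: ennreal_mult)
      finally show "(\<integral>\<^sup>+ t. ennreal (h t + e) \<partial>\<mu>) \<le> ennreal (H + e * c)" .
      show "circle_Lp p (g t) \<le> ennreal (h t + e)" if "t \<in> space \<mu>" for t
        using le[OF that] h(2)[OF that] e by (meson ennreal_leI less_eq_real_def less_add_same_cancel1 order_trans)
      show "h t + e > 0" if "t \<in> space \<mu>" for t using h(2)[OF that] e by simp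
      show "H + e * c > 0" using H e c by (simp add: add_nonneg_pos)
    qed (use h g G in auto)
  qed
qed

text \<open>The triangle inequality is Minkowski's integral inequality for the counting measure on two points.\<close>
lemma circle_Lp_triangle:
  assumes p: "p \<ge> 1" and C: "C1 \<ge> 0" "C2 \<ge> 0"
    and m: "g1 \<in> borel_measurable borel" "g2 \<in> borel_measurable borel"
    and nn: "\<And>\<theta>. 0 \<le> g1 \<theta>" "\<And>\<theta>. 0 \<le> g2 \<theta>"
    and le: "circle_Lp p g1 \<le> ennreal C1" "circle_Lp p g2 \<le> ennreal C2"
  shows "circle_Lp p (\<lambda>\<theta>. g1 \<theta> + g2 \<theta>) \<le> ennreal (C1 + C2)"
proof (rule circle_Lp_Minkowski_integral[where \<mu> = "count_space (UNIV :: bool set)"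
      and g = "\<lambda>b. if b then g1 else g2" and h = "\<lambda>b. if b then C1 else C2"])
  show "(\<lambda>(t, \<theta>). (if t then g1 else g2) \<theta>) \<in> borel_measurable (count_space UNIV \<Otimes>\<^sub>M lborel)"
    using m by (intro measurable_pair_measure_countable1) auto
qed (use assms in \<open>auto simp: nn_integral_count_space_finite UNIV_bool finite_measure_count_space simp flip: ennreal_plus\<close>)

lemma circle_Lp_cmult:
  assumes p: "p \<ge> 1" and C: "C \<ge> 0" "c \<ge> 0" and nn: "\<And>\<theta>. 0 \<le> g \<theta>"
    and m: "g \<in> borel_measurable borel"
    and le: "circle_Lp p g \<le> ennreal C"
  shows "circle_Lp p (\<lambda>\<theta>. c * g \<theta>) \<le> ennreal (c * C)"
proof -
  have "(\<integral>\<^sup>+ \<theta>\<in>{0..2 * pi}. ennreal ((c * g \<theta>) powr p) \<partial>lborel)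
     = (\<integral>\<^sup>+ \<theta>. ennreal (c powr p) * (ennreal (g \<theta> powr p) * indicator {0..2*pi} \<theta>) \<partial>lborel)"
    using nn C by (intro nn_integral_cong) (auto simp: powr_mult ennreal_mult ac_simps)
  also have "\<dots> = ennreal (c powr p) * (\<integral>\<^sup>+ \<theta>\<in>{0..2 * pi}. ennreal (g \<theta> powr p) \<partial>lborel)"
    using m by (intro nn_integral_cmult) auto
  also have "\<dots> \<le> ennreal (c powr p) * ennreal (C powr p)"
    using le p C by (intro mult_left_mono) (auto simp: circle_Lp_le_iff)
  also have "\<dots> = ennreal ((c * C) powr p)" using C by (simp add: powr_mult ennreal_mult)
  finally show ?thesis using p C by (subst circle_Lp_le_iff) auto
qed

lemma circle_Lp_Fatou:
  assumes p: "p \<ge> 1" and C: "\<And>n. Cn n \<ge> 0" and m: "\<And>n. g n \<in> borel_measurable borel"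
    and nn: "\<And>n \<theta>. 0 \<le> g n \<theta>"
    and le: "\<And>n. circle_Lp p (g n) \<le> ennreal (Cn n)"
    and lim: "\<And>\<theta>. (\<lambda>n. g n \<theta>) \<longlonglongrightarrow> G \<theta>" and CC: "Cn \<longlonglongrightarrow> C"
  shows "circle_Lp p G \<le> ennreal C"
proof -
  have C0: "C \<ge> 0" by (rule LIMSEQ_le_const[OF CC]) (use assms in auto)
  have G0: "G \<theta> \<ge> 0" for \<theta> by (rule LIMSEQ_le_const[OF lim]) (use assms in auto)
  have "(\<integral>\<^sup>+ \<theta>\<in>{0..2 * pi}. ennreal (G \<theta> powr p) \<partial>lborel)
     = (\<integral>\<^sup>+ \<theta>. liminf (\<lambda>n. ennreal (g n \<theta> powr p) * indicator {0..2*pi} \<theta>) \<partial>lborel)"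
  proof (intro nn_integral_cong)
    fix \<theta> :: real
    have "(\<lambda>n. ennreal (g n \<theta> powr p) * indicator {0..2*pi} \<theta>)
        \<longlonglongrightarrow> ennreal (G \<theta> powr p) * indicator {0..2*pi} \<theta>"
      using p nn G0 by (auto simp: indicator_def intro!: tendsto_ennrealI tendsto_powr' lim)
    then show "ennreal (G \<theta> powr p) * indicator {0..2*pi} \<theta>
        = liminf (\<lambda>n. ennreal (g n \<theta> powr p) * indicator {0..2*pi} \<theta>)"
      using lim_imp_Liminf by (metis sequentially_bot)
  qed
  also have "\<dots> \<le> liminf (\<lambda>n. \<integral>\<^sup>+ \<theta>. ennreal (g n \<theta> powr p) * indicator {0..2*pi} \<theta> \<partial>lborel)"
    using m by (intro nn_integral_liminf) auto
  also have "\<dots> \<le> liminf (\<lambda>n. ennreal (Cn n powr p))"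
    using le C p by (intro Liminf_mono always_eventually allI) (auto simp: circle_Lp_le_iff)
  also have "\<dots> = ennreal (C powr p)"
    using p C C0 by (intro lim_imp_Liminf tendsto_ennrealI tendsto_powr' CC) auto
  finally show ?thesis using p C0 by (subst circle_Lp_le_iff) auto
qed

lemma nn_integral_period:
  fixes f :: "real \<Rightarrow> ennreal"
  assumes [measurable]: "f \<in> borel_measurable borel"
    and T: "T > 0" and per: "\<And>x. f (x + T) = f x"
  shows "(\<integral>\<^sup>+ x\<in>{a..a+T}. f x \<partial>lborel) = (\<integral>\<^sup>+ x\<in>{0..T}. f x \<partial>lborel)"
proof -
  have per_int: "f (x + of_int k * T) = f x" for x k
  proof -
    have *: "f (x + of_nat n * T) = f x" for n x
      by (induction n) (use per[of "x + of_nat _ * T"] in \<open>auto simp: algebra_simps\<close>)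
    show ?thesis
    proof (cases "k \<ge> 0")
      case True then show ?thesis using *[of x "nat k"] by simp
    next
      case False then show ?thesis using *[of "x + of_int k * T" "nat (-k)"] by (simp add: algebra_simps)
    qed
  qed
  define I where "I = (\<lambda>a b. \<integral>\<^sup>+ x\<in>{a..<b}. f x \<partial>lborel)"
  have shift: "I (a + of_int k * T) (b + of_int k * T) = I a b" for a b k
  proof -
    have "I (a + of_int k * T) (b + of_int k * T)
        = (\<integral>\<^sup>+ x. f (of_int k * T + 1 * x) * indicator {a + of_int k * T..<b + of_int k * T} (of_int k * T + 1 * x) \<partial>lborel)"
      unfolding I_def by (subst nn_integral_real_affine[where c=1 and t="of_int k * T"]) auto
    also have "\<dots> = I a b" unfolding I_def
      using per_int by (intro nn_integral_cong) (auto simp: indicator_def add.commute)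
    finally show ?thesis .
  qed
  have split: "I a c = I a b + I b c" if "a \<le> b" "b \<le> c" for a b c
  proof -
    have "I a c = (\<integral>\<^sup>+ x. f x * indicator {a..<b} x + f x * indicator {b..<c} x \<partial>lborel)"
      unfolding I_def using that by (intro nn_integral_cong) (auto simp: indicator_def)
    then show ?thesis unfolding I_def by (subst (asm) nn_integral_add) auto
  qed
  have closed: "(\<integral>\<^sup>+ x\<in>{a..b}. f x \<partial>lborel) = I a b" for a b
  proof -
    have "AE x in lborel. x \<noteq> b" by (rule AE_lborel_singleton)
    then show ?thesis unfolding I_def
      by (intro nn_integral_cong_AE) (auto elim!: eventually_mono simp: indicator_def)
  qed
  define k where "k = \<lfloor>a / T\<rfloor>"
  define a' where "a' = a - of_int k * T"
  have "of_int k \<le> a / T" "a / T < of_int k + 1" unfolding k_def by linarith+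
  then have a': "0 \<le> a'" "a' \<le> T" unfolding a'_def using T by (auto simp: field_simps)
  have "I a (a + T) = I a' (a' + T)" using shift[of a' k "a' + T"] by (simp add: a'_def algebra_simps)
  also have "\<dots> = I a' T + I T (a' + T)" using a' by (intro split) auto
  also have "I T (a' + T) = I 0 a'" using shift[of 0 1 a'] by simp
  also have "I a' T + I 0 a' = I 0 T" using split[of 0 a' T] a' by (simp add: add.commute)
  finally show ?thesis by (simp add: closed)
qed

text \<open>The starting point \<open>a\<close> of the period is kept free: Poisson kernels are centred at \<open>0\<close> and call for
  \<open>[-\<pi>, \<pi>]\<close>.\<close>
lemma nn_integral_circle_rotate:
  fixes f :: "complex \<Rightarrow> ennreal"
  assumes m: "(\<lambda>\<theta>. f (cis \<theta>)) \<in> borel_measurable borel"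
  shows "(\<integral>\<^sup>+ \<theta>\<in>{a..a+2*pi}. f (cis (\<theta> + \<alpha>)) \<partial>lborel) = (\<integral>\<^sup>+ \<theta>\<in>{0..2*pi}. f (cis \<theta>) \<partial>lborel)"
proof -
  have "(\<integral>\<^sup>+ \<theta>\<in>{a+\<alpha>..a+\<alpha>+2*pi}. f (cis \<theta>) \<partial>lborel)
     = (\<integral>\<^sup>+ \<theta>. f (cis (\<alpha> + 1 * \<theta>)) * indicator {a+\<alpha>..a+\<alpha>+2*pi} (\<alpha> + 1 * \<theta>) \<partial>lborel)"
    using m by (subst nn_integral_real_affine[where c=1 and t=\<alpha>]) auto
  also have "\<dots> = (\<integral>\<^sup>+ \<theta>\<in>{a..a+2*pi}. f (cis (\<theta> + \<alpha>)) \<partial>lborel)"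
    by (intro nn_integral_cong) (auto simp: indicator_def add.commute)
  finally show ?thesis
    using nn_integral_period[of "\<lambda>\<theta>. f (cis \<theta>)" "2*pi" "a+\<alpha>"] m by (simp flip: cis_mult)
qed

lemma circle_Lp_rotate:
  assumes "(\<lambda>\<theta>. g (cis \<theta>)) \<in> borel_measurable borel" "p \<ge> 1" "C \<ge> 0"
    "circle_Lp p (\<lambda>\<theta>. g (cis \<theta>)) \<le> ennreal C"
  shows "circle_Lp p (\<lambda>\<theta>. g (cis (\<theta> + \<alpha>))) \<le> ennreal C"
  using assms nn_integral_circle_rotate[where f="\<lambda>z. ennreal (g z powr p)" and a=0 and \<alpha>=\<alpha>]
  by (simp add: circle_Lp_le_iff)

section \<open>Majorants and integration along paths in the disk\<close>

lemma majorantD: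
  assumes "majorant \<omega>"
  shows "\<And>t. t \<ge> 0 \<Longrightarrow> 0 \<le> \<omega> t" "\<omega> 0 = 0"
    "\<And>s t. 0 \<le> s \<Longrightarrow> s \<le> t \<Longrightarrow> \<omega> s \<le> \<omega> t"
    "\<And>s t. 0 < s \<Longrightarrow> s \<le> t \<Longrightarrow> \<omega> t / t \<le> \<omega> s / s"
    "continuous_on {0..} \<omega>"
  using assms unfolding majorant_def by (auto simp: mono_on_def monotone_on_def)

text \<open>A substitute for the doubling property: changing the argument by a constant factor costs that factor.\<close>
lemma majorant_scale:
  assumes "majorant \<omega>" "c \<ge> 1" "t \<ge> 0"
  shows "\<omega> (c * t) \<le> c * \<omega> t"
proof (cases "t = 0")
  case True then show ?thesis using majorantD[OF assms(1)] by simp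
next
  case False
  then have t: "t > 0" using assms by simp
  have "t \<le> c * t" using t assms(2) by simp
  from majorantD(4)[OF assms(1) t this] have "\<omega> (c * t) / (c * t) \<le> \<omega> t / t" .
  then show ?thesis using t assms(2) by (simp add: field_simps)
qed

lemma continuous_on_majorant_ratio:
  assumes "majorant \<omega>" "continuous_on S f" "\<And>x. x \<in> S \<Longrightarrow> 0 < f x"
  shows "continuous_on S (\<lambda>x. \<omega> (f x) / f x)"
proof -
  have "f ` S \<subseteq> {0..}" using assms(3) by (auto intro: less_imp_le)
  then have "continuous_on S (\<lambda>x. \<omega> (f x))"
    by (rule continuous_on_compose2[OF majorantD(5)[OF assms(1)] assms(2)])
  then show ?thesis using assms(2,3) by (intro continuous_on_divide) (auto dest: assms(3))
qed

text \<open>Beyond a point \<open>\<delta>\<^sub>1\<close> below the threshold of the definition the integrand is at most \<open>\<omega> \<delta> / \<delta>\<^sub>1\<close>, so the estimate extends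
  to all of \<open>(0, 1]\<close>.\<close>
lemma fast_majorant_unit_interval:
  assumes "fast_majorant \<omega>"
  obtains M where "M > 0"
    "\<And>\<delta>. 0 < \<delta> \<Longrightarrow> \<delta> \<le> 1 \<Longrightarrow> (\<integral>\<^sup>+ t\<in>{0<..<\<delta>}. ennreal (\<omega> t / t) \<partial>lborel) \<le> ennreal (M * \<omega> \<delta>)"
proof -
  from assms obtain \<delta>\<^sub>0 M where maj: "majorant \<omega>" and \<delta>\<^sub>0: "\<delta>\<^sub>0 > 0" and M: "M > 0"
    and *: "\<And>\<delta>. 0 < \<delta> \<Longrightarrow> \<delta> < \<delta>\<^sub>0 \<Longrightarrow>
        (\<integral>\<^sup>+ t\<in>{0<..<\<delta>}. ennreal (\<omega> t / t) \<partial>lborel) \<le> ennreal (M * \<omega> \<delta>)"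
    unfolding fast_majorant_def by blast
  note m = majorantD[OF maj]
  define \<delta>\<^sub>1 where "\<delta>\<^sub>1 = \<delta>\<^sub>0 / 2"
  have \<delta>\<^sub>1: "0 < \<delta>\<^sub>1" "\<delta>\<^sub>1 < \<delta>\<^sub>0" using \<delta>\<^sub>0 by (auto simp: \<delta>\<^sub>1_def)
  show thesis
  proof (rule that[of "M + 1 / \<delta>\<^sub>1"])
    show "M + 1 / \<delta>\<^sub>1 > 0" using M \<delta>\<^sub>1 by (simp add: add_pos_pos)
    fix \<delta> :: real assume d: "0 < \<delta>" "\<delta> \<le> 1"
    show "(\<integral>\<^sup>+ t\<in>{0<..<\<delta>}. ennreal (\<omega> t / t) \<partial>lborel) \<le> ennreal ((M + 1 / \<delta>\<^sub>1) * \<omega> \<delta>)"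
    proof (cases "\<delta> < \<delta>\<^sub>0")
      case True
      have "M * \<omega> \<delta> \<le> (M + 1 / \<delta>\<^sub>1) * \<omega> \<delta>" using m d \<delta>\<^sub>1 by (intro mult_right_mono) auto
      then show ?thesis using *[OF d(1) True] by (meson ennreal_leI order_trans)
    next
      case False
      have "(\<integral>\<^sup>+ t\<in>{0<..<\<delta>}. ennreal (\<omega> t / t) \<partial>lborel)
        \<le> (\<integral>\<^sup>+ t. ennreal (\<omega> t / t) * indicator {0<..<\<delta>\<^sub>1} t + ennreal (\<omega> \<delta> / \<delta>\<^sub>1) * indicator {\<delta>\<^sub>1..1} t \<partial>lborel)"
      proof (intro nn_integral_mono)
        fix t
        have "ennreal (\<omega> t / t) \<le> ennreal (\<omega> \<delta> / \<delta>\<^sub>1)" if "\<delta>\<^sub>1 \<le> t" "t < \<delta>"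
          using that \<delta>\<^sub>1 m d by (intro ennreal_leI frac_le) auto
        then show "ennreal (\<omega> t / t) * indicator {0<..<\<delta>} t
          \<le> ennreal (\<omega> t / t) * indicator {0<..<\<delta>\<^sub>1} t + ennreal (\<omega> \<delta> / \<delta>\<^sub>1) * indicator {\<delta>\<^sub>1..1} t"
          using d by (auto simp: indicator_def)
      qed
      also have "\<dots> = (\<integral>\<^sup>+ t\<in>{0<..<\<delta>\<^sub>1}. ennreal (\<omega> t / t) \<partial>lborel) + ennreal (\<omega> \<delta> / \<delta>\<^sub>1) * emeasure lborel {\<delta>\<^sub>1..1}"
      proof (subst nn_integral_add)
        have "continuous_on {0<..<\<delta>\<^sub>1} (\<lambda>t. \<omega> t / t)"
          by (intro continuous_on_majorant_ratio[OF maj]) (auto intro!: continuous_intros)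
        then have "(\<lambda>t. indicator {0<..<\<delta>\<^sub>1} t *\<^sub>R (\<omega> t / t)) \<in> borel_measurable borel"
          by (intro borel_measurable_continuous_on_indicator) auto
        then have "(\<lambda>t. ennreal (indicator {0<..<\<delta>\<^sub>1} t *\<^sub>R (\<omega> t / t))) \<in> borel_measurable borel" by simp
        also have "(\<lambda>t. ennreal (indicator {0<..<\<delta>\<^sub>1} t *\<^sub>R (\<omega> t / t))) = (\<lambda>t. ennreal (\<omega> t / t) * indicator {0<..<\<delta>\<^sub>1} t)"
          by (auto simp: indicator_def)
        finally show "(\<lambda>t. ennreal (\<omega> t / t) * indicator {0<..<\<delta>\<^sub>1} t) \<in> borel_measurable lborel" by simp
      qed (auto simp: nn_integral_cmult)
      also have "\<dots> \<le> ennreal (M * \<omega> \<delta>\<^sub>1) + ennreal (\<omega> \<delta> / \<delta>\<^sub>1) * ennreal 1"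
        using *[OF \<delta>\<^sub>1] False \<delta>\<^sub>1 by (intro add_mono mult_left_mono) (auto simp: emeasure_lborel_Icc_eq)
      also have "\<dots> = ennreal (M * \<omega> \<delta>\<^sub>1 + \<omega> \<delta> / \<delta>\<^sub>1)"
        using m M \<delta>\<^sub>1 d by simp
      also have "\<dots> \<le> ennreal ((M + 1 / \<delta>\<^sub>1) * \<omega> \<delta>)"
        using m(3)[of \<delta>\<^sub>1 \<delta>] \<delta>\<^sub>1 False M by (intro ennreal_leI) (auto simp: distrib_right)
      finally show ?thesis .
    qed
  qed
qed

lemma nn_integral_Ioo_continuous:
  fixes f :: "real \<Rightarrow> real"
  assumes c: "continuous_on {a..b} f" and nn: "\<And>t. t \<in> {a..b} \<Longrightarrow> 0 \<le> f t"
  shows "(\<integral>\<^sup>+ t\<in>{a<..<b}. ennreal (f t) \<partial>lborel) = ennreal (integral {a..b} f)"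
proof -
  have si: "set_integrable lborel {a..b} f"
    using c by (rule borel_integrable_atLeastAtMost')
  have "AE x in lborel. x \<noteq> a \<and> x \<noteq> b"
    using AE_lborel_singleton[of a] AE_lborel_singleton[of b] by eventually_elim simp
  then have "(\<integral>\<^sup>+ t\<in>{a<..<b}. ennreal (f t) \<partial>lborel) = (\<integral>\<^sup>+ t. ennreal (indicator {a..b} t *\<^sub>R f t) \<partial>lborel)"
    by (intro nn_integral_cong_AE, elim eventually_mono) (auto simp: indicator_def)
  also have "\<dots> = ennreal (LINT t:{a..b}|lborel. f t)"
    unfolding set_lebesgue_integral_def using si nn
    by (intro nn_integral_eq_integral) (auto simp: set_integrable_def indicator_def)
  finally show ?thesis using set_borel_integral_eq_integral(2)[OF si] by simp
qed

lemma borel_measurable_pair_restrict: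
  fixes g :: "real \<Rightarrow> real \<Rightarrow> real"
  assumes c: "continuous_on (A \<times> UNIV) (\<lambda>(t, \<theta>). g t \<theta>)" and A: "A \<in> sets borel"
  shows "(\<lambda>(t, \<theta>). g t \<theta>) \<in> borel_measurable (restrict_space lborel A \<Otimes>\<^sub>M lborel)"
proof -
  let ?f = "\<lambda>x. indicator (A \<times> UNIV) x *\<^sub>R (case x of (t, \<theta>) \<Rightarrow> g t \<theta>)"
  have "A \<times> UNIV \<in> sets (borel \<Otimes>\<^sub>M borel :: (real \<times> real) measure)"
    by (rule pair_measureI) (use A in simp_all)
  then have "?f \<in> borel_measurable (borel \<Otimes>\<^sub>M borel)"
    unfolding borel_prod by (intro borel_measurable_continuous_on_indicator c)
  then have f: "?f \<in> borel_measurable (lborel \<Otimes>\<^sub>M lborel)" by simp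
  have "(\<lambda>x. (fst x, snd x)) \<in> (restrict_space lborel A \<Otimes>\<^sub>M lborel) \<rightarrow>\<^sub>M (lborel \<Otimes>\<^sub>M lborel)"
    by (intro measurable_Pair measurable_snd measurable_compose[OF measurable_fst] measurable_restrict_space1) simp
  from measurable_compose[OF this f]
  have "(\<lambda>x. ?f (fst x, snd x)) \<in> borel_measurable (restrict_space lborel A \<Otimes>\<^sub>M lborel)" .
  then show ?thesis
    by (rule measurable_cong[THEN iffD1, rotated]) (auto simp: space_pair_measure space_restrict_space)
qed

lemma finite_measure_restrict_Ioo: "finite_measure (restrict_space lborel {a<..<b :: real})"
  by (rule finite_measureI, cases "a \<le> b") (auto simp: emeasure_restrict_space space_restrict_space)

text \<open>The function \<open>k\<close> bounds the local Lipschitz constant of \<open>F\<close> at every point of the disk. Both points \<open>a\<close>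
  and \<open>b\<close> vary, so that the bound can be integrated along a path by bisection. This
  covers \<open>\<omega> (1 - |\<phi>|)\<close>, which need not be differentiable where \<open>\<phi>\<close> vanishes.\<close>
definition slope_le :: "(complex \<Rightarrow> complex) \<Rightarrow> (complex \<Rightarrow> real) \<Rightarrow> bool" where
  "slope_le F k \<longleftrightarrow> (\<forall>z\<in>unit_disk. \<forall>e>0. \<exists>\<delta>>0. \<forall>a\<in>ball z \<delta>. \<forall>b\<in>ball z \<delta>.
     norm (F b - F a) \<le> (k z + e) * norm (b - a))"

text \<open>The claim with an additional error \<open>e (y - x)\<close> is additive over adjacent intervals and holds on short ones,
  so it holds on the whole interval by bisection.\<close>
lemma slope_le_segment:
  assumes F: "slope_le F k" and k: "continuous_on unit_disk k"
    and T: "T \<ge> 0" and seg: "\<And>t. 0 \<le> t \<Longrightarrow> t \<le> T \<Longrightarrow> a + of_real t * v \<in> unit_disk"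
  shows "norm (F (a + of_real T * v) - F a) \<le> integral {0..T} (\<lambda>t. norm v * k (a + of_real t * v))"
proof -
  define \<gamma> where "\<gamma> = (\<lambda>t. a + of_real t * v)"
  define \<kappa> where "\<kappa> = (\<lambda>t. norm v * k (\<gamma> t))"
  have \<kappa>: "continuous_on {0..T} \<kappa>"
    unfolding \<kappa>_def \<gamma>_def using seg
    by (intro continuous_intros continuous_on_compose2[OF k]) (auto simp del: mem_ball_0)
  have "norm (F (\<gamma> T) - F (\<gamma> 0)) \<le> integral {0..T} \<kappa> + e" if e: "e > 0" for e
  proof -
    define e' where "e' = e / (T + 1)"
    have e': "e' > 0" using e T by (simp add: e'_def)
    define P where "P = (\<lambda>x y. 0 \<le> x \<and> x \<le> y \<and> y \<le> T \<longrightarrow>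
      norm (F (\<gamma> y) - F (\<gamma> x)) \<le> integral {x..y} \<kappa> + e' * (y - x))"
    have "P 0 T"
      using T
    proof (induction rule: Bolzano)
      case (trans x y z)
      show ?case unfolding P_def
      proof
        assume *: "0 \<le> x \<and> x \<le> z \<and> z \<le> T"
        have "\<kappa> integrable_on {x..z}"
          using * by (intro integrable_continuous_real continuous_on_subset[OF \<kappa>]) auto
        then have I: "integral {x..y} \<kappa> + integral {y..z} \<kappa> = integral {x..z} \<kappa>"
          using trans by (intro Henstock_Kurzweil_Integration.integral_combine) auto
        have "norm (F (\<gamma> z) - F (\<gamma> x)) \<le> norm (F (\<gamma> y) - F (\<gamma> x)) + norm (F (\<gamma> z) - F (\<gamma> y))"
          using norm_triangle_ineq[of "F (\<gamma> y) - F (\<gamma> x)" "F (\<gamma> z) - F (\<gamma> y)"] by (simp add: algebra_simps)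
        also have "\<dots> \<le> (integral {x..y} \<kappa> + e' * (y - x)) + (integral {y..z} \<kappa> + e' * (z - y))"
          using trans * unfolding P_def by (intro add_mono) auto
        finally show "norm (F (\<gamma> z) - F (\<gamma> x)) \<le> integral {x..z} \<kappa> + e' * (z - x)"
          unfolding I[symmetric] by (simp add: algebra_simps)
      qed
    next
      case (local x)
      \<comment> \<open>Half of the error goes to the slope, the other half to the oscillation of \<open>\<kappa>\<close>.\<close>
      define e1 where "e1 = e' / (2 * (norm v + 1))"
      have nv: "norm v + 1 > 0" by (simp add: add_nonneg_pos)
      have e1: "e1 > 0" "e1 * norm v \<le> e' / 2"
        using e' nv by (auto simp: e1_def field_simps)
      have "\<gamma> x \<in> unit_disk" unfolding \<gamma>_def using seg local by blast
      then obtain \<delta> where \<delta>: "\<delta> > 0" and D: "\<And>a b. a \<in> ball (\<gamma> x) \<delta> \<Longrightarrow> b \<in> ball (\<gamma> x) \<delta> \<Longrightarrow>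
          norm (F b - F a) \<le> (k (\<gamma> x) + e1) * norm (b - a)"
        using F e1(1) unfolding slope_le_def by blast
      have "\<exists>d>0. \<forall>s\<in>{0..T}. dist s x < d \<longrightarrow> dist (\<kappa> s) (\<kappa> x) < e' / 2"
        using \<kappa> local e' unfolding continuous_on_iff by (meson atLeastAtMost_iff half_gt_zero)
      then obtain d where d: "d > 0" and dd: "\<And>s. s \<in> {0..T} \<Longrightarrow> dist s x < d \<Longrightarrow> dist (\<kappa> s) (\<kappa> x) < e' / 2"
        by blast
      show ?case
      proof (intro exI conjI allI impI)
        show "min d (\<delta> / (norm v + 1)) > 0" using d \<delta> nv by simp
        fix s t assume st: "s \<le> x \<and> x \<le> t \<and> t - s < min d (\<delta> / (norm v + 1))"
        show "P s t" unfolding P_def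
        proof
          assume bd: "0 \<le> s \<and> s \<le> t \<and> t \<le> T"
          have in_ball: "\<gamma> r \<in> ball (\<gamma> x) \<delta>" if "s \<le> r" "r \<le> t" for r
          proof -
            have "norm v * \<bar>x - r\<bar> \<le> norm v * (t - s)" using that st by (intro mult_left_mono) auto
            also have "\<dots> \<le> (norm v + 1) * (t - s)" using st by (intro mult_right_mono) auto
            also have "\<dots> < \<delta>" using st nv by (simp add: field_simps)
            finally have "norm v * \<bar>x - r\<bar> < \<delta>" .
            moreover have "norm (\<gamma> x - \<gamma> r) = norm v * \<bar>x - r\<bar>"
            proof -
              have "\<gamma> x - \<gamma> r = of_real (x - r) * v" by (simp add: \<gamma>_def algebra_simps)
              then show ?thesis by (simp only: norm_mult norm_of_real mult.commute)
            qed
            ultimately show ?thesis by (simp add: dist_norm)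
          qed
          have "norm (F (\<gamma> t) - F (\<gamma> s)) \<le> (k (\<gamma> x) + e1) * norm (\<gamma> t - \<gamma> s)"
            using bd by (intro D in_ball) auto
          also have "\<gamma> t - \<gamma> s = of_real (t - s) * v" by (simp add: \<gamma>_def algebra_simps)
          also have "(k (\<gamma> x) + e1) * norm (of_real (t - s) * v) = (\<kappa> x + e1 * norm v) * (t - s)"
            using bd unfolding norm_mult norm_of_real by (simp add: \<kappa>_def algebra_simps)
          also have "\<dots> \<le> (\<kappa> x + e' / 2) * (t - s)" using e1 bd by (intro mult_right_mono) auto
          also have "\<dots> = (\<kappa> x - e' / 2) * (t - s) + e' * (t - s)" by (simp add: algebra_simps)
          also have "(\<kappa> x - e' / 2) * (t - s) = integral {s..t} (\<lambda>_. \<kappa> x - e' / 2)" using bd by simp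
          also have "\<dots> \<le> integral {s..t} \<kappa>"
          proof (rule integral_le)
            show "\<kappa> integrable_on {s..t}"
              using bd by (intro integrable_continuous_real continuous_on_subset[OF \<kappa>]) auto
            fix r assume "r \<in> {s..t}"
            then have "r \<in> {0..T}" "dist r x < d" using st bd by (auto simp: dist_real_def abs_less_iff)
            from dd[OF this] show "\<kappa> x - e' / 2 \<le> \<kappa> r" by (simp only: dist_real_def abs_less_iff) linarith
          qed (rule integrable_const_ivl)
          finally show "norm (F (\<gamma> t) - F (\<gamma> s)) \<le> integral {s..t} \<kappa> + e' * (t - s)" by simp
        qed
      qed
    qed
    then have "norm (F (\<gamma> T) - F (\<gamma> 0)) \<le> integral {0..T} \<kappa> + e' * T"
      unfolding P_def using T by simp
    moreover have "e' * T \<le> e" using e T by (simp add: e'_def field_simps)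
    ultimately show ?thesis by linarith
  qed
  then have "norm (F (\<gamma> T) - F (\<gamma> 0)) \<le> integral {0..T} \<kappa>" by (rule field_le_epsilon)
  then show ?thesis by (simp add: \<gamma>_def \<kappa>_def)
qed

text \<open>The path runs from \<open>z\<^sub>1\<close> inwards to \<open>(1 - \<delta>) z\<^sub>1\<close>, then along a segment to \<open>(1 - \<delta>) z\<^sub>2\<close>, and outwards to \<open>z\<^sub>2\<close>.
  The straight segment from \<open>z\<^sub>1\<close> to \<open>z\<^sub>2\<close> would be too close to the circle.\<close>
lemma slope_le_radial_path:
  assumes F: "slope_le F k" and k: "continuous_on unit_disk k" "\<And>z. z \<in> unit_disk \<Longrightarrow> 0 \<le> k z"
    and z: "z\<^sub>1 \<in> unit_disk" "z\<^sub>2 \<in> unit_disk" and \<delta>: "0 \<le> \<delta>" "\<delta> \<le> 1"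
    and v: "v = of_real (1 - \<delta>) * (z\<^sub>2 - z\<^sub>1)" 
  shows "norm (F z\<^sub>1 - F z\<^sub>2) \<le>
     integral {0..\<delta>} (\<lambda>t. k (of_real (1 - t) * z\<^sub>1)) + integral {0..\<delta>} (\<lambda>t. k (of_real (1 - t) * z\<^sub>2))
     + integral {0..1} (\<lambda>t. norm v * k (of_real (1 - \<delta>) * z\<^sub>1 + of_real t * v))"
proof -
  have inD: "of_real (1 - t) * z \<in> unit_disk" if "z \<in> unit_disk" "0 \<le> t" "t \<le> 1" for t z
  proof -
    have "norm (of_real (1 - t) * z) \<le> 1 * norm z"
      using that unfolding norm_mult norm_of_real by (intro mult_right_mono) auto
    then show ?thesis using that by simp
  qed
  have radial: "norm (F (of_real (1 - \<delta>) * z) - F z) \<le> integral {0..\<delta>} (\<lambda>t. k (of_real (1 - t) * z))"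
    if z: "z \<in> unit_disk" for z
  proof -
    have eq: "z + of_real t * (- z) = of_real (1 - t) * z" for t by (simp add: algebra_simps)
    have "norm (F (z + of_real \<delta> * (- z)) - F z) \<le> integral {0..\<delta>} (\<lambda>t. norm (- z) * k (z + of_real t * (- z)))"
      using inD[OF z] \<delta> by (intro slope_le_segment[OF F k(1)]) (auto simp only: eq)
    also have "\<dots> \<le> integral {0..\<delta>} (\<lambda>t. k (of_real (1 - t) * z))"
    proof (rule integral_le)
      have c: "continuous_on {0..\<delta>} (\<lambda>t. k (of_real (1 - t) * z))"
        using inD[OF z] \<delta> by (intro continuous_on_compose2[OF k(1)]) (auto intro!: continuous_intros simp del: mem_ball_0)
      then show "(\<lambda>t. k (of_real (1 - t) * z)) integrable_on {0..\<delta>}"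
        by (rule integrable_continuous_real)
      show "(\<lambda>t. norm (- z) * k (z + of_real t * (- z))) integrable_on {0..\<delta>}"
        unfolding eq by (intro integrable_continuous_real continuous_intros c)
      fix t assume "t \<in> {0..\<delta>}"
      then have "0 \<le> k (of_real (1 - t) * z)" using inD[OF z] \<delta> k(2) by auto
      then show "norm (- z) * k (z + of_real t * (- z)) \<le> k (of_real (1 - t) * z)"
        unfolding eq using z by (intro mult_left_le_one_le) auto
    qed
    finally show ?thesis unfolding eq .
  qed
  have "norm (F (of_real (1 - \<delta>) * z\<^sub>1 + of_real 1 * v) - F (of_real (1 - \<delta>) * z\<^sub>1))
     \<le> integral {0..1} (\<lambda>t. norm v * k (of_real (1 - \<delta>) * z\<^sub>1 + of_real t * v))"
  proof (rule slope_le_segment[OF F k(1)])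
    fix t :: real assume t: "0 \<le> t" "t \<le> 1"
    have "of_real (1 - \<delta>) * z\<^sub>1 + of_real t * v = (1 - t) *\<^sub>R (of_real (1 - \<delta>) * z\<^sub>1) + t *\<^sub>R (of_real (1 - \<delta>) * z\<^sub>2)"
      unfolding v by (simp add: scaleR_conv_of_real algebra_simps)
    moreover have "\<dots> \<in> unit_disk"
      using t inD[OF z(1), of \<delta>] inD[OF z(2), of \<delta>] \<delta> by (intro convexD[OF convex_ball]) auto
    ultimately show "of_real (1 - \<delta>) * z\<^sub>1 + of_real t * v \<in> unit_disk" by simp
  qed simp
  also have "of_real (1 - \<delta>) * z\<^sub>1 + of_real 1 * v = of_real (1 - \<delta>) * z\<^sub>2"
    unfolding v by (simp add: algebra_simps)
  finally have mid: "norm (F (of_real (1 - \<delta>) * z\<^sub>2) - F (of_real (1 - \<delta>) * z\<^sub>1))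
     \<le> integral {0..1} (\<lambda>t. norm v * k (of_real (1 - \<delta>) * z\<^sub>1 + of_real t * v))" .
  have "F z\<^sub>1 - F z\<^sub>2 = (F (of_real (1 - \<delta>) * z\<^sub>2) - F z\<^sub>2) - (F (of_real (1 - \<delta>) * z\<^sub>1) - F z\<^sub>1)
      - (F (of_real (1 - \<delta>) * z\<^sub>2) - F (of_real (1 - \<delta>) * z\<^sub>1))" by simp
  then have "norm (F z\<^sub>1 - F z\<^sub>2) \<le> norm (F (of_real (1 - \<delta>) * z\<^sub>2) - F z\<^sub>2) + norm (F (of_real (1 - \<delta>) * z\<^sub>1) - F z\<^sub>1)
      + norm (F (of_real (1 - \<delta>) * z\<^sub>2) - F (of_real (1 - \<delta>) * z\<^sub>1))"
    using norm_triangle_ineq4[of "F (of_real (1 - \<delta>) * z\<^sub>2) - F z\<^sub>2 - (F (of_real (1 - \<delta>) * z\<^sub>1) - F z\<^sub>1)"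
        "F (of_real (1 - \<delta>) * z\<^sub>2) - F (of_real (1 - \<delta>) * z\<^sub>1)"]
      norm_triangle_ineq4[of "F (of_real (1 - \<delta>) * z\<^sub>2) - F z\<^sub>2" "F (of_real (1 - \<delta>) * z\<^sub>1) - F z\<^sub>1"]
    by simp
  then show ?thesis using radial[OF z(1)] radial[OF z(2)] mid by linarith
qed

lemma disk_scale:
  assumes "z \<in> unit_disk" "0 \<le> t" "t \<le> 1"
  shows "of_real (1 - t) * z \<in> unit_disk" "t \<le> disk_dist (of_real (1 - t) * z)"
proof -
  have "norm (of_real (1 - t) * z) \<le> 1 * norm z"
    using assms unfolding norm_mult norm_of_real by (intro mult_right_mono) auto
  then show "of_real (1 - t) * z \<in> unit_disk" using assms by simp
  have "norm (of_real (1 - t) * z) \<le> (1 - t) * 1"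
    using assms unfolding norm_mult norm_of_real by (intro mult_mono) auto
  then show "t \<le> disk_dist (of_real (1 - t) * z)" by (simp add: disk_dist_def)
qed

text \<open>The middle piece of the path has length at most \<open>\<delta>\<close> and distance at least \<open>\<delta>\<close> from the circle. For
  \<open>\<delta> = 1\<close> it degenerates to the origin.\<close>
lemma inner_segment:
  assumes z: "z\<^sub>1 \<in> unit_disk" "z\<^sub>2 \<in> unit_disk"
    and \<delta>: "\<delta> = min 1 (dist z\<^sub>1 z\<^sub>2)" and v: "v = of_real (1 - \<delta>) * (z\<^sub>2 - z\<^sub>1)"
  shows "norm v \<le> \<delta>"
    and "0 \<le> t \<Longrightarrow> t \<le> 1 \<Longrightarrow> of_real (1 - \<delta>) * z\<^sub>1 + of_real t * v \<in> unit_disk"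
    and "0 \<le> t \<Longrightarrow> t \<le> 1 \<Longrightarrow> \<delta> \<le> disk_dist (of_real (1 - \<delta>) * z\<^sub>1 + of_real t * v)"
proof -
  show "norm v \<le> \<delta>"
  proof (cases "dist z\<^sub>1 z\<^sub>2 \<le> 1")
    case True
    then have "norm v \<le> 1 * dist z\<^sub>1 z\<^sub>2"
      unfolding v norm_mult norm_of_real by (intro mult_mono) (auto simp: \<delta> dist_norm norm_minus_commute)
    then show ?thesis using True by (simp add: \<delta>)
  qed (simp add: v \<delta>)
  assume t: "0 \<le> t" "t \<le> 1"
  have "of_real (1 - t) * z\<^sub>1 + of_real t * z\<^sub>2 \<in> unit_disk"
    using convexD[OF convex_ball, of z\<^sub>1 0 1 z\<^sub>2 "1-t" t] z t by (simp add: scaleR_conv_of_real)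
  note this[THEN disk_scale(1), of \<delta>] this[THEN disk_scale(2), of \<delta>]
  moreover have "of_real (1 - \<delta>) * z\<^sub>1 + of_real t * v = of_real (1 - \<delta>) * (of_real (1 - t) * z\<^sub>1 + of_real t * z\<^sub>2)"
    unfolding v by (simp add: algebra_simps)
  ultimately show "of_real (1 - \<delta>) * z\<^sub>1 + of_real t * v \<in> unit_disk"
    "\<delta> \<le> disk_dist (of_real (1 - \<delta>) * z\<^sub>1 + of_real t * v)"
    by (auto simp: \<delta>)
qed

lemma fast_majorant_integral:
  assumes \<omega>: "fast_majorant \<omega>"
  obtains Mf where "Mf > 0"
    "\<And>\<delta> M. 0 < \<delta> \<Longrightarrow> \<delta> \<le> 1 \<Longrightarrow> 0 \<le> M \<Longrightarrow>
      (\<integral>\<^sup>+ t\<in>{0<..<\<delta>}. ennreal (M * (\<omega> t / t)) \<partial>lborel) \<le> ennreal (M * Mf * \<omega> \<delta>)"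
proof -
  have maj: "majorant \<omega>" using \<omega> by (simp add: fast_majorant_def)
  note m = majorantD[OF maj]
  obtain Mf where Mf: "Mf > 0" and fast: "\<And>\<delta>. 0 < \<delta> \<Longrightarrow> \<delta> \<le> 1 \<Longrightarrow>
      (\<integral>\<^sup>+ t\<in>{0<..<\<delta>}. ennreal (\<omega> t / t) \<partial>lborel) \<le> ennreal (Mf * \<omega> \<delta>)"
    using fast_majorant_unit_interval[OF \<omega>] by blast
  show thesis
  proof (rule that[OF Mf])
    fix \<delta> M :: real assume \<delta>: "0 < \<delta>" "\<delta> \<le> 1" and M: "0 \<le> M"
    have "(\<integral>\<^sup>+ t\<in>{0<..<\<delta>}. ennreal (M * (\<omega> t / t)) \<partial>lborel)
       = (\<integral>\<^sup>+ t. ennreal M * ennreal (\<omega> t / t) \<partial>restrict_space lborel {0<..<\<delta>})"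
      using M m by (subst nn_integral_restrict_space)
        (auto intro!: nn_integral_cong simp: indicator_def ennreal_mult simp del: times_divide_eq_right)
    also have "\<dots> = ennreal M * (\<integral>\<^sup>+ t. ennreal (\<omega> t / t) \<partial>restrict_space lborel {0<..<\<delta>})"
    proof (rule nn_integral_cmult)
      have "continuous_on {0<..<\<delta>} (\<lambda>t. \<omega> t / t)"
        by (intro continuous_on_majorant_ratio[OF maj]) (auto intro!: continuous_intros)
      from borel_measurable_continuous_on_restrict[OF this]
      have "(\<lambda>t. \<omega> t / t) \<in> borel_measurable (restrict_space lborel {0<..<\<delta>})"
        by (simp cong: measurable_cong_sets sets_restrict_space_cong)
      then show "(\<lambda>t. ennreal (\<omega> t / t)) \<in> borel_measurable (restrict_space lborel {0<..<\<delta>})" by simp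
    qed
    also have "\<dots> \<le> ennreal M * ennreal (Mf * \<omega> \<delta>)"
      using fast[OF \<delta>] by (intro mult_left_mono) (auto simp: nn_integral_restrict_space)
    also have "\<dots> = ennreal (M * Mf * \<omega> \<delta>)" using M Mf m \<delta> by (simp add: ennreal_mult mult.assoc)
    finally show "(\<integral>\<^sup>+ t\<in>{0<..<\<delta>}. ennreal (M * (\<omega> t / t)) \<partial>lborel) \<le> ennreal (M * Mf * \<omega> \<delta>)" .
  qed
qed

section \<open>From pointwise slopes to moduli of continuity in the mean\<close>

lemma continuous_on_slice:
  fixes g :: "real \<Rightarrow> real \<Rightarrow> real"
  assumes "continuous_on (A \<times> UNIV) (\<lambda>(t, \<theta>). g t \<theta>)"
  shows "continuous_on A (\<lambda>t. g t \<theta>)"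
proof -
  have "continuous_on A (\<lambda>t. (\<lambda>(t, \<theta>). g t \<theta>) (t, \<theta>))"
    by (rule continuous_on_compose2[OF assms]) (auto intro!: continuous_intros)
  then show ?thesis by simp
qed

lemma integral_slice_nonneg:
  fixes g :: "real \<Rightarrow> real \<Rightarrow> real"
  assumes "continuous_on ({a..b} \<times> UNIV) (\<lambda>(t, \<theta>). g t \<theta>)"
    and "\<And>t. t \<in> {a..b} \<Longrightarrow> 0 \<le> g t \<theta>"
  shows "0 \<le> integral {a..b} (\<lambda>t. g t \<theta>)"
  using assms by (intro integral_nonneg integrable_continuous_real continuous_on_slice) auto

text \<open>Minkowski's integral inequality for an interval of parameters. The bound \<open>h\<close> is required on the open
  interval only, since on radial paths it is \<open>\<omega> t / t\<close>, which may be unbounded at \<open>0\<close>.\<close>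
lemma circle_Lp_integral_le:
  fixes g :: "real \<Rightarrow> real \<Rightarrow> real" and h :: "real \<Rightarrow> real"
  assumes p: "p \<ge> 1"
    and c: "continuous_on ({a..b} \<times> UNIV) (\<lambda>(t, \<theta>). g t \<theta>)"
    and g: "\<And>t \<theta>. t \<in> {a..b} \<Longrightarrow> 0 \<le> g t \<theta>"
    and h: "continuous_on {a<..<b} h" "\<And>t. t \<in> {a<..<b} \<Longrightarrow> 0 \<le> h t"
    and le: "\<And>t. t \<in> {a<..<b} \<Longrightarrow> circle_Lp p (g t) \<le> ennreal (h t)"
    and H: "(\<integral>\<^sup>+ t\<in>{a<..<b}. ennreal (h t) \<partial>lborel) \<le> ennreal H" "0 \<le> H"
  shows "circle_Lp p (\<lambda>\<theta>. integral {a..b} (\<lambda>t. g t \<theta>)) \<le> ennreal H"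
proof (rule circle_Lp_Minkowski_integral[OF p finite_measure_restrict_Ioo])
  note ct = continuous_on_slice[OF c]
  show "(\<lambda>(t, \<theta>). g t \<theta>) \<in> borel_measurable (restrict_space lborel {a<..<b} \<Otimes>\<^sub>M lborel)"
    by (rule borel_measurable_pair_restrict) (auto intro: continuous_on_subset[OF c])
  show "h \<in> borel_measurable (restrict_space lborel {a<..<b})"
    using borel_measurable_continuous_on_restrict[OF h(1)]
    by (simp cong: measurable_cong_sets sets_restrict_space_cong)
  show "(\<integral>\<^sup>+ t. ennreal (h t) \<partial>restrict_space lborel {a<..<b}) \<le> ennreal H"
    using H by (simp add: nn_integral_restrict_space)
  show "0 \<le> integral {a..b} (\<lambda>t. g t \<theta>)" for \<theta>
    using g by (intro integral_slice_nonneg c)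
  show "ennreal (integral {a..b} (\<lambda>t. g t \<theta>)) \<le> (\<integral>\<^sup>+ t. ennreal (g t \<theta>) \<partial>restrict_space lborel {a<..<b})" for \<theta>
    using nn_integral_Ioo_continuous[OF ct, of \<theta>] g by (simp add: nn_integral_restrict_space)
qed (use g h le H in \<open>auto simp: space_restrict_space\<close>)

lemma continuous_on_integral_param:
  fixes g :: "real \<Rightarrow> real \<Rightarrow> real"
  assumes c: "continuous_on ({a..b} \<times> UNIV) (\<lambda>(t, \<theta>). g t \<theta>)"
  shows "continuous_on UNIV (\<lambda>\<theta>. integral {a..b} (\<lambda>t. g t \<theta>))"
proof -
  have "continuous_on (UNIV \<times> cbox a b) (\<lambda>x. (\<lambda>(t, \<theta>). g t \<theta>) (snd x, fst x))"
    by (rule continuous_on_compose2[OF c]) (auto intro!: continuous_intros)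
  then have "continuous_on (UNIV \<times> cbox a b) (\<lambda>(\<theta>, t). g t \<theta>)"
    by (simp add: split_beta')
  from integral_continuous_on_param[OF this] show ?thesis by simp
qed

text \<open>A theorem of Hardy and Littlewood for means. Rotations commute with the path from \<open>z\<^sub>1\<close> to \<open>z\<^sub>2\<close>, so
  Minkowski's inequality reduces the claim to the integral of \<open>\<omega> t / t\<close> over the radial pieces and to \<open>\<delta> (\<omega> \<delta> / \<delta>)\<close> for the
  middle one.\<close>
lemma slope_le_imp_Lambda_p:
  assumes p: "p \<ge> 1" and \<omega>: "fast_majorant \<omega>"
    and F: "slope_le F k" and k: "continuous_on unit_disk k" "\<And>z. z \<in> unit_disk \<Longrightarrow> 0 \<le> k z"
    and M: "M \<ge> 0" and le: "\<And>z. z \<in> unit_disk \<Longrightarrow>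
        circle_Lp p (\<lambda>\<theta>. k (z * cis \<theta>)) \<le> ennreal (M * (\<omega> (disk_dist z) / disk_dist z))"
  obtains C where "C > 0" "\<And>z\<^sub>1 z\<^sub>2. z\<^sub>1 \<in> unit_disk \<Longrightarrow> z\<^sub>2 \<in> unit_disk \<Longrightarrow>
        osc (ereal p) F z\<^sub>1 z\<^sub>2 \<le> ennreal (C * \<omega> (dist z\<^sub>1 z\<^sub>2))"
proof -
  have maj: "majorant \<omega>" using \<omega> by (simp add: fast_majorant_def)
  note m = majorantD[OF maj]
  obtain Mf where Mf: "Mf > 0" and fast: "\<And>\<delta> M. 0 < \<delta> \<Longrightarrow> \<delta> \<le> 1 \<Longrightarrow> 0 \<le> M \<Longrightarrow>
      (\<integral>\<^sup>+ t\<in>{0<..<\<delta>}. ennreal (M * (\<omega> t / t)) \<partial>lborel) \<le> ennreal (M * Mf * \<omega> \<delta>)"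
    using fast_majorant_integral[OF \<omega>] by blast
  define C where "C = M * Mf + M * Mf + M + 1"
  show thesis
  proof (rule that[of C])
    show "C > 0" using M Mf by (simp add: C_def add_nonneg_pos)
    fix z\<^sub>1 z\<^sub>2 assume z: "z\<^sub>1 \<in> unit_disk" "z\<^sub>2 \<in> unit_disk"
    define \<delta> where "\<delta> = min 1 (dist z\<^sub>1 z\<^sub>2)"
    have rot: "cis \<theta> * z \<in> unit_disk" if "z \<in> unit_disk" for \<theta> z using that by (simp add: norm_mult)
    show "osc (ereal p) F z\<^sub>1 z\<^sub>2 \<le> ennreal (C * \<omega> (dist z\<^sub>1 z\<^sub>2))"
    proof (cases "z\<^sub>1 = z\<^sub>2")
      case True
      then have "circle_Lp p (\<lambda>\<eta>. norm (F (cis \<eta> * z\<^sub>1) - F (cis \<eta> * z\<^sub>2))) \<le> ennreal 0"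
        using p by (subst circle_Lp_le_iff) auto
      then show ?thesis by (simp add: osc_def)
    next
      case False
      then have \<delta>: "0 < \<delta>" "\<delta> \<le> 1" by (auto simp: \<delta>_def)
      then have \<omega>0: "0 \<le> \<omega> \<delta>" by (intro m) simp
      define v where "v = of_real (1 - \<delta>) * (z\<^sub>2 - z\<^sub>1)"
      note inner = inner_segment[OF z \<delta>_def v_def]
      note v = inner(1) and seg_in = inner(2) and seg_d = inner(3)
      have ratio: "ennreal (M * (\<omega> (disk_dist w) / disk_dist w)) \<le> ennreal (M * (\<omega> t / t))"
        if "0 < t" "t \<le> disk_dist w" for w t
        using that M m(4) by (intro ennreal_leI mult_left_mono) auto
      define I where "I = (\<lambda>z \<theta>. integral {0..\<delta>} (\<lambda>t. k (of_real (1 - t) * (cis \<theta> * z))))"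
      define J where "J = (\<lambda>\<theta>. integral {0..1} (\<lambda>t. norm v * k (cis \<theta> * (of_real (1 - \<delta>) * z\<^sub>1 + of_real t * v))))"
      have cI: "continuous_on ({0..\<delta>} \<times> UNIV) (\<lambda>(t, \<theta>). k (of_real (1 - t) * (cis \<theta> * z)))"
        if "z \<in> unit_disk" for z
        unfolding split_beta' using disk_scale(1)[OF rot[OF that]] \<delta>
        by (intro continuous_on_compose2[OF k(1)] continuous_intros) auto
      have cJ: "continuous_on ({0..1} \<times> UNIV) (\<lambda>(t, \<theta>). norm v * k (cis \<theta> * (of_real (1 - \<delta>) * z\<^sub>1 + of_real t * v)))"
        unfolding split_beta' using rot[OF seg_in]
        by (intro continuous_on_compose2[OF k(1)] continuous_intros) auto
      have I: "circle_Lp p (I z) \<le> ennreal (M * Mf * \<omega> \<delta>)" if z: "z \<in> unit_disk" for z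
        unfolding I_def
      proof (rule circle_Lp_integral_le[OF p cI[OF z]])
        show "0 \<le> k (of_real (1 - t) * (cis \<theta> * z))" if "t \<in> {0..\<delta>}" for t \<theta>
          using that \<delta> by (intro k(2) disk_scale(1) rot z) auto
        show c: "continuous_on {0<..<\<delta>} (\<lambda>t. M * (\<omega> t / t))"
          by (intro continuous_on_mult_left continuous_on_majorant_ratio[OF maj]) (auto intro!: continuous_intros)
        show "0 \<le> M * (\<omega> t / t)" if "t \<in> {0<..<\<delta>}" for t using that M m(1)[of t] by auto
        fix t assume t: "t \<in> {0<..<\<delta>}"
        have "circle_Lp p (\<lambda>\<theta>. k (of_real (1 - t) * z * cis \<theta>)) \<le> ennreal (M * (\<omega> t / t))"
          using t \<delta> disk_scale[OF z, of t] by (intro order_trans[OF le ratio]) auto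
        then show "circle_Lp p (\<lambda>\<theta>. k (of_real (1 - t) * (cis \<theta> * z))) \<le> ennreal (M * (\<omega> t / t))"
          by (simp add: mult_ac)
      next
        show "(\<integral>\<^sup>+ t\<in>{0<..<\<delta>}. ennreal (M * (\<omega> t / t)) \<partial>lborel) \<le> ennreal (M * Mf * \<omega> \<delta>)"
          using fast \<delta> M by blast
        show "0 \<le> M * Mf * \<omega> \<delta>" using M Mf \<omega>0 by simp
      qed
      have J: "circle_Lp p J \<le> ennreal (M * \<omega> \<delta>)"
        unfolding J_def
      proof (rule circle_Lp_integral_le[OF p cJ])
        have kn: "0 \<le> k (cis \<theta> * (of_real (1 - \<delta>) * z\<^sub>1 + of_real t * v))" if "t \<in> {0..1}" for t \<theta>
          using that by (intro k(2) rot seg_in) auto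
        then show "0 \<le> norm v * k (cis \<theta> * (of_real (1 - \<delta>) * z\<^sub>1 + of_real t * v))" if "t \<in> {0..1}" for t \<theta>
          using that by simp
        show "continuous_on {0<..<1} (\<lambda>t. M * \<omega> \<delta>)" by simp
        show "0 \<le> M * \<omega> \<delta>" "0 \<le> M * \<omega> \<delta>" using M \<omega>0 by auto
        show "(\<integral>\<^sup>+ t\<in>{0<..<1::real}. ennreal (M * \<omega> \<delta>) \<partial>lborel) \<le> ennreal (M * \<omega> \<delta>)"
          by (simp add: nn_integral_cmult)
        fix t :: real assume t: "t \<in> {0<..<1}"
        define w where "w = of_real (1 - \<delta>) * z\<^sub>1 + of_real t * v"
        have w: "w \<in> unit_disk" "\<delta> \<le> disk_dist w" unfolding w_def using seg_in[of t] seg_d[of t] t by auto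
        have wr: "w * cis \<theta> \<in> unit_disk" for \<theta> using rot[OF w(1), of \<theta>] by (simp add: mult.commute)
        have c: "continuous_on UNIV (\<lambda>\<theta>. k (w * cis \<theta>))"
          using wr by (intro continuous_on_compose2[OF k(1)] continuous_intros) auto
        have "circle_Lp p (\<lambda>\<theta>. norm v * k (w * cis \<theta>)) \<le> ennreal (norm v * (M * (\<omega> \<delta> / \<delta>)))"
        proof (rule circle_Lp_cmult[OF p])
          show "circle_Lp p (\<lambda>\<theta>. k (w * cis \<theta>)) \<le> ennreal (M * (\<omega> \<delta> / \<delta>))"
            by (rule order_trans[OF le ratio]) (use w \<delta> in auto)
          show "(\<lambda>\<theta>. k (w * cis \<theta>)) \<in> borel_measurable borel"
            using c by (rule borel_measurable_continuous_onI)
        qed (use M \<omega>0 \<delta> k(2)[OF wr] in auto)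
        also have "\<dots> \<le> ennreal (M * \<omega> \<delta>)"
        proof (rule ennreal_leI)
          have "norm v * (M * (\<omega> \<delta> / \<delta>)) \<le> \<delta> * (M * (\<omega> \<delta> / \<delta>))"
            using v M \<omega>0 \<delta> by (intro mult_right_mono) auto
          then show "norm v * (M * (\<omega> \<delta> / \<delta>)) \<le> M * \<omega> \<delta>" using \<delta> by simp
        qed
        finally show "circle_Lp p (\<lambda>\<theta>. norm v * k (cis \<theta> * (of_real (1 - \<delta>) * z\<^sub>1 + of_real t * v))) \<le> ennreal (M * \<omega> \<delta>)"
          unfolding w_def by (simp add: mult.commute)
      qed
      have nnI: "0 \<le> I z \<theta>" if "z \<in> unit_disk" for z \<theta>
        unfolding I_def using \<delta> by (intro integral_slice_nonneg cI that k(2) disk_scale(1) rot) auto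
      have nnJ: "0 \<le> J \<theta>" for \<theta>
        unfolding J_def by (intro integral_slice_nonneg cJ mult_nonneg_nonneg k(2) rot seg_in) auto
      have mI: "I z \<in> borel_measurable borel" if "z \<in> unit_disk" for z
        unfolding I_def using continuous_on_integral_param[OF cI[OF that]] by (rule borel_measurable_continuous_onI)
      have mJ: "J \<in> borel_measurable borel"
        unfolding J_def using continuous_on_integral_param[OF cJ] by (rule borel_measurable_continuous_onI)
      have nonneg: "0 \<le> M * Mf * \<omega> \<delta>" "0 \<le> M * \<omega> \<delta>" using M Mf \<omega>0 by auto
      have "circle_Lp p (\<lambda>\<theta>. I z\<^sub>1 \<theta> + I z\<^sub>2 \<theta>) \<le> ennreal (M * Mf * \<omega> \<delta> + M * Mf * \<omega> \<delta>)"
        by (rule circle_Lp_triangle[OF p nonneg(1) nonneg(1) mI mI nnI nnI I I]) fact+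
      then have "circle_Lp p (\<lambda>\<theta>. (I z\<^sub>1 \<theta> + I z\<^sub>2 \<theta>) + J \<theta>) \<le> ennreal ((M * Mf * \<omega> \<delta> + M * Mf * \<omega> \<delta>) + M * \<omega> \<delta>)"
        using nonneg mI[OF z(1)] mI[OF z(2)] nnI[OF z(1)] nnI[OF z(2)]
        by (intro circle_Lp_triangle[OF p _ nonneg(2) _ mJ _ nnJ _ J]) auto
      then have "circle_Lp p (\<lambda>\<theta>. norm (F (cis \<theta> * z\<^sub>1) - F (cis \<theta> * z\<^sub>2))) \<le> ennreal ((M * Mf * \<omega> \<delta> + M * Mf * \<omega> \<delta>) + M * \<omega> \<delta>)"
      proof (rule circle_Lp_mono[OF p, rotated])
        fix \<theta> :: real
        have "norm (F (cis \<theta> * z\<^sub>1) - F (cis \<theta> * z\<^sub>2)) \<le> I z\<^sub>1 \<theta> + I z\<^sub>2 \<theta> +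
            integral {0..1} (\<lambda>t. norm (cis \<theta> * v) * k (of_real (1 - \<delta>) * (cis \<theta> * z\<^sub>1) + of_real t * (cis \<theta> * v)))"
          unfolding I_def
          using rot z \<delta> by (intro slope_le_radial_path[OF F k]) (auto simp: v_def algebra_simps)
        also have "(\<lambda>t. norm (cis \<theta> * v) * k (of_real (1 - \<delta>) * (cis \<theta> * z\<^sub>1) + of_real t * (cis \<theta> * v)))
            = (\<lambda>t. norm v * k (cis \<theta> * (of_real (1 - \<delta>) * z\<^sub>1 + of_real t * v)))"
          by (simp add: norm_mult algebra_simps)
        finally show "norm (F (cis \<theta> * z\<^sub>1) - F (cis \<theta> * z\<^sub>2)) \<le> I z\<^sub>1 \<theta> + I z\<^sub>2 \<theta> + J \<theta>"
          by (simp add: J_def)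
      qed (use nonneg in auto)
      then have "osc (ereal p) F z\<^sub>1 z\<^sub>2 \<le> ennreal ((M * Mf * \<omega> \<delta> + M * Mf * \<omega> \<delta>) + M * \<omega> \<delta>)"
        by (simp add: osc_def)
      also have "\<dots> \<le> ennreal (C * \<omega> (dist z\<^sub>1 z\<^sub>2))"
      proof (rule ennreal_leI)
        have "(M * Mf * \<omega> \<delta> + M * Mf * \<omega> \<delta>) + M * \<omega> \<delta> = (M * Mf + M * Mf + M) * \<omega> \<delta>" by (simp add: algebra_simps)
        also have "\<dots> \<le> C * \<omega> (dist z\<^sub>1 z\<^sub>2)"
          using M Mf \<omega>0 by (intro mult_mono m(3)) (auto simp: C_def \<delta>_def)
        finally show "(M * Mf * \<omega> \<delta> + M * Mf * \<omega> \<delta>) + M * \<omega> \<delta> \<le> C * \<omega> (dist z\<^sub>1 z\<^sub>2)" .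
      qed
      finally show ?thesis .
    qed
  qed
qed

text \<open>The same path, with pointwise bounds in place of means.\<close>
lemma slope_le_imp_Lambda_inf:
  assumes \<omega>: "fast_majorant \<omega>"
    and F: "slope_le F k" and k: "continuous_on unit_disk k" "\<And>z. z \<in> unit_disk \<Longrightarrow> 0 \<le> k z"
    and M: "M \<ge> 0" and le: "\<And>z. z \<in> unit_disk \<Longrightarrow> k z \<le> M * (\<omega> (disk_dist z) / disk_dist z)"
  obtains C where "C > 0" "\<And>z\<^sub>1 z\<^sub>2. z\<^sub>1 \<in> unit_disk \<Longrightarrow> z\<^sub>2 \<in> unit_disk \<Longrightarrow>
        norm (F z\<^sub>1 - F z\<^sub>2) \<le> C * \<omega> (dist z\<^sub>1 z\<^sub>2)"
proof -
  have maj: "majorant \<omega>" using \<omega> by (simp add: fast_majorant_def)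
  note m = majorantD[OF maj]
  obtain Mf where Mf: "Mf > 0" and fast: "\<And>\<delta> M. 0 < \<delta> \<Longrightarrow> \<delta> \<le> 1 \<Longrightarrow> 0 \<le> M \<Longrightarrow>
      (\<integral>\<^sup>+ t\<in>{0<..<\<delta>}. ennreal (M * (\<omega> t / t)) \<partial>lborel) \<le> ennreal (M * Mf * \<omega> \<delta>)"
    using fast_majorant_integral[OF \<omega>] by blast
  define C where "C = M * Mf + M * Mf + M + 1"
  show thesis
  proof (rule that[of C])
    show "C > 0" using M Mf by (simp add: C_def add_nonneg_pos)
    fix z\<^sub>1 z\<^sub>2 assume z: "z\<^sub>1 \<in> unit_disk" "z\<^sub>2 \<in> unit_disk"
    define \<delta> where "\<delta> = min 1 (dist z\<^sub>1 z\<^sub>2)"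
    show "norm (F z\<^sub>1 - F z\<^sub>2) \<le> C * \<omega> (dist z\<^sub>1 z\<^sub>2)"
    proof (cases "z\<^sub>1 = z\<^sub>2")
      case True
      then show ?thesis using m by simp
    next
      case False
      then have \<delta>: "0 < \<delta>" "\<delta> \<le> 1" by (auto simp: \<delta>_def)
      then have \<omega>0: "0 \<le> \<omega> \<delta>" by (intro m) simp
      define v where "v = of_real (1 - \<delta>) * (z\<^sub>2 - z\<^sub>1)"
      note inner = inner_segment[OF z \<delta>_def v_def]
      note v = inner(1) and seg_in = inner(2) and seg_d = inner(3)
      have kle: "k w \<le> M * (\<omega> t / t)" if "w \<in> unit_disk" "0 < t" "t \<le> disk_dist w" for w t
        using le[OF that(1)] mult_left_mono[OF m(4)[OF that(2,3)] M] by simp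
      have I: "integral {0..\<delta>} (\<lambda>t. k (of_real (1 - t) * z)) \<le> M * Mf * \<omega> \<delta>" if z: "z \<in> unit_disk" for z
      proof -
        have c: "continuous_on {0..\<delta>} (\<lambda>t. k (of_real (1 - t) * z))"
          using disk_scale(1)[OF z] \<delta> by (intro continuous_on_compose2[OF k(1)] continuous_intros) auto
        have "ennreal (integral {0..\<delta>} (\<lambda>t. k (of_real (1 - t) * z)))
            = (\<integral>\<^sup>+ t\<in>{0<..<\<delta>}. ennreal (k (of_real (1 - t) * z)) \<partial>lborel)"
          using disk_scale(1)[OF z] \<delta> by (intro nn_integral_Ioo_continuous[symmetric, OF c] k(2)) auto
        also have "\<dots> \<le> (\<integral>\<^sup>+ t\<in>{0<..<\<delta>}. ennreal (M * (\<omega> t / t)) \<partial>lborel)"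
        proof (intro nn_integral_mono)
          fix t
          have "k (of_real (1 - t) * z) \<le> M * (\<omega> t / t)" if "t \<in> {0<..<\<delta>}"
            using that \<delta> disk_scale[OF z, of t] by (intro kle) auto
          then show "ennreal (k (of_real (1 - t) * z)) * indicator {0<..<\<delta>} t
              \<le> ennreal (M * (\<omega> t / t)) * indicator {0<..<\<delta>} t"
            by (auto simp: indicator_def intro!: ennreal_leI simp del: times_divide_eq_right)
        qed
        also have "\<dots> \<le> ennreal (M * Mf * \<omega> \<delta>)" using fast \<delta> M by blast
        finally show ?thesis using M Mf \<omega>0 by (subst (asm) ennreal_le_iff) auto
      qed
      have J: "integral {0..1} (\<lambda>t. norm v * k (of_real (1 - \<delta>) * z\<^sub>1 + of_real t * v)) \<le> M * \<omega> \<delta>"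
      proof -
        have "integral {0..1} (\<lambda>t. norm v * k (of_real (1 - \<delta>) * z\<^sub>1 + of_real t * v)) \<le> integral {0..1::real} (\<lambda>t. M * \<omega> \<delta>)"
        proof (rule integral_le)
          show "(\<lambda>t. norm v * k (of_real (1 - \<delta>) * z\<^sub>1 + of_real t * v)) integrable_on {0..1}"
            using seg_in by (intro integrable_continuous_real continuous_on_compose2[OF k(1)] continuous_intros) auto
          fix t :: real assume "t \<in> {0..1}"
          then have "norm v * k (of_real (1 - \<delta>) * z\<^sub>1 + of_real t * v) \<le> \<delta> * (M * (\<omega> \<delta> / \<delta>))"
            using v k(2) seg_in seg_d \<delta> by (intro mult_mono kle) auto
          then show "norm v * k (of_real (1 - \<delta>) * z\<^sub>1 + of_real t * v) \<le> M * \<omega> \<delta>" using \<delta> by simp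
        qed (rule integrable_const_ivl)
        then show ?thesis by simp
      qed
      have "norm (F z\<^sub>1 - F z\<^sub>2) \<le> M * Mf * \<omega> \<delta> + M * Mf * \<omega> \<delta> + M * \<omega> \<delta>"
        using slope_le_radial_path[OF F k z _ _ v_def] \<delta> I[OF z(1)] I[OF z(2)] J by auto
      also have "\<dots> = (M * Mf + M * Mf + M) * \<omega> \<delta>" by (simp add: algebra_simps)
      also have "\<dots> \<le> C * \<omega> (dist z\<^sub>1 z\<^sub>2)"
        using M Mf \<omega>0 by (intro mult_mono m(3)) (auto simp: C_def \<delta>_def)
      finally show ?thesis .
    qed
  qed
qed

section \<open>Cauchy and Poisson formulas on circles\<close>

lemma Cauchy_formula_circle:
  assumes "continuous_on (cball c r) f" "f holomorphic_on ball c r" "w \<in> ball c r" "r > 0"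
  shows "((\<lambda>t. f (c + of_real r * cis t) * (of_real r * cis t / (c + of_real r * cis t - w)))
     has_integral 2 * of_real pi * f w) {0..2*pi}"
proof -
  have "((\<lambda>u. f u/(u-w)) has_contour_integral (2 * of_real pi * \<i> * f w)) (part_circlepath c r 0 (2*pi))"
    using Cauchy_integral_circlepath[OF assms(1,2), of w] assms(3)
    by (simp add: circlepath_def dist_norm norm_minus_commute)
  then have "((\<lambda>t. f (c + of_real r * cis t) / (c + of_real r * cis t - w) * of_real r * \<i> * cis t)
      has_integral 2 * of_real pi * \<i> * f w) {0..2*pi}"
    by (subst (asm) has_contour_integral_part_circlepath_iff) auto
  from has_integral_mult_right[OF this, of "-\<i>"] show ?thesis
    by (simp add: algebra_simps)
qed

lemma mean_value_circle:
  assumes "continuous_on (cball c r) f" "f holomorphic_on ball c r" "r > 0"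
  shows "((\<lambda>t. f (c + of_real r * cis t)) has_integral 2 * of_real pi * f c) {0..2*pi}"
  using Cauchy_formula_circle[OF assms(1,2), of c] assms(3) by simp

lemma deriv_circle_Fourier:
  assumes "continuous_on (cball c r) f" "f holomorphic_on ball c r" "r > 0"
  shows "((\<lambda>t. f (c + of_real r * cis t) * cis (- t)) has_integral 2 * of_real pi * of_real r * deriv f c) {0..2*pi}"
proof -
  have "((\<lambda>u. f u/(u-c)^(Suc 1)) has_contour_integral (2 * pi * \<i>) / fact 1 * (deriv ^^ 1) f c) (part_circlepath c r 0 (2*pi))"
    using Cauchy_has_contour_integral_higher_derivative_circlepath[OF assms(1,2), of c 1] assms(3)
    by (simp add: circlepath_def)
  then have "((\<lambda>t. f (c + of_real r * cis t) / (of_real r * cis t)^(Suc 1) * of_real r * \<i> * cis t)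
      has_integral (2 * pi * \<i>) / fact 1 * (deriv ^^ 1) f c) {0..2*pi}"
    by (subst (asm) has_contour_integral_part_circlepath_iff) auto
  from has_integral_mult_right[OF this, of "-\<i> * of_real r"]
  have *: "((\<lambda>t. (-\<i> * of_real r) * (f (c + of_real r * cis t) / (of_real r * cis t)^(Suc 1) * of_real r * \<i> * cis t))
      has_integral 2 * of_real pi * of_real r * deriv f c) {0..2*pi}"
    by (simp add: mult_ac)
  have "(-\<i> * of_real r) * (X / (of_real r * cis t)^(Suc 1) * of_real r * \<i> * cis t) = X * cis (- t)" for t X
  proof -
    have "cis (- t) = 1 / cis t" by (simp add: cis_inverse divide_inverse)
    then show ?thesis using assms(3) by (simp add: power2_eq_square mult.commute[of X])
  qed
  with * show ?thesis by (simp only:)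
qed

lemma antianalytic_circle_Fourier:
  assumes "continuous_on (cball c r) f" "f holomorphic_on ball c r" "r > 0"
  shows "((\<lambda>t. f (c + of_real r * cis t) * cis t) has_integral 0) {0..2*pi}"
proof -
  have "((\<lambda>t. f (c + of_real r * cis t) * (c + of_real r * cis t - c)) has_integral
       2 * of_real pi * (f c * (c - c))) {0..2*pi}"
    using assms by (intro mean_value_circle[of c r "\<lambda>w. f w * (w - c)"] continuous_intros holomorphic_intros) auto
  from has_integral_mult_right[OF this, of "1 / of_real r"] show ?thesis
    using assms(3) by (simp add: field_simps)
qed

text \<open>For \<open>\<Phi> = f - f c\<close> the Fourier coefficient of \<open>\<Phi>\<close> with \<open>cis (-t)\<close> is a multiple of \<open>f' c\<close>, and that of \<open>cnj \<Phi>\<close>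
  vanishes. Their sum expresses \<open>f' c\<close> by the real part of \<open>\<Phi>\<close> alone.\<close>
lemma norm_deriv_le_Re_mean:
  assumes c: "continuous_on (cball c r) f" and h: "f holomorphic_on ball c r" and r: "r > 0"
  shows "norm (deriv f c) \<le> 1 / (pi * r) * integral {0..2*pi} (\<lambda>t. \<bar>Re (f (c + of_real r * cis t)) - Re (f c)\<bar>)"
proof -
  define \<Phi> where "\<Phi> = (\<lambda>t. f (c + of_real r * cis t) - f c)"
  have path: "c + of_real r * cis t \<in> cball c r" for t using r by (simp add: dist_norm norm_mult)
  have "continuous_on UNIV (\<lambda>t. f (c + of_real r * cis t))"
    using path by (intro continuous_on_compose2[OF c]) (auto intro!: continuous_intros)
  then have cont: "continuous_on UNIV \<Phi>" unfolding \<Phi>_def by (intro continuous_intros)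
  have 1: "((\<lambda>t. \<Phi> t * cis (- t)) has_integral 2 * of_real pi * of_real r * deriv (\<lambda>w. f w - f c) c) {0..2*pi}"
    unfolding \<Phi>_def using c h r by (intro deriv_circle_Fourier continuous_intros holomorphic_intros)
  have f: "f field_differentiable at c" using h r by (auto simp: holomorphic_on_open field_differentiable_def)
  have d: "deriv (\<lambda>w. f w - f c) c = deriv f c" using f by (simp add: deriv_diff)
  have "((\<lambda>t. \<Phi> t * cis t) has_integral 0) {0..2*pi}"
    unfolding \<Phi>_def using c h r by (intro antianalytic_circle_Fourier[of _ _ "\<lambda>w. f w - f c"] continuous_intros holomorphic_intros)
  then have 2: "((\<lambda>t. cnj (\<Phi> t * cis t)) has_integral cnj 0) {0..2*pi}"
    by (drule_tac has_integral_cnj[THEN iffD2]) (simp only: o_def)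
  have "((\<lambda>t. of_real (2 * Re (\<Phi> t)) * cis (- t)) has_integral 2 * of_real pi * of_real r * deriv f c) {0..2*pi}"
  proof -
    have "\<Phi> t * cis (- t) + cnj (\<Phi> t * cis t) = of_real (2 * Re (\<Phi> t)) * cis (- t)" for t
      by (simp add: cis_cnj complex_add_cnj mult.commute[of "cis (-t)"] flip: distrib_right)
    then show ?thesis using has_integral_add[OF 1 2] d by (simp only: complex_cnj_zero add_0_right)
  qed
  then have *: "integral {0..2*pi} (\<lambda>t. of_real (2 * Re (\<Phi> t)) * cis (- t)) = 2 * of_real pi * of_real r * deriv f c"
    by (rule integral_unique)
  have cont': "continuous_on {0..2*pi} \<Phi>" using cont by (rule continuous_on_subset) simp
  have "norm (integral {0..2*pi} (\<lambda>t. of_real (2 * Re (\<Phi> t)) * cis (- t))) \<le> integral {0..2*pi} (\<lambda>t. 2 * \<bar>Re (\<Phi> t)\<bar>)"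
  proof (rule integral_norm_bound_integral)
    show "(\<lambda>t. of_real (2 * Re (\<Phi> t)) * cis (- t)) integrable_on {0..2*pi}"
      by (intro integrable_continuous_real continuous_intros cont')
    show "(\<lambda>t. 2 * \<bar>Re (\<Phi> t)\<bar>) integrable_on {0..2*pi}"
      by (intro integrable_continuous_real continuous_intros cont')
  qed (simp add: norm_mult)
  then have "norm (2 * of_real pi * of_real r * deriv f c) \<le> integral {0..2*pi} (\<lambda>t. 2 * \<bar>Re (\<Phi> t)\<bar>)"
    by (simp only: *)
  also have "\<dots> = 2 * integral {0..2*pi} (\<lambda>t. \<bar>Re (\<Phi> t)\<bar>)" by simp
  finally have "pi * r * norm (deriv f c) \<le> integral {0..2*pi} (\<lambda>t. \<bar>Re (\<Phi> t)\<bar>)"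
    using r by (simp add: norm_mult)
  then show ?thesis using r by (simp add: field_simps \<Phi>_def)
qed

text \<open>The increments of the real part have mean \<open>0\<close>, so their absolute values have twice the
  mean of their positive parts.\<close>
lemma norm_deriv_le_Re_pos_mean:
  assumes c: "continuous_on (cball c r) f" and h: "f holomorphic_on ball c r" and r: "r > 0"
  shows "norm (deriv f c) \<le> 2 / (pi * r) * integral {0..2*pi} (\<lambda>t. max 0 (Re (f (c + of_real r * cis t)) - Re (f c)))"
proof -
  define q where "q = (\<lambda>t. Re (f (c + of_real r * cis t)) - Re (f c))"
  have path: "c + of_real r * cis t \<in> cball c r" for t using r by (simp add: dist_norm norm_mult)
  have "continuous_on UNIV (\<lambda>t. f (c + of_real r * cis t))"
    using path by (intro continuous_on_compose2[OF c]) (auto intro!: continuous_intros)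
  then have "continuous_on UNIV q" unfolding q_def by (intro continuous_intros)
  then have cont: "continuous_on {0..2*pi} q" by (rule continuous_on_subset) simp
  have "((\<lambda>t. f (c + of_real r * cis t) - f c) has_integral 2 * of_real pi * (f c - f c)) {0..2*pi}"
    using c h r by (intro mean_value_circle continuous_intros holomorphic_intros)
  then have "((\<lambda>t. Re (f (c + of_real r * cis t) - f c)) has_integral Re 0) {0..2*pi}"
    by (intro has_integral_Re) simp
  then have 0: "(q has_integral 0) {0..2*pi}" by (simp add: q_def)
  have "integral {0..2*pi} (\<lambda>t. \<bar>q t\<bar>) = integral {0..2*pi} (\<lambda>t. 2 * max 0 (q t) - q t)"
    by (intro integral_cong) (auto simp: max_def)
  also have "\<dots> = 2 * integral {0..2*pi} (\<lambda>t. max 0 (q t))"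
    using 0 cont by (subst integral_diff) (auto simp: has_integral_iff intro!: integrable_continuous_real continuous_intros)
  finally show ?thesis using norm_deriv_le_Re_mean[OF c h r] by (simp add: q_def)
qed

definition poisson_kernel :: "complex \<Rightarrow> real \<Rightarrow> real" where
  "poisson_kernel z \<tau> = (1 - (norm z)\<^sup>2) / (norm (cis \<tau> - z))\<^sup>2"

lemma cis_neq_disk: "norm z < 1 \<Longrightarrow> cis \<tau> \<noteq> z" by auto

lemma poisson_kernel_pos: "norm z < 1 \<Longrightarrow> 0 < poisson_kernel z \<tau>"
  unfolding poisson_kernel_def using cis_neq_disk[of z \<tau>]
  by (intro divide_pos_pos) (auto simp: power_less_one_iff abs_square_less_1)

lemma continuous_on_poisson_kernel [continuous_intros]:
  assumes "continuous_on S f" "continuous_on S g" "\<And>x. x \<in> S \<Longrightarrow> norm (f x) < 1"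
  shows "continuous_on S (\<lambda>x. poisson_kernel (f x) (g x))"
  unfolding poisson_kernel_def using assms cis_neq_disk
  by (intro continuous_intros) (simp_all add: cis_neq_disk)

text \<open>Cauchy's formula for \<open>w \<mapsto> f w (1 - |z|\<^sup>2) / (1 - cnj z w)\<close>, whose value at \<open>z\<close> is \<open>f z\<close>. On the unit
  circle \<open>1 - cnj z w = (cnj w - cnj z) w\<close>, which turns the Cauchy kernel into the Poisson kernel.\<close>
lemma poisson_formula:
  assumes c: "continuous_on (cball 0 1) f" and h: "f holomorphic_on ball 0 1" and z: "norm z < 1"
  shows "((\<lambda>t. f (cis t) * of_real (poisson_kernel z t)) has_integral 2 * of_real pi * f z) {0..2*pi}"
proof -
  have ne: "1 - cnj z * w \<noteq> 0" if "norm w \<le> 1" for w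
  proof
    assume "1 - cnj z * w = 0"
    then have "norm (cnj z * w) = 1" by (metis eq_iff_diff_eq_0 norm_one)
    moreover have "norm (cnj z * w) \<le> norm z * 1" using that unfolding norm_mult complex_mod_cnj by (intro mult_left_mono) auto
    ultimately show False using z by simp
  qed
  define F where "F = (\<lambda>w. f w * ((1 - of_real ((norm z)\<^sup>2)) / (1 - cnj z * w)))"
  have "continuous_on (cball 0 1) F" unfolding F_def using ne by (intro continuous_intros c) (auto simp: dist_norm)
  moreover have "F holomorphic_on ball 0 1" unfolding F_def using ne by (intro holomorphic_intros h) (auto simp: dist_norm)
  ultimately have "((\<lambda>t. F (0 + of_real 1 * cis t) * (of_real 1 * cis t / (0 + of_real 1 * cis t - z)))
     has_integral 2 * of_real pi * F z) {0..2*pi}"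
    using z by (intro Cauchy_formula_circle) (auto simp: dist_norm)
  moreover have "F z = f z"
  proof -
    have "1 - of_real ((norm z)\<^sup>2) = 1 - cnj z * z" by (metis complex_norm_square mult.commute)
    then show ?thesis unfolding F_def using ne[of z] z by simp
  qed
  moreover have "F (0 + of_real 1 * cis t) * (of_real 1 * cis t / (0 + of_real 1 * cis t - z))
     = f (cis t) * of_real (poisson_kernel z t)" for t
  proof -
    have D: "1 - cnj z * cis t = (cnj (cis t) - cnj z) * cis t"
      by (simp add: algebra_simps cis_cnj cis_mult)
    have "of_real ((norm (cis t - z))\<^sup>2) = (cis t - z) * (cnj (cis t) - cnj z)"
      by (metis complex_norm_square complex_cnj_diff)
    then have P: "of_real (poisson_kernel z t) = (1 - of_real ((norm z)\<^sup>2)) / ((cis t - z) * (cnj (cis t) - cnj z))"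
      unfolding poisson_kernel_def by (metis of_real_1 of_real_diff of_real_divide)
    show ?thesis unfolding F_def P by (simp add: D)
  qed
  ultimately show ?thesis by simp
qed

lemma integral_poisson_kernel:
  assumes "norm z < 1" shows "(poisson_kernel z has_integral 2 * pi) {0..2*pi}"
  using has_integral_Re[OF poisson_formula[of "\<lambda>_. 1" z]] assms by simp

lemma poisson_eq_integral:
  assumes "continuous_on UNIV (\<lambda>t. u (cis t))" "norm z < 1"
  shows "poisson u z = 1 / (2 * pi) * integral {0..2*pi} (\<lambda>t. u (cis t) * poisson_kernel z t)"
proof -
  have "continuous_on {0..2*pi} (\<lambda>t. u (cis t) * poisson_kernel z t)"
    using assms by (intro continuous_intros continuous_on_subset[OF assms(1)]) auto
  then have "set_integrable lebesgue {0..2*pi} (\<lambda>t. u (cis t) * poisson_kernel z t)"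
    using absolutely_integrable_continuous_real by blast
  from set_lebesgue_integral_eq_integral(2)[OF this] show ?thesis
    unfolding poisson_def poisson_kernel_def by simp
qed

lemma continuous_on_poisson:
  assumes "continuous_on UNIV (\<lambda>t. u (cis t))"
  shows "continuous_on unit_disk (poisson u)"
proof -
  have "continuous_on (unit_disk \<times> cbox 0 (2*pi)) (\<lambda>(z, t). u (cis t) * poisson_kernel z t)"
    unfolding split_beta' 
    by (intro continuous_intros continuous_on_compose2[OF assms]) (auto simp: dist_norm)
  from integral_continuous_on_param[OF this]
  have "continuous_on unit_disk (\<lambda>z. 1 / (2 * pi) * integral {0..2*pi} (\<lambda>t. u (cis t) * poisson_kernel z t))"
    by (intro continuous_intros) simp
  then show ?thesis
    by (rule continuous_on_eq) (use assms in \<open>auto simp: poisson_eq_integral\<close>)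
qed

section \<open>Harmonic functions as sums of holomorphic and antiholomorphic ones\<close>

lemma partial_deriv_eqI:
  assumes "((\<lambda>t::real. f (z + t *\<^sub>R v)) has_vector_derivative D) (at 0)"
  shows "partial_deriv v f z = D"
  unfolding partial_deriv_def using assms by (rule vector_derivative_at)

lemma line_eventually_in_open:
  fixes z v :: complex
  assumes "open S" "z \<in> S"
  shows "\<forall>\<^sub>F t::real in nhds 0. z + t *\<^sub>R v \<in> S"
proof -
  have "open ((\<lambda>t::real. z + t *\<^sub>R v) -` S)"
    using assms(1) by (intro open_vimage continuous_intros)
  then show ?thesis using assms(2) by (auto simp: eventually_nhds)
qed

lemma line_has_vector_derivative_transform:
  fixes f g :: "complex \<Rightarrow> complex"
  assumes "open S" "z \<in> S" and eq: "\<And>w. w \<in> S \<Longrightarrow> f w = g w"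
    and "((\<lambda>t::real. g (z + t *\<^sub>R v)) has_vector_derivative D) (at 0)"
  shows "((\<lambda>t::real. f (z + t *\<^sub>R v)) has_vector_derivative D) (at 0)"
proof -
  have ev: "\<forall>\<^sub>F t in nhds (0::real). g (z + t *\<^sub>R v) = f (z + t *\<^sub>R v)"
    using line_eventually_in_open[OF assms(1) assms(2), of v] by eventually_elim (simp add: eq)
  show ?thesis
    using assms(4) unfolding has_vector_derivative_def
    by (rule has_derivative_transform_eventually) (use ev eq[OF assms(2)] in \<open>auto simp: eventually_at_filter elim: eventually_mono\<close>)
qed

text \<open>The class of functions \<open>A + cnj B\<close> is closed under derivatives along lines, with \<open>A\<close>, \<open>B\<close> replaced by \<open>v A'\<close>,
  \<open>v B'\<close>. This handles first and second partial derivatives at once.\<close>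
lemma holomorphic_sum_line_deriv:
  assumes A: "A holomorphic_on unit_disk" and B: "B holomorphic_on unit_disk"
    and f: "\<And>w. w \<in> unit_disk \<Longrightarrow> f w = A w + cnj (B w)" and z: "z \<in> unit_disk"
  shows "((\<lambda>t::real. f (z + t *\<^sub>R v)) has_vector_derivative v * deriv A z + cnj (v * deriv B z)) (at 0)"
proof (rule line_has_vector_derivative_transform[OF open_ball z f])
  have line: "((\<lambda>t::real. z + t *\<^sub>R v) has_vector_derivative v) (at 0)"
    by (auto intro!: derivative_eq_intros)
  have dA: "((\<lambda>t::real. G (z + t *\<^sub>R v)) has_vector_derivative v * deriv G z) (at 0)"
    if "G holomorphic_on unit_disk" for G
    using field_vector_diff_chain_at[OF line, of G "deriv G z"] holomorphic_derivI[OF that open_ball z]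
    by (simp add: o_def)
  show "((\<lambda>t::real. A (z + t *\<^sub>R v) + cnj (B (z + t *\<^sub>R v))) has_vector_derivative v * deriv A z + cnj (v * deriv B z)) (at 0)"
    by (intro has_vector_derivative_add dA A has_vector_derivative_cnj B)
qed

lemma holomorphic_sum_C1:
  assumes A: "A holomorphic_on unit_disk" and B: "B holomorphic_on unit_disk"
    and f: "\<And>w. w \<in> unit_disk \<Longrightarrow> f w = A w + cnj (B w)"
  shows "C1_on f unit_disk"
    and "z \<in> unit_disk \<Longrightarrow> partial_deriv v f z = v * deriv A z + cnj (v * deriv B z)"
proof -
  show pd: "partial_deriv v f z = v * deriv A z + cnj (v * deriv B z)" if "z \<in> unit_disk" for z v
    using partial_deriv_eqI[OF holomorphic_sum_line_deriv[OF A B f that]] .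
  have dA: "deriv A holomorphic_on unit_disk" "deriv B holomorphic_on unit_disk"
    using A B by (auto intro: holomorphic_deriv)
  have "continuous_on unit_disk (\<lambda>z. v * deriv A z + cnj (v * deriv B z))" for v
    using dA[THEN holomorphic_on_imp_continuous_on] by (intro continuous_intros)
  then have "continuous_on unit_disk (partial_deriv v f)" for v
    by (rule continuous_on_eq) (simp add: pd)
  moreover have "(\<lambda>t::real. f (z + t *\<^sub>R v)) differentiable (at 0)" if "z \<in> unit_disk" for z v
    by (rule differentiableI_vector[OF holomorphic_sum_line_deriv[OF A B f that]])
  ultimately show "C1_on f unit_disk" unfolding C1_on_def by blast
qed

text \<open>The second derivatives in the directions \<open>1\<close> and \<open>\<i>\<close> cancel because \<open>1\<^sup>2 + \<i>\<^sup>2 = 0\<close>.\<close>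
lemma harmonic_on_holomorphic_sum:
  assumes A: "A holomorphic_on unit_disk" and B: "B holomorphic_on unit_disk"
    and f: "\<And>w. w \<in> unit_disk \<Longrightarrow> f w = A w + cnj (B w)"
  shows "harmonic_on f unit_disk"
proof -
  have A': "(\<lambda>z. v * deriv G z) holomorphic_on unit_disk" if "G holomorphic_on unit_disk" for v G
    using that by (intro holomorphic_intros holomorphic_deriv) auto
  have f': "partial_deriv v f w = v * deriv A w + cnj (v * deriv B w)" if "w \<in> unit_disk" for v w
    using holomorphic_sum_C1(2)[OF A B f that] .
  have "partial_deriv v (partial_deriv v f) z = v * (v * deriv (deriv A) z) + cnj (v * (v * deriv (deriv B) z))"
    if z: "z \<in> unit_disk" for v z
  proof -
    have "deriv (\<lambda>w. v * deriv G w) z = v * deriv (deriv G) z" if "G holomorphic_on unit_disk" for G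
      using holomorphic_on_imp_differentiable_at[OF holomorphic_deriv[OF that open_ball] open_ball z]
      by (rule deriv_cmult)
    then show ?thesis using holomorphic_sum_C1(2)[OF A'[OF A] A'[OF B] f' z, of v] A B by simp
  qed
  then show ?thesis
    unfolding harmonic_on_def
    using holomorphic_sum_C1(1)[OF A B f] holomorphic_sum_C1(1)[OF A'[OF A] A'[OF B] f'] by auto
qed

lemma rectangle_mixed_mvt:
  fixes u ux uxy :: "real \<Rightarrow> real \<Rightarrow> real"
  assumes h: "h > 0" "k > 0"
    and ux: "\<And>x y. x \<in> {a..a+h} \<Longrightarrow> y \<in> {b..b+k} \<Longrightarrow> ((\<lambda>x. u x y) has_real_derivative ux x y) (at x)"
    and uxy: "\<And>x y. x \<in> {a..a+h} \<Longrightarrow> y \<in> {b..b+k} \<Longrightarrow> ((\<lambda>y. ux x y) has_real_derivative uxy x y) (at y)"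
  obtains x y where "x \<in> {a..a+h}" "y \<in> {b..b+k}"
    "u (a+h) (b+k) - u a (b+k) - u (a+h) b + u a b = h * k * uxy x y"
proof -
  have "\<exists>x. a < x \<and> x < a + h \<and> (u (a+h) (b+k) - u (a+h) b) - (u a (b+k) - u a b)
      = (a + h - a) * (ux x (b+k) - ux x b)"
    using h by (intro MVT2) (auto intro!: derivative_eq_intros ux)
  then obtain x where x: "a < x" "x < a + h" and
    1: "(u (a+h) (b+k) - u (a+h) b) - (u a (b+k) - u a b) = h * (ux x (b+k) - ux x b)" by auto
  have "\<exists>y. b < y \<and> y < b + k \<and> ux x (b+k) - ux x b = (b + k - b) * uxy x y"
    using h x by (intro MVT2) (auto intro!: uxy)
  then obtain y where y: "b < y" "y < b + k" and 2: "ux x (b+k) - ux x b = k * uxy x y" by auto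
  show thesis using that[of x y] x y 1 2 by (simp add: algebra_simps)
qed

lemma C1_on_line_derivs:
  assumes "C1_on f S" "z \<in> S" "v \<in> {1, \<i>}"
  shows "((\<lambda>t::real. f (z + t *\<^sub>R v)) has_vector_derivative partial_deriv v f z) (at 0)"
  using assms unfolding C1_on_def partial_deriv_def by (auto simp: vector_derivative_works)

lemma C1_on_coordinate_derivs:
  assumes f: "C1_on f S"
  shows "Complex x y \<in> S \<Longrightarrow>
     ((\<lambda>x. f (Complex x y)) has_vector_derivative partial_deriv 1 f (Complex x y)) (at x)"
    and "Complex x y \<in> S \<Longrightarrow>
     ((\<lambda>y. f (Complex x y)) has_vector_derivative partial_deriv \<i> f (Complex x y)) (at y)"
proof -
  have shift: "(g has_vector_derivative D) (at x)" if "((\<lambda>t. g (x + t)) has_vector_derivative D) (at 0)"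
    for g :: "real \<Rightarrow> complex" and D x
  proof -
    have "((\<lambda>s. s - x) has_vector_derivative 1) (at x)"
      by (auto intro!: derivative_eq_intros simp: has_vector_derivative_def)
    from vector_diff_chain_at[OF this, of "\<lambda>t. g (x + t)" D] that show ?thesis by (simp add: o_def)
  qed
  assume z: "Complex x y \<in> S"
  have "Complex x y + t *\<^sub>R 1 = Complex (x + t) y" "Complex x y + t *\<^sub>R \<i> = Complex x (y + t)" for t
    by (auto simp: complex_eq_iff)
  with C1_on_line_derivs[OF f z, of 1] C1_on_line_derivs[OF f z, of \<i>]
  show "((\<lambda>x. f (Complex x y)) has_vector_derivative partial_deriv 1 f (Complex x y)) (at x)"
    "((\<lambda>y. f (Complex x y)) has_vector_derivative partial_deriv \<i> f (Complex x y)) (at y)"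
    by (auto intro!: shift)
qed

lemma Re_has_real_derivative:
  assumes "(g has_vector_derivative D) (at x)"
  shows "((\<lambda>x. Re (c * g x)) has_real_derivative Re (c * D)) (at x)"
proof -
  have "bounded_linear (\<lambda>w. Re (c * w))"
    by (rule bounded_linear_compose[OF bounded_linear_Re bounded_linear_mult_right])
  from bounded_linear.has_vector_derivative[OF this assms] show ?thesis
    by (simp add: has_real_derivative_iff_has_vector_derivative)
qed

lemma closed_square_in_open:
  assumes "open S" "Complex a b \<in> S"
  obtains h where "h > 0" "\<And>x y. x \<in> {a..a+h} \<Longrightarrow> y \<in> {b..b+h} \<Longrightarrow> Complex x y \<in> S"
proof -
  obtain e where e: "e > 0" "ball (Complex a b) e \<subseteq> S" using assms by (auto simp: open_contains_ball)
  have "Complex x y \<in> S" if "x \<in> {a..a+e/3}" "y \<in> {b..b+e/3}" for x y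
  proof -
    have "norm (Complex (a - x) (b - y)) \<le> \<bar>a - x\<bar> + \<bar>b - y\<bar>" using cmod_le[of "Complex (a - x) (b - y)"] by simp
    also have "\<dots> < e" using that e(1) by auto
    finally have "Complex x y \<in> ball (Complex a b) e" by (simp add: dist_norm complex_diff)
    then show ?thesis using e(2) by blast
  qed
  then show thesis using that[of "e/3"] e(1) by auto
qed

text \<open>Over a small square the second difference of \<open>u\<close> equals \<open>h\<^sup>2\<close> times either mixed derivative at some point of the
  square; continuity of the mixed derivatives identifies them at the corner. The real-valued mean value theorem
  is applied to \<open>Re (c f)\<close> for all constants \<open>c\<close>.\<close>
lemma mixed_partials_commute:
  assumes f: "C1_on f S" and fx: "C1_on (partial_deriv 1 f) S" and fy: "C1_on (partial_deriv \<i> f) S"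
    and S: "open S" "z \<in> S"
  shows "partial_deriv \<i> (partial_deriv 1 f) z = partial_deriv 1 (partial_deriv \<i> f) z"
proof -
  define P where "P = partial_deriv \<i> (partial_deriv 1 f)"
  define Q where "Q = partial_deriv 1 (partial_deriv \<i> f)"
  have cont: "continuous_on S P" "continuous_on S Q"
    using fx fy unfolding C1_on_def P_def Q_def by auto
  obtain a b where z: "z = Complex a b" by (cases z)
  have Re_eq: "Re (c * P z) = Re (c * Q z)" for c
  proof (rule ccontr)
    assume ne: "Re (c * P z) \<noteq> Re (c * Q z)"
    define e where "e = \<bar>Re (c * P z) - Re (c * Q z)\<bar> / 2"
    have e: "e > 0" using ne by (simp add: e_def)
    define U where "U = {w\<in>S. \<bar>Re (c * P w) - Re (c * P z)\<bar> < e \<and> \<bar>Re (c * Q w) - Re (c * Q z)\<bar> < e}"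
    have "open U"
    proof -
      have "open (S \<inter> (\<lambda>w. (Re (c * P w), Re (c * Q w))) -` ({Re (c * P z) - e<..<Re (c * P z) + e} \<times> {Re (c * Q z) - e<..<Re (c * Q z) + e}))"
        by (intro continuous_open_preimage S open_Times open_greaterThanLessThan continuous_intros cont)
      also have "\<dots> = U" by (auto simp: U_def abs_less_iff)
      finally show ?thesis .
    qed
    moreover have "Complex a b \<in> U" using S e by (simp add: U_def z[symmetric])
    ultimately obtain h where h: "h > 0" and hU: "\<And>x y. x \<in> {a..a+h} \<Longrightarrow> y \<in> {b..b+h} \<Longrightarrow> Complex x y \<in> U"
      using closed_square_in_open by blast
    then have hS: "x \<in> {a..a+h} \<Longrightarrow> y \<in> {b..b+h} \<Longrightarrow> Complex x y \<in> S" for x y by (auto simp: U_def)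
    define u where "u = (\<lambda>x y. Re (c * f (Complex x y)))"
    have ux: "((\<lambda>x. u x y) has_real_derivative Re (c * partial_deriv 1 f (Complex x y))) (at x)"
      and uxy: "((\<lambda>y. Re (c * partial_deriv 1 f (Complex x y))) has_real_derivative Re (c * P (Complex x y))) (at y)"
      and uy: "((\<lambda>y. u x y) has_real_derivative Re (c * partial_deriv \<i> f (Complex x y))) (at y)"
      and uyx: "((\<lambda>x. Re (c * partial_deriv \<i> f (Complex x y))) has_real_derivative Re (c * Q (Complex x y))) (at x)"
      if "x \<in> {a..a+h}" "y \<in> {b..b+h}" for x y
      unfolding u_def P_def Q_def using hS[OF that]
      by (intro Re_has_real_derivative C1_on_coordinate_derivs[OF f] C1_on_coordinate_derivs[OF fx]
          C1_on_coordinate_derivs[OF fy]; assumption)+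
    obtain x y where xy: "x \<in> {a..a+h}" "y \<in> {b..b+h}"
      "u (a+h) (b+h) - u a (b+h) - u (a+h) b + u a b = h * h * Re (c * P (Complex x y))"
      using rectangle_mixed_mvt[OF h h ux uxy] by blast
    obtain y' x' where xy': "y' \<in> {b..b+h}" "x' \<in> {a..a+h}"
      "u (a+h) (b+h) - u (a+h) b - u a (b+h) + u a b = h * h * Re (c * Q (Complex x' y'))"
      using rectangle_mixed_mvt[of h h b a "\<lambda>y x. u x y", OF h h uy uyx] by blast
    have "h * h * Re (c * P (Complex x y)) = h * h * Re (c * Q (Complex x' y'))" using xy(3) xy'(3) by linarith
    then have "Re (c * P (Complex x y)) = Re (c * Q (Complex x' y'))" using h by simp
    moreover have "\<bar>Re (c * P (Complex x y)) - Re (c * P z)\<bar> < e" "\<bar>Re (c * Q (Complex x' y')) - Re (c * Q z)\<bar> < e"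
      using hU[OF xy(1,2)] hU[OF xy'(2,1)] by (auto simp: U_def)
    ultimately show False unfolding e_def by (simp only: abs_less_iff) (smt (verit) field_sum_of_halves)
  qed
  have "P z = Q z" using Re_eq[of 1] Re_eq[of "-\<i>"] by (simp add: complex_eq_iff)
  then show ?thesis by (simp add: P_def Q_def)
qed

lemma C1_on_imp_has_derivative:
  assumes f: "C1_on f S" and S: "open S" "z \<in> S"
  shows "(f has_derivative (\<lambda>w. of_real (Re w) * partial_deriv 1 f z + of_real (Im w) * partial_deriv \<i> f z)) (at z)"
proof -
  obtain e where e: "e > 0" "ball z e \<subseteq> S" using S by (auto simp: open_contains_ball)
  define X where "X = {Re z - e/2<..<Re z + e/2}"
  define Y where "Y = {Im z - e/2<..<Im z + e/2}"
  have XY: "Complex x y \<in> S" if "x \<in> X" "y \<in> Y" for x y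
  proof -
    have "norm (z - Complex x y) \<le> \<bar>Re z - x\<bar> + \<bar>Im z - y\<bar>" using cmod_le[of "z - Complex x y"] by simp
    also have "\<dots> < e" using that by (auto simp: X_def Y_def abs_if)
    finally show ?thesis using e(2) by (auto simp: dist_norm subset_iff)
  qed
  have zXY: "Re z \<in> X" "Im z \<in> Y" using e by (auto simp: X_def Y_def)
  have o: "open (X \<times> Y)" by (auto simp: X_def Y_def intro!: open_Times)
  have cfy: "continuous_on S (partial_deriv \<i> f)" using f by (auto simp: C1_on_def)
  have "((\<lambda>(x, y). f (Complex x y)) has_derivative
     (\<lambda>(tx, ty). tx *\<^sub>R partial_deriv 1 f z + blinfun_apply (blinfun_scaleR_left (partial_deriv \<i> f z)) ty)) (at (Re z, Im z) within X \<times> Y)"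
  proof -
    have "((\<lambda>(x, y). f (Complex x y)) has_derivative
     (\<lambda>(tx, ty). (\<lambda>tx. tx *\<^sub>R partial_deriv 1 f z) tx + blinfun_apply ((\<lambda>x y. blinfun_scaleR_left (partial_deriv \<i> f (Complex x y))) (Re z) (Im z)) ty))
      (at (Re z, Im z) within X \<times> Y)"
    proof (rule has_derivative_partialsI)
      have "((\<lambda>x. f (Complex x (Im z))) has_vector_derivative partial_deriv 1 f z) (at (Re z))"
        using C1_on_coordinate_derivs(1)[OF f, of "Re z" "Im z"] S by simp
      then show "((\<lambda>x. f (Complex x (Im z))) has_derivative (\<lambda>tx. tx *\<^sub>R partial_deriv 1 f z)) (at (Re z) within X)"
        by (simp add: has_vector_derivative_def has_derivative_at_withinI)
      fix x y assume "x \<in> X" "y \<in> Y"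
      then have "((\<lambda>y. f (Complex x y)) has_vector_derivative partial_deriv \<i> f (Complex x y)) (at y)"
        using C1_on_coordinate_derivs(2)[OF f] XY by blast
      then show "((\<lambda>y. f (Complex x y)) has_derivative blinfun_apply (blinfun_scaleR_left (partial_deriv \<i> f (Complex x y)))) (at y within Y)"
        by (simp add: has_vector_derivative_def has_derivative_at_withinI)
    next
      have "continuous_on (X \<times> Y) (\<lambda>x. partial_deriv \<i> f (Complex (fst x) (snd x)))"
        using XY by (intro continuous_on_compose2[OF cfy]) (auto intro!: continuous_intros simp: Complex_eq)
      then have "continuous_on (X \<times> Y) (\<lambda>(x, y). blinfun_scaleR_left (partial_deriv \<i> f (Complex x y)))"
        unfolding split_beta' by (intro continuous_intros bounded_linear.continuous_on[OF bounded_linear_blinfun_scaleR_left])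
      then show "continuous (at (Re z, Im z) within X \<times> Y) (\<lambda>(x, y). blinfun_scaleR_left (partial_deriv \<i> f (Complex x y)))"
        using zXY by (auto simp: continuous_on_eq_continuous_within)
    qed (use zXY in \<open>auto simp: Y_def\<close>)
    then show ?thesis by simp
  qed
  then have 1: "((\<lambda>(x, y). f (Complex x y)) has_derivative
     (\<lambda>(tx, ty). tx *\<^sub>R partial_deriv 1 f z + ty *\<^sub>R partial_deriv \<i> f z)) (at (Re z, Im z))"
    using at_within_open[OF _ o, of "(Re z, Im z)"] zXY by simp
  have 2: "((\<lambda>w. (Re w, Im w)) has_derivative (\<lambda>w. (Re w, Im w))) (at z)"
    by (intro derivative_intros bounded_linear_imp_has_derivative bounded_linear_Re bounded_linear_Im has_derivative_Pair)
  have "((\<lambda>(x, y). f (Complex x y)) \<circ> (\<lambda>w. (Re w, Im w)) has_derivative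
      (\<lambda>(tx, ty). tx *\<^sub>R partial_deriv 1 f z + ty *\<^sub>R partial_deriv \<i> f z) \<circ> (\<lambda>w. (Re w, Im w))) (at z)"
    by (rule diff_chain_at[OF 2 1])
  then show ?thesis by (simp add: o_def scaleR_conv_of_real)
qed

text \<open>The Wirtinger derivatives \<open>\<partial>f = (f\<^sub>x - \<i> f\<^sub>y) / 2\<close> and \<open>cnj ((f\<^sub>x + \<i> f\<^sub>y) / 2)\<close> are holomorphic by the Laplace
  equation and the symmetry of second derivatives. Their primitives \<open>A\<close> and \<open>B\<close> give \<open>f\<close> up to a constant.\<close>
lemma harmonic_on_imp_holomorphic_sum:
  assumes f: "harmonic_on f unit_disk"
  obtains A B where "A holomorphic_on unit_disk" "B holomorphic_on unit_disk"
    "\<And>w. w \<in> unit_disk \<Longrightarrow> f w = A w + cnj (B w)"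
proof -
  define fx where "fx = partial_deriv 1 f"
  define fy where "fy = partial_deriv \<i> f"
  have C1: "C1_on f unit_disk" "C1_on fx unit_disk" "C1_on fy unit_disk"
    using f by (auto simp: harmonic_on_def fx_def fy_def)
  have laplace: "partial_deriv \<i> fy z = - partial_deriv 1 fx z" if "z \<in> unit_disk" for z
    using f that by (auto simp: harmonic_on_def fx_def fy_def add_eq_0_iff)
  have mixed: "partial_deriv \<i> fx z = partial_deriv 1 fy z" if "z \<in> unit_disk" for z
    unfolding fx_def fy_def using C1 that by (intro mixed_partials_commute) (auto simp: fx_def fy_def)
  note D = C1_on_imp_has_derivative[OF _ open_ball]
  define a where "a = (\<lambda>z. (1/2) * (fx z - \<i> * fy z))"
  define b where "b = (\<lambda>z. cnj ((1/2) * (fx z + \<i> * fy z)))"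
  have "(a has_field_derivative (partial_deriv 1 fx z - \<i> * partial_deriv 1 fy z) / 2) (at z)" if z: "z \<in> unit_disk" for z
    unfolding has_field_derivative_def a_def
    by (rule has_derivative_eq_rhs[OF has_derivative_mult_right[OF has_derivative_diff[OF D[OF C1(2) z] has_derivative_mult_right[OF D[OF C1(3) z]]]]])
       (auto simp: fun_eq_iff complex_eq_iff laplace[OF z] mixed[OF z] field_simps)
  then have a: "a holomorphic_on unit_disk" unfolding holomorphic_on_open[OF open_ball] by blast
  have "(b has_field_derivative cnj ((partial_deriv 1 fx z + \<i> * partial_deriv 1 fy z) / 2)) (at z)" if z: "z \<in> unit_disk" for z
    unfolding has_field_derivative_def b_def
    by (rule has_derivative_eq_rhs[OF bounded_linear.has_derivative[OF bounded_linear_cnj has_derivative_mult_right[OF has_derivative_add[OF D[OF C1(2) z] has_derivative_mult_right[OF D[OF C1(3) z]]]]]])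
       (auto simp: fun_eq_iff complex_eq_iff laplace[OF z] mixed[OF z] field_simps)
  then have b: "b holomorphic_on unit_disk" unfolding holomorphic_on_open[OF open_ball] by blast
  obtain A where "\<And>z. z \<in> unit_disk \<Longrightarrow> (A has_field_derivative a z) (at z within unit_disk)"
    using holomorphic_convex_primitive'[OF convex_ball open_ball a] by blast
  then have A: "\<And>z. z \<in> unit_disk \<Longrightarrow> (A has_field_derivative a z) (at z)"
    by (simp only: at_within_open[OF _ open_ball])
  obtain B where "\<And>z. z \<in> unit_disk \<Longrightarrow> (B has_field_derivative b z) (at z within unit_disk)"
    using holomorphic_convex_primitive'[OF convex_ball open_ball b] by blast
  then have B: "\<And>z. z \<in> unit_disk \<Longrightarrow> (B has_field_derivative b z) (at z)"
    by (simp only: at_within_open[OF _ open_ball])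
  have AB: "A holomorphic_on unit_disk" "B holomorphic_on unit_disk"
    using A B unfolding holomorphic_on_open[OF open_ball] by blast+
  define d where "d = (\<lambda>z. f z - (A z + cnj (B z)))"
  have d0: "(d has_derivative (\<lambda>_. 0)) (at z within unit_disk)" if z: "z \<in> unit_disk" for z
  proof -
    have "(d has_derivative (\<lambda>w. (of_real (Re w) * fx z + of_real (Im w) * fy z) - (a z * w + cnj (b z * w)))) (at z)"
      unfolding d_def fx_def fy_def
      using A[OF z] B[OF z] unfolding has_field_derivative_def
      by (intro has_derivative_diff has_derivative_add D[OF C1(1) z] bounded_linear.has_derivative[OF bounded_linear_cnj])
    also have "(\<lambda>w. (of_real (Re w) * fx z + of_real (Im w) * fy z) - (a z * w + cnj (b z * w))) = (\<lambda>_. 0)"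
      by (auto simp: fun_eq_iff complex_eq_iff a_def b_def field_simps)
    finally show ?thesis by (rule has_derivative_at_withinI)
  qed
  obtain c where c: "\<And>z. z \<in> unit_disk \<Longrightarrow> d z = c"
    using has_derivative_zero_constant[OF convex_ball d0] by blast
  show thesis
  proof (rule that[of "\<lambda>z. A z + c" B])
    show "(\<lambda>z. A z + c) holomorphic_on unit_disk" using AB by (intro holomorphic_intros)
    show "f w = A w + c + cnj (B w)" if "w \<in> unit_disk" for w
      using c[OF that] by (simp add: d_def algebra_simps)
  qed (rule AB)
qed

section \<open>Lacunary test functions\<close>

lemma slope_le_holomorphic:
  assumes f: "f holomorphic_on unit_disk"
  shows "slope_le f (\<lambda>z. norm (deriv f z))"
  unfolding slope_le_def
proof (intro ballI allI impI)
  fix z :: complex and e :: real assume z: "z \<in> unit_disk" and e: "e > 0"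
  have "continuous_on unit_disk (deriv f)"
    using f by (intro holomorphic_on_imp_continuous_on holomorphic_deriv) auto
  then have "isCont (deriv f) z" using z by (simp add: continuous_on_eq_continuous_at del: mem_ball_0)
  then obtain d where d: "d > 0" "\<And>w. dist w z < d \<Longrightarrow> dist (deriv f w) (deriv f z) < e"
    using e unfolding continuous_at_eps_delta by blast
  obtain d' where d': "d' > 0" "ball z d' \<subseteq> unit_disk" using z open_ball openE by blast
  show "\<exists>\<delta>>0. \<forall>a\<in>ball z \<delta>. \<forall>b\<in>ball z \<delta>. norm (f b - f a) \<le> (norm (deriv f z) + e) * norm (b - a)"
  proof (intro exI conjI ballI)
    show "min d d' > 0" using d d' by simp
    fix a b assume ab: "a \<in> ball z (min d d')" "b \<in> ball z (min d d')"
    show "norm (f b - f a) \<le> (norm (deriv f z) + e) * norm (b - a)"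
    proof (rule field_differentiable_bound[OF convex_ball _ _ ab(2,1)])
      fix w assume w: "w \<in> ball z (min d d')"
      then have "w \<in> unit_disk" using d' by auto
      then show "(f has_field_derivative deriv f w) (at w within ball z (min d d'))"
        using holomorphic_derivI[OF f open_ball] has_field_derivative_at_within by blast
      have "dist (deriv f w) (deriv f z) < e" using w d(2)[of w] by (simp add: dist_commute)
      then show "norm (deriv f w) \<le> norm (deriv f z) + e"
        using norm_triangle_ineq2[of "deriv f w" "deriv f z"] by (simp add: dist_norm)
    qed
  qed
qed

text \<open>The scales \<open>t j\<close> at which \<open>\<omega> t / t\<close> reaches \<open>q\<^sup>j\<close> times its value at \<open>1\<close>. As \<open>\<omega>\<close> increases, these
  scales decrease at least geometrically, even if \<open>\<omega>\<close> is not slow and \<open>\<omega> t / t\<close> grows slowly.\<close>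
lemma lacunary_scales:
  assumes maj: "majorant \<omega>" and pos: "0 < \<omega> 1"
    and unbdd: "\<And>K. \<exists>t\<in>{0<..1}. K < \<omega> t / t" and q: "1 < q"
  obtains t :: "nat \<Rightarrow> real" where "t 0 = 1" "\<And>j. 0 < t j" "\<And>j. \<omega> (t j) / t j = q ^ j * \<omega> 1"
    "\<And>i j. i \<le> j \<Longrightarrow> t j * q ^ (j - i) \<le> t i"
    "\<And>d. 0 < d \<Longrightarrow> d \<le> 1 \<Longrightarrow> \<exists>j. t (Suc j) \<le> d \<and> d \<le> t j"
proof -
  note m = majorantD[OF maj]
  have "\<exists>t. 0 < t \<and> \<omega> t / t = q ^ j * \<omega> 1 \<and> (j = 0 \<longrightarrow> t = 1)" for j
  proof (cases "j = 0")
    case True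
    then show ?thesis by (intro exI[of _ 1]) auto
  next
    case False
    obtain s where s: "s \<in> {0<..1}" "q ^ j * \<omega> 1 < \<omega> s / s" using unbdd by blast
    have "continuous_on {s..1} (\<lambda>t. \<omega> t / t)"
      using s by (intro continuous_on_majorant_ratio[OF maj]) (auto intro!: continuous_intros)
    moreover have "\<omega> 1 / 1 \<le> q ^ j * \<omega> 1" using pos q by simp
    ultimately have "\<exists>t. s \<le> t \<and> t \<le> 1 \<and> \<omega> t / t = q ^ j * \<omega> 1"
      using s by (intro IVT2') auto
    then obtain t where "s \<le> t" "\<omega> t / t = q ^ j * \<omega> 1" by blast
    then show ?thesis using s False by (intro exI[of _ t]) simp
  qed
  then obtain t where t: "\<And>j. 0 < t j" "\<And>j. \<omega> (t j) / t j = q ^ j * \<omega> 1" "t 0 = 1"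
    by metis
  have scale: "t j * q ^ (j - i) \<le> t i" if "i \<le> j" for i j
  proof -
    have le: "t j \<le> t i"
    proof (rule ccontr)
      assume "\<not> t j \<le> t i"
      then have "i < j" using that by (metis le_neq_implies_less order_refl)
      have "\<omega> (t j) / t j \<le> \<omega> (t i) / t i" using \<open>\<not> t j \<le> t i\<close> t(1) by (intro m(4)) auto
      then have "q ^ j \<le> q ^ i" using pos by (simp add: t(2))
      moreover have "q ^ i < q ^ j" using q \<open>i < j\<close> by simp
      ultimately show False by simp
    qed
    have \<omega>t: "\<omega> (t j) = t j * q ^ j * \<omega> 1" for j using t(2)[of j] t(1)[of j] by (simp add: field_simps)
    have "t j * q ^ j * \<omega> 1 \<le> t i * q ^ i * \<omega> 1"
      using m(3)[OF _ le] t(1)[of j] by (simp flip: \<omega>t)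
    then have "t j * q ^ j \<le> t i * q ^ i" using pos by simp
    moreover have "q ^ j = q ^ (j - i) * q ^ i" using that by (simp flip: power_add)
    ultimately have "(t j * q ^ (j - i)) * q ^ i \<le> t i * q ^ i" by (simp add: mult.assoc)
    then show ?thesis using q by (simp add: mult_le_cancel_right)
  qed
  have locate: "\<exists>j. t (Suc j) \<le> d \<and> d \<le> t j" if d: "0 < d" "d \<le> 1" for d
  proof -
    obtain n where n: "1 / d < q ^ n" using real_arch_pow[OF q] by blast
    have "t (Suc n) * q ^ Suc n \<le> 1" using scale[of 0 "Suc n"] t(3) by simp
    moreover have "q ^ n \<le> q ^ Suc n" using q by simp
    ultimately have "t (Suc n) * (1 / d) \<le> 1"
      using n t(1)[of "Suc n"] by (smt (verit) mult_left_mono)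
    then have ex: "t (Suc n) \<le> d" using d by (simp add: field_simps)
    define j where "j = (LEAST j. t (Suc j) \<le> d)"
    have 1: "t (Suc j) \<le> d" unfolding j_def by (rule LeastI, rule ex)
    have "d \<le> t j"
    proof (cases j)
      case 0 then show ?thesis using d t(3) by simp
    next
      case (Suc i)
      then have "\<not> t (Suc i) \<le> d" using not_less_Least[of i "\<lambda>j. t (Suc j) \<le> d"] by (simp add: j_def)
      then show ?thesis using Suc by simp
    qed
    with 1 show ?thesis by blast
  qed
  show thesis by (rule that[of t, OF t(3) t(1) t(2) scale locate])
qed

lemma exp_neg_le_inverse_power4:
  fixes x :: real assumes "0 < x" shows "exp (- x) \<le> 256 / x ^ 4"
proof -
  have "(x / 4) ^ 4 \<le> exp (x / 4) ^ 4"
    using assms exp_ge_add_one_self[of "x / 4"] by (intro power_mono) linarith+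
  also have "\<dots> = exp x" by (simp flip: exp_of_nat_mult)
  finally show ?thesis using assms by (simp add: exp_minus field_simps)
qed

lemma one_minus_power_ge:
  fixes t :: real assumes t: "0 < t" "t \<le> 1/2" and n: "real n \<le> 1 / t"
  shows "1 / 9 \<le> (1 - t) ^ n"
proof -
  have "- t - 2 * t\<^sup>2 \<le> ln (1 - t)" using t by (intro ln_one_minus_pos_lower_bound) auto
  moreover have "2 * t\<^sup>2 \<le> t" using t by (simp add: power2_eq_square)
  ultimately have "- 2 * t \<le> ln (1 - t)" by simp
  then have "real n * (- 2 * t) \<le> real n * ln (1 - t)" by (intro mult_left_mono) auto
  moreover have "real n * (2 * t) \<le> 2" using n t by (simp add: field_simps)
  ultimately have "- 2 \<le> real n * ln (1 - t)" by simp
  then have "exp (- 2) \<le> exp (real n * ln (1 - t))" by simp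
  also have "\<dots> = (1 - t) ^ n" using t by (simp add: exp_of_nat_mult)
  finally have "exp (- 2) \<le> (1 - t) ^ n" .
  moreover have "1 / 9 \<le> exp (- 2 :: real)"
  proof -
    have "exp (2 :: real) = exp 1 * exp 1" by (simp flip: exp_add)
    also have "\<dots> \<le> 3 * 3" using exp_le by (intro mult_mono) auto
    finally show ?thesis by (simp add: exp_minus field_simps)
  qed
  ultimately show ?thesis by simp
qed

text \<open>Let \<open>N j\<close> be about \<open>1 / t j\<close>. For \<open>d w\<close> between \<open>t (j + 1)\<close> and \<open>t j\<close> the sum of the \<open>q\<^sup>i w\<^bsup>N i\<^esup>\<close> is of the order of \<open>q\<^sup>j\<close>:
  its terms grow geometrically up to the index \<open>j\<close> and decay superexponentially after \<open>j + 1\<close>. The terms \<open>j\<close> and \<open>j + 1\<close> may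
  cancel each other. Hence the indices are divided by parity into two series; that with
  the parity of \<open>j\<close> is dominated by its term \<open>j\<close>.\<close>
lemma lacunary_pair:
  assumes maj: "majorant \<omega>" and pos: "0 < \<omega> 1"
    and unbdd: "\<And>K. \<exists>t\<in>{0<..1}. K < \<omega> t / t"
  obtains g :: "nat \<Rightarrow> complex \<Rightarrow> complex" and C c :: real where "0 \<le> C" "0 < c"
    "\<And>s. g s holomorphic_on unit_disk"
    "\<And>s w. w \<in> unit_disk \<Longrightarrow> norm (g s w) \<le> C * (\<omega> (disk_dist w) / disk_dist w)"
    "\<And>w. w \<in> unit_disk \<Longrightarrow> c * (\<omega> (disk_dist w) / disk_dist w) \<le> norm (g 0 w) + norm (g 1 w)"
proof -
  note m = majorantD[OF maj]
  \<comment> \<open>Large enough that the terms other than the index \<open>j\<close> add up to less than that term.\<close>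
  define q :: real where "q = 100"
  obtain t where t0: "t 0 = 1" and tpos: "\<And>j. 0 < t j" and tm: "\<And>j. \<omega> (t j) / t j = q ^ j * \<omega> 1"
    and scale: "\<And>i j. i \<le> j \<Longrightarrow> t j * q ^ (j - i) \<le> t i"
    and locate: "\<And>d. 0 < d \<Longrightarrow> d \<le> 1 \<Longrightarrow> \<exists>j. t (Suc j) \<le> d \<and> d \<le> t j"
    using lacunary_scales[OF maj pos unbdd, of q] by (auto simp: q_def)
  have t_le1: "t j \<le> 1" for j
  proof -
    have "t j * 1 \<le> t j * q ^ j" using tpos[of j] by (intro mult_left_mono) (auto simp: q_def)
    then show ?thesis using scale[of 0 j] t0 by simp
  qed
  \<comment> \<open>The shift by \<open>1\<close> makes \<open>N 0 = 0\<close>, so that the series of even index does not vanish at the origin.\<close>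
  define N where "N j = nat \<lceil>1 / t j\<rceil> - 1" for j
  have N: "real (N j) \<le> 1 / t j" "1 / t j - 1 \<le> real (N j)" for j
  proof -
    have "0 < 1 / t j" using tpos by simp
    then have "1 \<le> \<lceil>1 / t j\<rceil>" by linarith
    then have "1 \<le> nat \<lceil>1 / t j\<rceil>" "real (nat \<lceil>1 / t j\<rceil>) = of_int \<lceil>1 / t j\<rceil>" by linarith+
    then have "real (N j) = of_int \<lceil>1 / t j\<rceil> - 1" unfolding N_def by (simp add: of_nat_diff)
    then show "real (N j) \<le> 1 / t j" "1 / t j - 1 \<le> real (N j)" by linarith+
  qed
  define a where "a s j = (if j mod 2 = s then q ^ j else 0)" for s j :: nat
  have a: "0 \<le> a s j" "a s j \<le> q ^ j" for s j by (auto simp: a_def q_def)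
  have tail: "q ^ (k + (j + 2)) * x ^ N (k + (j + 2)) \<le> (768 * q ^ Suc j / q ^ 3) * (1 / q ^ 3) ^ k"
    if x: "0 \<le> x" "x \<le> 1 - t (Suc j)" for x j k
  proof -
    define i where "i = k + (j + 2)"
    have "x ^ N i \<le> (1 - t (Suc j)) ^ N i" using x by (intro power_mono) auto
    also have "\<dots> \<le> exp (- t (Suc j)) ^ N i"
      using x exp_ge_add_one_self[of "- t (Suc j)"] by (intro power_mono) auto
    also have "\<dots> = exp (- (real (N i) * t (Suc j)))" by (simp flip: exp_of_nat_mult)
    also have "\<dots> \<le> exp (1 - q ^ Suc k)"
    proof -
      have "q ^ Suc k \<le> t (Suc j) / t i"
        using scale[of "Suc j" i] tpos[of i] by (simp add: i_def field_simps)
      also have "\<dots> \<le> t (Suc j) * (real (N i) + 1)"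
        using mult_left_mono[OF N(2)[of i], of "t (Suc j)"] tpos[of "Suc j"] by (simp add: algebra_simps)
      also have "\<dots> \<le> real (N i) * t (Suc j) + 1" using t_le1[of "Suc j"]
        by (simp add: distrib_left mult.commute)
      finally show ?thesis by simp
    qed
    also have "\<dots> = exp 1 * exp (- (q ^ Suc k))" by (simp flip: exp_add)
    also have "\<dots> \<le> 3 * (256 / (q ^ Suc k) ^ 4)"
      by (intro mult_mono exp_le exp_neg_le_inverse_power4) (auto simp: q_def)
    finally have "q ^ i * x ^ N i \<le> q ^ i * (3 * (256 / (q ^ Suc k) ^ 4))"
      by (intro mult_left_mono) (auto simp: q_def)
    also have "\<dots> = (768 * q ^ Suc j / q ^ 3) * (1 / q ^ 3) ^ k"
    proof -
      have "(100 ^ k :: real) ^ 4 = (100 ^ 4) ^ k" by (simp only: power_mult[symmetric] mult.commute)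
      then show ?thesis
        by (simp add: i_def power_add power_mult_distrib power_divide q_def field_simps)
          (simp flip: power_mult_distrib)
    qed
    finally show ?thesis by (simp add: i_def)
  qed
  have geo: "summable (\<lambda>k. (768 * q ^ Suc j / q ^ 3) * (1 / q ^ 3) ^ k)"
    "(\<Sum>k. (768 * q ^ Suc j / q ^ 3) * (1 / q ^ 3) ^ k) \<le> q ^ j / 13" for j
  proof -
    show "summable (\<lambda>k. (768 * q ^ Suc j / q ^ 3) * (1 / q ^ 3) ^ k)"
      by (intro summable_mult summable_geometric) (simp add: q_def)
    have "(\<Sum>k. (768 * q ^ Suc j / q ^ 3) * (1 / q ^ 3) ^ k) = (768 * q ^ Suc j / q ^ 3) * (1 / (1 - 1 / q ^ 3))"
      by (subst suminf_mult, intro summable_geometric, simp add: q_def, subst suminf_geometric) (auto simp: q_def)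
    also have "\<dots> \<le> q ^ j / 13" by (simp add: q_def)
    finally show "(\<Sum>k. (768 * q ^ Suc j / q ^ 3) * (1 / q ^ 3) ^ k) \<le> q ^ j / 13" .
  qed
  define F where "F s j w = complex_of_real (a s j) * w ^ N j" for s j and w :: complex
  have normF: "norm (F s j w) \<le> q ^ j * norm w ^ N j" for s j w
    using a[of s j] by (auto simp: F_def norm_mult norm_power intro!: mult_right_mono)
  have tailF: "norm (F s (k + (j + 2)) w) \<le> (768 * q ^ Suc j / q ^ 3) * (1 / q ^ 3) ^ k"
    if "norm w \<le> 1 - t (Suc j)" for s k j w
    using order_trans[OF normF tail[of "norm w" j k]] that by simp
  have near: "\<exists>j. norm w \<le> 1 - t (Suc j) \<and> 1 - t j \<le> norm w" if w: "w \<in> unit_disk" for w :: complex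
  proof -
    obtain j where "t (Suc j) \<le> 1 - norm w" "1 - norm w \<le> t j"
      using locate[of "1 - norm w"] w by auto
    then show ?thesis by (intro exI[of _ j]) auto
  qed
  have "\<exists>g. \<forall>x \<in> unit_disk. ((\<lambda>n. F s n x) sums g x) \<and> g field_differentiable (at x)" for s
  proof (rule series_differentiable_comparison_complex[of unit_disk "F s"])
    fix x :: complex assume x: "x \<in> unit_disk"
    define w where "w = complex_of_real ((1 + norm x) / 2)"
    have w: "w \<in> unit_disk" "norm w = (1 + norm x) / 2" using x by (auto simp: w_def norm_divide simp flip: of_real_add)
    obtain j where j: "norm w \<le> 1 - t (Suc j)" using near[OF w(1)] by blast
    define h where "h n = (768 * q ^ Suc j / q ^ 3) * (1 / q ^ 3) ^ (n - (j + 2))" for n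
    have "summable h"
      using geo(1)[of j] by (subst summable_iff_shift[symmetric, of _ "j + 2"]) (simp add: h_def)
    then have sh: "summable (\<lambda>n. complex_of_real (h n))" by (rule summable_of_real)
    have ev: "\<forall>\<^sub>F n in sequentially. \<forall>y\<in>ball x ((1 - norm x) / 2) \<inter> unit_disk. norm (F s n y) \<le> norm (complex_of_real (h n))"
    proof (rule eventually_sequentiallyI[of "j + 2"], intro ballI)
      fix n y assume n: "j + 2 \<le> n" and y: "y \<in> ball x ((1 - norm x) / 2) \<inter> unit_disk"
      have "norm y \<le> norm x + norm (y - x)" by (metis add.commute norm_triangle_sub)
      also have "\<dots> \<le> norm w" using y w by (simp add: dist_norm norm_minus_commute field_simps)
      finally have "norm y \<le> 1 - t (Suc j)" using j by simp
      then have "norm (F s (n - (j + 2) + (j + 2)) y) \<le> h n" unfolding h_def by (rule tailF)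
      moreover have "n - (j + 2) + (j + 2) = n" using n by simp
      ultimately have "norm (F s n y) \<le> h n" by (simp only:)
      then show "norm (F s n y) \<le> norm (complex_of_real (h n))" by simp
    qed
    have rng: "range (\<lambda>n. complex_of_real (h n)) \<subseteq> \<real>\<^sub>\<ge>\<^sub>0" by (auto simp: h_def q_def)
    have r: "0 < (1 - norm x) / 2" using x by simp
    show "\<exists>d (h :: nat \<Rightarrow> complex). 0 < d \<and> summable h \<and> range h \<subseteq> \<real>\<^sub>\<ge>\<^sub>0 \<and>
        (\<forall>\<^sub>F n in sequentially. \<forall>y\<in>ball x d \<inter> unit_disk. norm (F s n y) \<le> norm (h n))"
      by (rule exI[of _ "(1 - norm x) / 2"], rule exI[of _ "\<lambda>n. complex_of_real (h n)"])
        (intro conjI r sh rng ev)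
  next
    have "F s n = (\<lambda>w. complex_of_real (a s n) * w ^ N n)" for n by (simp add: F_def fun_eq_iff)
    then show "F s n field_differentiable (at x)" for n x by (auto intro!: derivative_intros)
  qed auto
  then obtain g where g: "\<And>s x. x \<in> unit_disk \<Longrightarrow> (\<lambda>n. F s n x) sums g s x"
    and gd: "\<And>s x. x \<in> unit_disk \<Longrightarrow> g s field_differentiable (at x)" by metis
  have hol: "g s holomorphic_on unit_disk" for s
    using gd field_differentiable_at_within unfolding holomorphic_on_def by blast
  have split: "norm (g s w - (\<Sum>i<j + 2. F s i w)) \<le> q ^ j / 13"
    if w: "w \<in> unit_disk" and j: "norm w \<le> 1 - t (Suc j)" for s j w
  proof -
    have sm: "summable (\<lambda>n. F s n w)" using g[OF w] by (rule sums_summable)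
    have "g s w = (\<Sum>n. F s n w)" using g[OF w] by (rule sums_unique)
    also have "\<dots> = (\<Sum>n. F s (n + (j + 2)) w) + (\<Sum>i<j + 2. F s i w)"
      by (rule suminf_split_initial_segment[OF sm])
    finally have "norm (g s w - (\<Sum>i<j + 2. F s i w)) = norm (\<Sum>n. F s (n + (j + 2)) w)" by simp
    also have "\<dots> \<le> (\<Sum>n. (768 * q ^ Suc j / q ^ 3) * (1 / q ^ 3) ^ n)"
      using tailF[OF j] geo(1) by (intro norm_suminf_le) auto
    finally show ?thesis using geo(2)[of j] by simp
  qed
  have init: "norm (\<Sum>i<j. F s i w) \<le> q ^ j / 99" if "w \<in> unit_disk" for s j w
  proof -
    have "norm (\<Sum>i<j. F s i w) \<le> (\<Sum>i<j. q ^ i)"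
    proof (rule sum_norm_le)
      fix i
      have "q ^ i * norm w ^ N i \<le> q ^ i * 1" using that by (intro mult_left_mono power_le_one) (auto simp: q_def)
      then show "norm (F s i w) \<le> q ^ i" using normF[of s i w] by simp
    qed
    also have "\<dots> = (q ^ j - 1) / 99" by (subst geometric_sum) (auto simp: q_def)
    finally show ?thesis by (simp add: divide_right_mono)
  qed
  show thesis
  proof (rule that[of "3 * q / \<omega> 1" "1 / (50 * q * \<omega> 1)" g])
    show "0 \<le> 3 * q / \<omega> 1" "0 < 1 / (50 * q * \<omega> 1)" using pos by (auto simp: q_def)
    show "g s holomorphic_on unit_disk" for s by (rule hol)
    fix w :: complex assume w: "w \<in> unit_disk"
    obtain j where j: "norm w \<le> 1 - t (Suc j)" "1 - t j \<le> norm w" using near[OF w] by blast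
    have d: "0 < disk_dist w" "t (Suc j) \<le> disk_dist w" "disk_dist w \<le> t j"
      using w j by (auto simp: disk_dist_def)
    have m_lower: "q ^ j * \<omega> 1 \<le> \<omega> (disk_dist w) / disk_dist w"
      using m(4)[OF d(1) d(3)] tm by simp
    have m_upper: "\<omega> (disk_dist w) / disk_dist w \<le> q ^ Suc j * \<omega> 1"
      using m(4)[OF tpos d(2)] tm[of "Suc j"] by simp
    show "norm (g s w) \<le> 3 * q / \<omega> 1 * (\<omega> (disk_dist w) / disk_dist w)" for s
    proof -
      have "norm (g s w) \<le> q ^ j / 13 + q ^ (j + 2) / 99"
        using split[OF w j(1), of s] init[OF w, of s "j + 2"] norm_triangle_sub[of "g s w" "\<Sum>i<j + 2. F s i w"] by linarith
      also have "\<dots> \<le> 3 * q / \<omega> 1 * (q ^ j * \<omega> 1)" using pos by (simp add: q_def power_add)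
      also have "\<dots> \<le> 3 * q / \<omega> 1 * (\<omega> (disk_dist w) / disk_dist w)"
        using m_lower pos by (intro mult_left_mono) (auto simp: q_def)
      finally show ?thesis .
    qed
    define s where "s = j mod 2"
    have "q ^ j / 9 \<le> norm (F s j w)"
    proof -
      have "1 / 9 \<le> norm w ^ N j"
      proof (cases "j = 0")
        case True
        then show ?thesis using t0 by (simp add: N_def)
      next
        case False
        have "t j * 100 \<le> t j * q ^ j" using False tpos[of j]
          by (intro mult_left_mono) (auto simp: q_def self_le_power)
        then have tj: "t j \<le> 1 / 2" using scale[of 0 j] t0 by simp
        have "1 / 9 \<le> (1 - t j) ^ N j" using tpos tj N by (intro one_minus_power_ge) auto
        also have "\<dots> \<le> norm w ^ N j" using j tj by (intro power_mono) auto
        finally show ?thesis .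
      qed
      then show ?thesis by (simp add: F_def a_def s_def norm_mult norm_power q_def)
    qed
    moreover have "F s (Suc j) w = 0" unfolding F_def a_def s_def by (simp add: mod_Suc)
    then have "(\<Sum>i<j + 2. F s i w) = F s j w + (\<Sum>i<j. F s i w)" by (simp add: add.commute)
    ultimately have "q ^ j / 9 - q ^ j / 99 - q ^ j / 13 \<le> norm (g s w)"
      using split[OF w j(1), of s] init[OF w, of s j]
        norm_triangle_ineq2[of "F s j w" "F s j w - g s w"] norm_triangle_ineq4[of "g s w - (F s j w + (\<Sum>i<j. F s i w))" "- (\<Sum>i<j. F s i w)"]
      by (simp add: norm_minus_commute algebra_simps) 
    moreover have "q ^ j / 50 \<le> q ^ j / 9 - q ^ j / 99 - q ^ j / 13" by (simp add: q_def)
    ultimately have "q ^ j / 50 \<le> norm (g s w)" by linarith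
    moreover have "norm (g s w) \<le> norm (g 0 w) + norm (g 1 w)" by (cases "s = 0") (auto simp: s_def)
    ultimately have "q ^ j / 50 \<le> norm (g 0 w) + norm (g 1 w)" by linarith
    moreover have "1 / (50 * q * \<omega> 1) * (\<omega> (disk_dist w) / disk_dist w) \<le> 1 / (50 * q * \<omega> 1) * (q ^ Suc j * \<omega> 1)"
      using m_upper pos by (intro mult_left_mono) (auto simp: q_def)
    moreover have "1 / (50 * q * \<omega> 1) * (q ^ Suc j * \<omega> 1) = q ^ j / 50" using pos by (simp add: q_def)
    ultimately show "1 / (50 * q * \<omega> 1) * (\<omega> (disk_dist w) / disk_dist w) \<le> norm (g 0 w) + norm (g 1 w)"
      by linarith
  qed
qed

text \<open>Primitives of the lacunary pair. If \<open>\<omega> t / t\<close> is bounded, then it is comparable to \<open>1\<close> and the identity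
  serves as a test function; if \<open>\<omega>\<close> vanishes on \<open>[0, 1]\<close>, then the zero function does.\<close>
lemma test_functions:
  assumes maj: "majorant \<omega>"
  obtains f :: "nat \<Rightarrow> complex \<Rightarrow> complex" and C c :: real where "0 \<le> C" "0 < c"
    "\<And>s. f s holomorphic_on unit_disk"
    "\<And>s w. w \<in> unit_disk \<Longrightarrow> norm (deriv (f s) w) \<le> C * (\<omega> (disk_dist w) / disk_dist w)"
    "\<And>w. w \<in> unit_disk \<Longrightarrow> c * (\<omega> (disk_dist w) / disk_dist w) \<le> norm (deriv (f 0) w) + norm (deriv (f 1) w)"
proof -
  note m = majorantD[OF maj]
  have disk: "0 < disk_dist w" "disk_dist w \<le> 1" if "w \<in> unit_disk" for w
    using that by (auto simp: disk_dist_def)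
  obtain g :: "nat \<Rightarrow> complex \<Rightarrow> complex" and C c :: real where Cc: "0 \<le> C" "0 < c"
    and g: "\<And>s. g s holomorphic_on unit_disk"
    and up: "\<And>s w. w \<in> unit_disk \<Longrightarrow> norm (g s w) \<le> C * (\<omega> (disk_dist w) / disk_dist w)"
    and low: "\<And>w. w \<in> unit_disk \<Longrightarrow> c * (\<omega> (disk_dist w) / disk_dist w) \<le> norm (g 0 w) + norm (g 1 w)"
  proof (cases "\<omega> 1 = 0")
    case True
    have "\<omega> (disk_dist w) = 0" if "w \<in> unit_disk" for w
      using m(3)[of "disk_dist w" 1] m(1)[of "disk_dist w"] disk[OF that] True by auto
    then show thesis by (intro that[of 0 1 "\<lambda>_ _. 0"]) auto
  next
    case False
    then have pos: "0 < \<omega> 1" using m(1)[of 1] by simp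
    show thesis
    proof (cases "\<forall>K. \<exists>t\<in>{0<..1}. K < \<omega> t / t")
      case True
      then show thesis using lacunary_pair[OF maj pos] that by metis
    next
      case False
      then obtain K where K: "\<And>t. t \<in> {0<..1} \<Longrightarrow> \<omega> t / t \<le> K" by (force simp: not_less)
      have "\<omega> 1 \<le> K" using K[of 1] by simp
      show thesis
      proof (rule that[of "1 / \<omega> 1" "1 / K" "\<lambda>_ _. 1"])
        show "0 \<le> 1 / \<omega> 1" "0 < 1 / K" using pos \<open>\<omega> 1 \<le> K\<close> by auto
        fix w :: complex assume w: "w \<in> unit_disk"
        have "\<omega> 1 / 1 \<le> \<omega> (disk_dist w) / disk_dist w" using disk[OF w] by (intro m(4))
        then have "1 / \<omega> 1 * \<omega> 1 \<le> 1 / \<omega> 1 * (\<omega> (disk_dist w) / disk_dist w)"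
          using pos by (intro mult_left_mono) auto
        then show "norm (1 :: complex) \<le> 1 / \<omega> 1 * (\<omega> (disk_dist w) / disk_dist w)"
          using pos by simp
        have "\<omega> (disk_dist w) / disk_dist w \<le> K" using disk[OF w] by (intro K) auto
        then have "1 / K * (\<omega> (disk_dist w) / disk_dist w) \<le> 1 / K * K"
          using pos \<open>\<omega> 1 \<le> K\<close> by (intro mult_left_mono) auto
        also have "\<dots> = 1" using pos \<open>\<omega> 1 \<le> K\<close> by simp
        finally have "1 / K * (\<omega> (disk_dist w) / disk_dist w) \<le> 1" .
        then show "1 / K * (\<omega> (disk_dist w) / disk_dist w) \<le> norm (1 :: complex) + norm (1 :: complex)"
          by simp
      qed (auto intro!: holomorphic_intros)
    qed
  qed
  have "\<exists>f. \<forall>w\<in>unit_disk. (f has_field_derivative g s w) (at w)" for s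
  proof -
    obtain f where "\<And>z. z \<in> unit_disk \<Longrightarrow> (f has_field_derivative g s z) (at z within unit_disk)"
      using holomorphic_convex_primitive'[OF convex_ball open_ball g] by blast
    then show ?thesis by (auto simp only: at_within_open[OF _ open_ball])
  qed
  then obtain f where f: "\<And>s w. w \<in> unit_disk \<Longrightarrow> (f s has_field_derivative g s w) (at w)" by metis
  have hol: "f s holomorphic_on unit_disk" for s
    using f unfolding holomorphic_on_open[OF open_ball] by blast
  have "deriv (f s) w = g s w" if "w \<in> unit_disk" for s w using f[OF that] by (rule DERIV_imp_deriv)
  then show thesis using that[of C c f] Cc hol up low by simp
qed

section \<open>Composition operators and the slope of the symbol\<close>

lemma slope_le_mono:
  assumes "slope_le F k" "\<And>z. z \<in> unit_disk \<Longrightarrow> k z \<le> k' z"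
  shows "slope_le F k'"
  unfolding slope_le_def
proof (intro ballI allI impI)
  fix z :: complex and e :: real assume "z \<in> unit_disk" "e > 0"
  then obtain \<delta> where \<delta>: "\<delta> > 0" "\<And>a b. a \<in> ball z \<delta> \<Longrightarrow> b \<in> ball z \<delta> \<Longrightarrow> norm (F b - F a) \<le> (k z + e) * norm (b - a)"
    using assms(1) unfolding slope_le_def by blast
  have "(k z + e) * norm (b - a) \<le> (k' z + e) * norm (b - a)" for a b
    using assms(2)[OF \<open>z \<in> unit_disk\<close>] by (intro mult_right_mono) auto
  then show "\<exists>\<delta>>0. \<forall>a\<in>ball z \<delta>. \<forall>b\<in>ball z \<delta>. norm (F b - F a) \<le> (k' z + e) * norm (b - a)"
    using \<delta> by (meson order_trans)
qed

lemma slope_le_holomorphic_sum: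
  assumes A: "A holomorphic_on unit_disk" and B: "B holomorphic_on unit_disk"
    and f: "\<And>w. w \<in> unit_disk \<Longrightarrow> f w = A w + cnj (B w)"
  shows "slope_le f (\<lambda>z. norm (deriv A z) + norm (deriv B z))"
  unfolding slope_le_def
proof (intro ballI allI impI)
  fix z :: complex and e :: real assume z: "z \<in> unit_disk" and e: "e > 0"
  then have e2: "e / 2 > 0" by simp
  obtain d1 where d1: "d1 > 0" "\<And>a b. a \<in> ball z d1 \<Longrightarrow> b \<in> ball z d1 \<Longrightarrow>
      norm (A b - A a) \<le> (norm (deriv A z) + e/2) * norm (b - a)"
    using slope_le_holomorphic[OF A] z e2 unfolding slope_le_def by blast
  obtain d2 where d2: "d2 > 0" "\<And>a b. a \<in> ball z d2 \<Longrightarrow> b \<in> ball z d2 \<Longrightarrow>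
      norm (B b - B a) \<le> (norm (deriv B z) + e/2) * norm (b - a)"
    using slope_le_holomorphic[OF B] z e2 unfolding slope_le_def by blast
  obtain d3 where d3: "d3 > 0" "ball z d3 \<subseteq> unit_disk" using z open_ball openE by blast
  show "\<exists>\<delta>>0. \<forall>a\<in>ball z \<delta>. \<forall>b\<in>ball z \<delta>.
      norm (f b - f a) \<le> (norm (deriv A z) + norm (deriv B z) + e) * norm (b - a)"
  proof (intro exI conjI ballI)
    show "min d1 (min d2 d3) > 0" using d1 d2 d3 by simp
    fix a b assume ab: "a \<in> ball z (min d1 (min d2 d3))" "b \<in> ball z (min d1 (min d2 d3))"
    then have "a \<in> unit_disk" "b \<in> unit_disk" using d3 by auto
    then have "f b - f a = (A b - A a) + cnj (B b - B a)" by (simp add: f del: mem_ball_0)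
    then have "norm (f b - f a) \<le> norm (A b - A a) + norm (B b - B a)"
      using norm_triangle_ineq[of "A b - A a" "cnj (B b - B a)"] by (simp only: complex_mod_cnj)
    also have "\<dots> \<le> (norm (deriv A z) + e/2) * norm (b - a) + (norm (deriv B z) + e/2) * norm (b - a)"
      using ab by (intro add_mono d1 d2) auto
    finally show "norm (f b - f a) \<le> (norm (deriv A z) + norm (deriv B z) + e) * norm (b - a)"
      by (simp add: algebra_simps)
  qed
qed

lemma half_radius_disk:
  assumes "z \<in> unit_disk"
  shows "cball z (disk_dist z / 2) \<subseteq> unit_disk" "0 < disk_dist z / 2"
    "z + of_real (disk_dist z / 2) * cis t \<in> unit_disk"
    "dist (z + of_real (disk_dist z / 2) * cis t) z = disk_dist z / 2"
proof -
  show pos: "0 < disk_dist z / 2" using assms by (simp add: disk_dist_def)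
  show sub: "cball z (disk_dist z / 2) \<subseteq> unit_disk"
  proof
    fix w assume "w \<in> cball z (disk_dist z / 2)"
    moreover have "norm w \<le> norm z + norm (w - z)" by (metis add.commute norm_triangle_sub)
    ultimately show "w \<in> unit_disk" using assms by (simp add: dist_norm norm_minus_commute disk_dist_def)
  qed
  show d: "dist (z + of_real (disk_dist z / 2) * cis t) z = disk_dist z / 2"
    using pos by (simp add: dist_norm norm_mult)
  show "z + of_real (disk_dist z / 2) * cis t \<in> unit_disk"
  proof (rule subsetD[OF sub])
    show "z + of_real (disk_dist z / 2) * cis t \<in> cball z (disk_dist z / 2)"
      unfolding mem_cball dist_commute[of z] d by simp
  qed
qed

lemma norm_deriv_le_Re_osc:
  assumes g: "g holomorphic_on unit_disk" and w: "w \<in> unit_disk"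
    and K: "\<And>t. \<bar>Re (g (w + of_real (disk_dist w / 2) * cis t)) - Re (g w)\<bar> \<le> K"
  shows "norm (deriv g w) \<le> 4 * K / disk_dist w"
proof -
  define \<rho> where "\<rho> = disk_dist w / 2"
  note half = half_radius_disk[OF w, folded \<rho>_def]
  have cont: "continuous_on (cball w \<rho>) g" and hol: "g holomorphic_on ball w \<rho>"
    using half(1) ball_subset_cball[of w \<rho>]
    by (auto intro!: holomorphic_on_imp_continuous_on holomorphic_on_subset[OF g] simp del: mem_ball_0)
  have "norm (deriv g w) \<le> 1 / (pi * \<rho>) * integral {0..2*pi} (\<lambda>t. \<bar>Re (g (w + of_real \<rho> * cis t)) - Re (g w)\<bar>)"
    by (rule norm_deriv_le_Re_mean[OF cont hol half(2)])
  also have "\<dots> \<le> 1 / (pi * \<rho>) * integral {0..2*pi} (\<lambda>t. K)"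
  proof (intro mult_left_mono integral_le)
    have "continuous_on {0..2*pi} (\<lambda>t. g (w + of_real \<rho> * cis t))"
      using half(3) by (intro continuous_on_compose2[OF holomorphic_on_imp_continuous_on[OF g]])
        (auto intro!: continuous_intros simp del: mem_ball_0)
    then show "(\<lambda>t. \<bar>Re (g (w + of_real \<rho> * cis t)) - Re (g w)\<bar>) integrable_on {0..2*pi}"
      by (intro integrable_continuous_real continuous_intros)
  qed (use K half(2) in \<open>auto simp: \<rho>_def\<close>)
  also have "\<dots> = 4 * K / disk_dist w" by (simp add: \<rho>_def)
  finally show ?thesis .
qed

lemma rotated_holomorphic:
  assumes g: "g holomorphic_on unit_disk"
  shows "(\<lambda>w. g (cis \<theta> * w)) holomorphic_on unit_disk"
    and "z \<in> unit_disk \<Longrightarrow> norm (deriv (\<lambda>w. g (cis \<theta> * w)) z) = norm (deriv g (z * cis \<theta>))"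
proof -
  have rot: "cis \<theta> * w \<in> unit_disk" if "w \<in> unit_disk" for w using that by (simp add: norm_mult)
  show "(\<lambda>w. g (cis \<theta> * w)) holomorphic_on unit_disk"
    using rot by (intro holomorphic_on_compose_gen[OF _ g, unfolded o_def, of _ unit_disk] holomorphic_intros) auto
  assume z: "z \<in> unit_disk"
  have "((\<lambda>w. cis \<theta> * w) has_field_derivative cis \<theta>) (at z)" by (auto intro!: derivative_eq_intros)
  moreover have "(g has_field_derivative deriv g (cis \<theta> * z)) (at (cis \<theta> * z))"
    using holomorphic_derivI[OF g open_ball rot[OF z]] .
  ultimately have "((\<lambda>w. g (cis \<theta> * w)) has_field_derivative deriv g (cis \<theta> * z) * cis \<theta>) (at z)"
    by (rule DERIV_chain2[rotated])
  then show "norm (deriv (\<lambda>w. g (cis \<theta> * w)) z) = norm (deriv g (z * cis \<theta>))"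
    by (simp add: DERIV_imp_deriv norm_mult mult.commute)
qed

text \<open>The real part of \<open>f\<close> is that of \<open>A + B\<close>, and its imaginary part is the real part of \<open>-\<i> (A - B)\<close>.
  The oscillation of \<open>f\<close> on a circle of radius \<open>d w / 2\<close> therefore bounds \<open>A' + B'\<close> and \<open>A' - B'\<close>.\<close>
lemma harmonic_gradient_bound:
  assumes \<omega>: "majorant \<omega>"
    and A: "A holomorphic_on unit_disk" and B: "B holomorphic_on unit_disk"
    and f: "\<And>w. w \<in> unit_disk \<Longrightarrow> f w = A w + cnj (B w)"
    and M: "M \<ge> 0" "\<And>z\<^sub>1 z\<^sub>2. z\<^sub>1 \<in> unit_disk \<Longrightarrow> z\<^sub>2 \<in> unit_disk \<Longrightarrow> norm (f z\<^sub>1 - f z\<^sub>2) \<le> M * \<omega> (dist z\<^sub>1 z\<^sub>2)"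
    and w: "w \<in> unit_disk"
  shows "norm (deriv A w) + norm (deriv B w) \<le> 8 * M * (\<omega> (disk_dist w) / disk_dist w)"
proof -
  note m = majorantD[OF \<omega>]
  note half = half_radius_disk[OF w]
  have osc: "norm (f (w + of_real (disk_dist w / 2) * cis t) - f w) \<le> M * \<omega> (disk_dist w)" for t
  proof -
    have "norm (f (w + of_real (disk_dist w / 2) * cis t) - f w) \<le> M * \<omega> (disk_dist w / 2)"
      using M(2)[OF half(3) w, of t] by (simp only: half(4))
    also have "\<dots> \<le> M * \<omega> (disk_dist w)"
      using half(2) M(1) by (intro mult_left_mono m(3)) auto
    finally show ?thesis .
  qed
  have dAB: "A field_differentiable at w" "B field_differentiable at w"
    using A B w by (auto intro: holomorphic_on_imp_differentiable_at)
  have "norm (deriv (\<lambda>z. A z + B z) w) \<le> 4 * (M * \<omega> (disk_dist w)) / disk_dist w"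
  proof (rule norm_deriv_le_Re_osc[OF _ w])
    fix t
    have "\<bar>Re (f (w + of_real (disk_dist w / 2) * cis t) - f w)\<bar> \<le> M * \<omega> (disk_dist w)"
      using abs_Re_le_cmod osc order_trans by blast
    then show "\<bar>Re (A (w + of_real (disk_dist w / 2) * cis t) + B (w + of_real (disk_dist w / 2) * cis t)) - Re (A w + B w)\<bar> \<le> M * \<omega> (disk_dist w)"
      using f[OF half(3)] f[OF w] by simp
  qed (intro holomorphic_intros A B)
  then have plus: "norm (deriv A w + deriv B w) \<le> 4 * (M * \<omega> (disk_dist w)) / disk_dist w"
    using dAB by (simp add: deriv_add)
  have "norm (deriv (\<lambda>z. - \<i> * (A z - B z)) w) \<le> 4 * (M * \<omega> (disk_dist w)) / disk_dist w"
  proof (rule norm_deriv_le_Re_osc[OF _ w])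
    fix t
    have "\<bar>Im (f (w + of_real (disk_dist w / 2) * cis t) - f w)\<bar> \<le> M * \<omega> (disk_dist w)"
      using abs_Im_le_cmod osc order_trans by blast
    then show "\<bar>Re (- \<i> * (A (w + of_real (disk_dist w / 2) * cis t) - B (w + of_real (disk_dist w / 2) * cis t))) - Re (- \<i> * (A w - B w))\<bar> \<le> M * \<omega> (disk_dist w)"
      using f[OF half(3)] f[OF w] by simp
  qed (intro holomorphic_intros A B)
  also have "deriv (\<lambda>z. - \<i> * (A z - B z)) w = - \<i> * (deriv A w - deriv B w)"
    using dAB by (subst deriv_cmult) (auto intro!: derivative_intros simp: deriv_diff)
  finally have minus: "norm (deriv A w - deriv B w) \<le> 4 * (M * \<omega> (disk_dist w)) / disk_dist w"
    by (simp add: norm_mult del: mult_minus_left)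
  have two: "norm (2 * x) \<le> norm (x + y) + norm (x - y)" for x y :: complex
    using norm_triangle_ineq[of "x + y" "x - y"] by simp
  have "norm (2 * deriv A w) \<le> norm (deriv A w + deriv B w) + norm (deriv A w - deriv B w)"
    "norm (2 * deriv B w) \<le> norm (deriv A w + deriv B w) + norm (deriv A w - deriv B w)"
    using two[of "deriv A w" "deriv B w"] two[of "deriv B w" "deriv A w"]
    by (simp_all add: add.commute norm_minus_commute)
  with plus minus show ?thesis by (simp add: norm_mult)
qed

text \<open>The integrand of the slope condition. It bounds the local Lipschitz constant of \<open>f \<circ> \<phi>\<close>, up to a constant,
  whenever the gradient of \<open>f\<close> at \<open>w\<close> is \<open>O(\<omega> (d w) / d w)\<close>.\<close>
definition pullback_slope :: "(real \<Rightarrow> real) \<Rightarrow> (complex \<Rightarrow> complex) \<Rightarrow> complex \<Rightarrow> real" where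
  "pullback_slope \<omega> \<phi> z = norm (deriv \<phi> z) * (\<omega> (disk_dist (\<phi> z)) / disk_dist (\<phi> z))"

locale disk_self_map =
  fixes \<phi> :: "complex \<Rightarrow> complex"
  assumes hol: "\<phi> holomorphic_on unit_disk" and self: "\<phi> ` unit_disk \<subseteq> unit_disk"
begin

lemma self_in: "z \<in> unit_disk \<Longrightarrow> \<phi> z \<in> unit_disk" using self by blast

lemma disk_dist_pos: "z \<in> unit_disk \<Longrightarrow> 0 < disk_dist (\<phi> z)"
  using self_in[of z] by (simp add: disk_dist_def)

lemma continuous_disk_dist: "continuous_on unit_disk (\<lambda>z. disk_dist (\<phi> z))"
  unfolding disk_dist_def by (intro continuous_intros holomorphic_on_imp_continuous_on hol)

lemma continuous_pullback_slope:
  assumes "majorant \<omega>" shows "continuous_on unit_disk (pullback_slope \<omega> \<phi>)"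
  unfolding pullback_slope_def
  using holomorphic_on_imp_continuous_on[OF holomorphic_deriv[OF hol open_ball]]
  by (intro continuous_intros continuous_on_majorant_ratio[OF assms continuous_disk_dist] disk_dist_pos)

lemma pullback_slope_nonneg:
  assumes "majorant \<omega>" "z \<in> unit_disk" shows "0 \<le> pullback_slope \<omega> \<phi> z"
  unfolding pullback_slope_def using majorantD(1)[OF assms(1)] disk_dist_pos[OF assms(2)] by simp

lemma deriv_comp:
  assumes "A holomorphic_on unit_disk" "z \<in> unit_disk"
  shows "deriv (A \<circ> \<phi>) z = deriv A (\<phi> z) * deriv \<phi> z"
  using assms self_in[OF assms(2)] hol holomorphic_on_imp_differentiable_at[OF _ open_ball]
  by (intro deriv_chain) auto

lemma holomorphic_comp:
  assumes "A holomorphic_on unit_disk" shows "A \<circ> \<phi> holomorphic_on unit_disk"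
  using holomorphic_on_compose_gen[OF hol assms self] .

text \<open>The gradient bound for \<open>f\<close> turns \<open>pullback_slope\<close> into a bound on the local Lipschitz constant
  of \<open>f \<circ> \<phi>\<close>.\<close>
lemma slope_bound_imp_composition:
  assumes p: "1 \<le> p" and \<omega>\<^sub>1: "majorant \<omega>\<^sub>1" and \<omega>\<^sub>2: "fast_majorant \<omega>\<^sub>2"
    and M: "0 \<le> M" "\<And>z. z \<in> unit_disk \<Longrightarrow>
      circle_Lp p (\<lambda>\<theta>. pullback_slope \<omega>\<^sub>1 \<phi> (z * cis \<theta>)) \<le> ennreal (M * (\<omega>\<^sub>2 (disk_dist z) / disk_dist z))"
  shows "\<phi> \<in> comp_symbols (Lambda \<omega>\<^sub>1 \<infinity> unit_disk \<inter> harmonic_disk) (Lambda \<omega>\<^sub>2 (ereal p) unit_disk \<inter> harmonic_disk)"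
proof -
  have "f \<circ> \<phi> \<in> Lambda \<omega>\<^sub>2 (ereal p) unit_disk \<inter> harmonic_disk"
    if f: "f \<in> Lambda \<omega>\<^sub>1 \<infinity> unit_disk" "f \<in> harmonic_disk" for f
  proof -
    obtain A B where A: "A holomorphic_on unit_disk" and B: "B holomorphic_on unit_disk"
      and fAB: "\<And>w. w \<in> unit_disk \<Longrightarrow> f w = A w + cnj (B w)"
      using harmonic_on_imp_holomorphic_sum f(2) unfolding harmonic_disk_def by blast
    obtain K where K: "K > 0" "\<And>z\<^sub>1 z\<^sub>2. z\<^sub>1 \<in> unit_disk \<Longrightarrow> z\<^sub>2 \<in> unit_disk \<Longrightarrow> osc \<infinity> f z\<^sub>1 z\<^sub>2 \<le> ennreal (K * \<omega>\<^sub>1 (dist z\<^sub>1 z\<^sub>2))"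
      using f(1) unfolding Lambda_def by blast
    have lip: "norm (f z\<^sub>1 - f z\<^sub>2) \<le> K * \<omega>\<^sub>1 (dist z\<^sub>1 z\<^sub>2)" if "z\<^sub>1 \<in> unit_disk" "z\<^sub>2 \<in> unit_disk" for z\<^sub>1 z\<^sub>2
      using K(2)[OF that] K(1) majorantD(1)[OF \<omega>\<^sub>1, of "dist z\<^sub>1 z\<^sub>2"] by (simp add: osc_def)
    have fAB': "(f \<circ> \<phi>) w = (A \<circ> \<phi>) w + cnj ((B \<circ> \<phi>) w)" if "w \<in> unit_disk" for w
      using fAB[OF self_in[OF that]] by simp
    note A' = holomorphic_comp[OF A] and B' = holomorphic_comp[OF B]
    have harm: "f \<circ> \<phi> \<in> harmonic_disk"
      unfolding harmonic_disk_def mem_Collect_eq by (rule harmonic_on_holomorphic_sum[OF A' B' fAB'])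
    have "slope_le (f \<circ> \<phi>) (\<lambda>z. norm (deriv (A \<circ> \<phi>) z) + norm (deriv (B \<circ> \<phi>) z))"
      by (rule slope_le_holomorphic_sum[OF A' B' fAB'])
    then have slope: "slope_le (f \<circ> \<phi>) (\<lambda>z. 8 * K * pullback_slope \<omega>\<^sub>1 \<phi> z)"
    proof (rule slope_le_mono)
      fix z :: complex assume z: "z \<in> unit_disk"
      have "norm (deriv A (\<phi> z)) + norm (deriv B (\<phi> z)) \<le> 8 * K * (\<omega>\<^sub>1 (disk_dist (\<phi> z)) / disk_dist (\<phi> z))"
        using K(1) lip by (intro harmonic_gradient_bound[OF \<omega>\<^sub>1 A B fAB _ _ self_in[OF z]]) auto
      from mult_right_mono[OF this, of "norm (deriv \<phi> z)"]
      show "norm (deriv (A \<circ> \<phi>) z) + norm (deriv (B \<circ> \<phi>) z) \<le> 8 * K * pullback_slope \<omega>\<^sub>1 \<phi> z"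
        unfolding deriv_comp[OF A z] deriv_comp[OF B z] pullback_slope_def norm_mult
        by (simp add: algebra_simps)
    qed
    have rot: "z * cis \<theta> \<in> unit_disk" if "z \<in> unit_disk" for z \<theta> using that by (simp add: norm_mult)
    have cont: "continuous_on UNIV (\<lambda>\<theta>. pullback_slope \<omega>\<^sub>1 \<phi> (z * cis \<theta>))" if "z \<in> unit_disk" for z
      using rot[OF that] by (intro continuous_on_compose2[OF continuous_pullback_slope[OF \<omega>\<^sub>1]])
        (auto intro!: continuous_intros simp del: mem_ball_0)
    have \<omega>2m: "majorant \<omega>\<^sub>2" using \<omega>\<^sub>2 by (simp add: fast_majorant_def)
    have bd: "circle_Lp p (\<lambda>\<theta>. 8 * K * pullback_slope \<omega>\<^sub>1 \<phi> (z * cis \<theta>)) \<le> ennreal (8 * K * M * (\<omega>\<^sub>2 (disk_dist z) / disk_dist z))"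
      if z: "z \<in> unit_disk" for z
    proof -
      have "0 \<le> \<omega>\<^sub>2 (disk_dist z) / disk_dist z"
        using z majorantD(1)[OF \<omega>2m] by (simp add: disk_dist_def)
      then have "circle_Lp p (\<lambda>\<theta>. 8 * K * pullback_slope \<omega>\<^sub>1 \<phi> (z * cis \<theta>)) \<le> ennreal (8 * K * (M * (\<omega>\<^sub>2 (disk_dist z) / disk_dist z)))"
        using M(1) K(1) cont[OF z] pullback_slope_nonneg[OF \<omega>\<^sub>1 rot[OF z]] M(2)[OF z]
        by (intro circle_Lp_cmult[OF p] mult_nonneg_nonneg) (auto intro: borel_measurable_continuous_onI simp del: times_divide_eq_right)
      then show ?thesis by (simp only: mult.assoc)
    qed
    have cn: "continuous_on unit_disk (\<lambda>z. 8 * K * pullback_slope \<omega>\<^sub>1 \<phi> z)"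
      by (intro continuous_on_mult_left continuous_pullback_slope \<omega>\<^sub>1)
    have pn: "0 \<le> 8 * K * pullback_slope \<omega>\<^sub>1 \<phi> z" if "z \<in> unit_disk" for z
      using K(1) pullback_slope_nonneg[OF \<omega>\<^sub>1 that] by simp
    have KM: "0 \<le> 8 * K * M" using K(1) M(1) by simp
    obtain C where C: "C > 0" "\<And>z\<^sub>1 z\<^sub>2. z\<^sub>1 \<in> unit_disk \<Longrightarrow> z\<^sub>2 \<in> unit_disk \<Longrightarrow>
        osc (ereal p) (f \<circ> \<phi>) z\<^sub>1 z\<^sub>2 \<le> ennreal (C * \<omega>\<^sub>2 (dist z\<^sub>1 z\<^sub>2))"
      using slope_le_imp_Lambda_p[OF p \<omega>\<^sub>2 slope cn pn KM bd] by metis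
    have "continuous_on unit_disk (f \<circ> \<phi>)"
      using A'[THEN holomorphic_on_imp_continuous_on] B'[THEN holomorphic_on_imp_continuous_on]
      by (subst continuous_on_cong[OF refl fAB']) (auto intro!: continuous_intros simp del: mem_ball_0)
    then have "f \<circ> \<phi> \<in> borel_measurable (restrict_space borel unit_disk)"
      by (rule borel_measurable_continuous_on_restrict)
    with C harm show ?thesis unfolding Lambda_def by blast
  qed
  then show ?thesis unfolding comp_symbols_def using hol self by blast
qed

text \<open>Apply the hypothesis to the two test functions \<open>f 0\<close> and \<open>f 1\<close>. Cauchy's formula on circles of radius
  \<open>d z / 2\<close> bounds the means of the derivatives of \<open>f j \<circ> \<phi>\<close> by their oscillation in the mean.\<close>
lemma composition_imp_slope_bound:
  assumes p: "1 \<le> p" and \<omega>\<^sub>1: "fast_majorant \<omega>\<^sub>1" and \<omega>\<^sub>2: "majorant \<omega>\<^sub>2"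
    and comp: "\<phi> \<in> comp_symbols (Lambda \<omega>\<^sub>1 \<infinity> unit_disk \<inter> harmonic_disk) (Lambda \<omega>\<^sub>2 (ereal p) unit_disk \<inter> harmonic_disk)"
  obtains M where "M > 0" "\<And>z. z \<in> unit_disk \<Longrightarrow>
      circle_Lp p (\<lambda>\<theta>. pullback_slope \<omega>\<^sub>1 \<phi> (z * cis \<theta>)) \<le> ennreal (M * (\<omega>\<^sub>2 (disk_dist z) / disk_dist z))"
proof -
  have \<omega>1m: "majorant \<omega>\<^sub>1" using \<omega>\<^sub>1 by (simp add: fast_majorant_def)
  obtain f :: "nat \<Rightarrow> complex \<Rightarrow> complex" and C c where Cc: "0 \<le> C" "0 < c"
    and f: "\<And>s. f s holomorphic_on unit_disk"
    and up: "\<And>s w. w \<in> unit_disk \<Longrightarrow> norm (deriv (f s) w) \<le> C * (\<omega>\<^sub>1 (disk_dist w) / disk_dist w)"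
    and low: "\<And>w. w \<in> unit_disk \<Longrightarrow> c * (\<omega>\<^sub>1 (disk_dist w) / disk_dist w) \<le> norm (deriv (f 0) w) + norm (deriv (f 1) w)"
    by (rule test_functions[OF \<omega>1m], metis)
  have in_X: "f s \<in> Lambda \<omega>\<^sub>1 \<infinity> unit_disk \<inter> harmonic_disk" for s
  proof -
    have "harmonic_on (f s) unit_disk"
      by (rule harmonic_on_holomorphic_sum[OF f[of s], of "\<lambda>_. 0"]) auto
    moreover have "continuous_on unit_disk (\<lambda>z. norm (deriv (f s) z))"
      by (intro continuous_intros holomorphic_on_imp_continuous_on holomorphic_deriv f) simp
    then obtain K where "K > 0" "\<And>z\<^sub>1 z\<^sub>2. z\<^sub>1 \<in> unit_disk \<Longrightarrow> z\<^sub>2 \<in> unit_disk \<Longrightarrow> norm (f s z\<^sub>1 - f s z\<^sub>2) \<le> K * \<omega>\<^sub>1 (dist z\<^sub>1 z\<^sub>2)"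
      using slope_le_imp_Lambda_inf[OF \<omega>\<^sub>1 slope_le_holomorphic[OF f[of s]] _ norm_ge_zero Cc(1) up] by blast
    then have "\<exists>M>0. \<forall>z\<^sub>1\<in>unit_disk. \<forall>z\<^sub>2\<in>unit_disk. osc \<infinity> (f s) z\<^sub>1 z\<^sub>2 \<le> ennreal (M * \<omega>\<^sub>1 (dist z\<^sub>1 z\<^sub>2))"
      by (auto simp: osc_def intro!: exI[of _ K] ennreal_leI simp del: mem_ball_0)
    moreover have "f s \<in> borel_measurable (restrict_space borel unit_disk)"
      by (intro borel_measurable_continuous_on_restrict holomorphic_on_imp_continuous_on f)
    ultimately show ?thesis unfolding Lambda_def harmonic_disk_def by blast
  qed
  have rot: "cis \<theta> * z \<in> unit_disk" if "z \<in> unit_disk" for z \<theta> using that by (simp add: norm_mult)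
  have rot': "z * cis \<theta> \<in> unit_disk" if "z \<in> unit_disk" for z \<theta> using that by (simp add: norm_mult)
  have \<omega>2_pos: "0 \<le> \<omega>\<^sub>2 (disk_dist z) / disk_dist z" if "z \<in> unit_disk" for z
    using that majorantD(1)[OF \<omega>\<^sub>2] by (simp add: disk_dist_def)
  have deriv_Lp: "\<exists>M>0. \<forall>z\<in>unit_disk. circle_Lp p (\<lambda>\<theta>. norm (deriv (f s \<circ> \<phi>) (z * cis \<theta>))) \<le> ennreal (M * (\<omega>\<^sub>2 (disk_dist z) / disk_dist z))" for s
  proof -
    define g where "g = f s \<circ> \<phi>"
    have g: "g holomorphic_on unit_disk" unfolding g_def by (rule holomorphic_comp[OF f])
    have "g \<in> Lambda \<omega>\<^sub>2 (ereal p) unit_disk" using comp in_X[of s] unfolding comp_symbols_def g_def by blast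
    then obtain M where M: "M > 0" "\<And>z\<^sub>1 z\<^sub>2. z\<^sub>1 \<in> unit_disk \<Longrightarrow> z\<^sub>2 \<in> unit_disk \<Longrightarrow>
        circle_Lp p (\<lambda>\<eta>. norm (g (cis \<eta> * z\<^sub>1) - g (cis \<eta> * z\<^sub>2))) \<le> ennreal (M * \<omega>\<^sub>2 (dist z\<^sub>1 z\<^sub>2))"
      unfolding Lambda_def osc_def by auto
    have "circle_Lp p (\<lambda>\<theta>. norm (deriv g (z * cis \<theta>))) \<le> ennreal (4 * M * (\<omega>\<^sub>2 (disk_dist z) / disk_dist z))"
      if z: "z \<in> unit_disk" for z
    proof -
      define \<rho> where "\<rho> = disk_dist z / 2"
      note half = half_radius_disk[OF z, folded \<rho>_def]
      define D where "D t \<theta> = norm (g (cis \<theta> * (z + of_real \<rho> * cis t)) - g (cis \<theta> * z))" for t \<theta>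
      have cg: "continuous_on unit_disk g" by (rule holomorphic_on_imp_continuous_on[OF g])
      have cD: "continuous_on ({0..2*pi} \<times> UNIV) (\<lambda>(t, \<theta>). D t \<theta>)"
        unfolding D_def split_beta' using rot[OF half(3)] rot[OF z]
        by (intro continuous_intros continuous_on_compose2[OF cg]) (auto simp del: mem_ball_0)
      have "circle_Lp p (\<lambda>\<theta>. integral {0..2*pi} (\<lambda>t. D t \<theta>)) \<le> ennreal (2 * pi * (M * \<omega>\<^sub>2 (disk_dist z)))"
      proof (rule circle_Lp_integral_le[OF p cD])
        fix t
        have "circle_Lp p (D t) \<le> ennreal (M * \<omega>\<^sub>2 \<rho>)"
          using M(2)[OF half(3) z, of t] half(4)[of t] unfolding D_def by (simp only:)
        also have "\<dots> \<le> ennreal (M * \<omega>\<^sub>2 (disk_dist z))"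
          using M(1) half(2) by (intro ennreal_leI mult_left_mono majorantD(3)[OF \<omega>\<^sub>2]) (auto simp: \<rho>_def)
        finally show "circle_Lp p (D t) \<le> ennreal (M * \<omega>\<^sub>2 (disk_dist z))" .
      next
        show "(\<integral>\<^sup>+ t\<in>{0<..<2*pi}. ennreal (M * \<omega>\<^sub>2 (disk_dist z)) \<partial>lborel) \<le> ennreal (2 * pi * (M * \<omega>\<^sub>2 (disk_dist z)))"
          using M(1) majorantD(1)[OF \<omega>\<^sub>2] half(2)
          by (simp add: nn_integral_cmult \<rho>_def ennreal_mult'[symmetric] mult.commute)
      qed (use M(1) majorantD(1)[OF \<omega>\<^sub>2] half(2) in \<open>auto simp: D_def \<rho>_def\<close>)
      then have "circle_Lp p (\<lambda>\<theta>. 1 / (pi * \<rho>) * integral {0..2*pi} (\<lambda>t. D t \<theta>))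
          \<le> ennreal (1 / (pi * \<rho>) * (2 * pi * (M * \<omega>\<^sub>2 (disk_dist z))))"
        using half(2) M(1) majorantD(1)[OF \<omega>\<^sub>2, of "disk_dist z"]
        by (intro circle_Lp_cmult[OF p] integral_slice_nonneg[OF cD]
            borel_measurable_continuous_onI[OF continuous_on_integral_param[OF cD]]) (auto simp: D_def \<rho>_def)
      also have "1 / (pi * \<rho>) * (2 * pi * (M * \<omega>\<^sub>2 (disk_dist z))) = 4 * M * (\<omega>\<^sub>2 (disk_dist z) / disk_dist z)"
        using half(2) by (simp add: \<rho>_def)
      finally show ?thesis
      proof (rule circle_Lp_mono[OF p, rotated])
        fix \<theta>
        define h where "h = (\<lambda>w. g (cis \<theta> * w))"
        have hh: "h holomorphic_on unit_disk" unfolding h_def by (rule rotated_holomorphic(1)[OF g])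
        have ch: "continuous_on (cball z \<rho>) h" "h holomorphic_on ball z \<rho>"
          using half(1) ball_subset_cball[of z \<rho>]
          by (auto intro!: holomorphic_on_imp_continuous_on holomorphic_on_subset[OF hh] simp del: mem_ball_0)
        have "norm (deriv g (z * cis \<theta>)) = norm (deriv h z)"
          unfolding h_def by (rule rotated_holomorphic(2)[OF g z, symmetric])
        also have "\<dots> \<le> 1 / (pi * \<rho>) * integral {0..2*pi} (\<lambda>t. \<bar>Re (h (z + of_real \<rho> * cis t)) - Re (h z)\<bar>)"
          by (rule norm_deriv_le_Re_mean[OF ch half(2)])
        also have "\<dots> \<le> 1 / (pi * \<rho>) * integral {0..2*pi} (\<lambda>t. D t \<theta>)"
        proof (intro mult_left_mono integral_le)
          have "continuous_on {0..2*pi} (\<lambda>t. h (z + of_real \<rho> * cis t))"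
            using half(3) by (intro continuous_on_compose2[OF holomorphic_on_imp_continuous_on[OF hh]])
              (auto intro!: continuous_intros simp del: mem_ball_0)
          then show "(\<lambda>t. \<bar>Re (h (z + of_real \<rho> * cis t)) - Re (h z)\<bar>) integrable_on {0..2*pi}"
            by (intro integrable_continuous_real continuous_intros)
          show "(\<lambda>t. D t \<theta>) integrable_on {0..2*pi}"
            by (intro integrable_continuous_real continuous_on_slice[OF cD])
          show "\<bar>Re (h (z + of_real \<rho> * cis t)) - Re (h z)\<bar> \<le> D t \<theta>" for t
            using abs_Re_le_cmod[of "h (z + of_real \<rho> * cis t) - h z"] by (simp add: h_def D_def)
        qed (use half(2) in auto)
        finally show "norm (deriv g (z * cis \<theta>)) \<le> 1 / (pi * \<rho>) * integral {0..2*pi} (\<lambda>t. D t \<theta>)" .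
      qed (use M(1) \<omega>2_pos[OF z] in \<open>auto simp del: times_divide_eq_right\<close>)
    qed
    then show ?thesis using M(1) by (intro exI[of _ "4 * M"]) (auto simp: g_def simp del: mem_ball_0)
  qed
  obtain M0 where M0: "M0 > 0" "\<And>z. z \<in> unit_disk \<Longrightarrow> circle_Lp p (\<lambda>\<theta>. norm (deriv (f 0 \<circ> \<phi>) (z * cis \<theta>))) \<le> ennreal (M0 * (\<omega>\<^sub>2 (disk_dist z) / disk_dist z))"
    using deriv_Lp by blast
  obtain M1 where M1: "M1 > 0" "\<And>z. z \<in> unit_disk \<Longrightarrow> circle_Lp p (\<lambda>\<theta>. norm (deriv (f 1 \<circ> \<phi>) (z * cis \<theta>))) \<le> ennreal (M1 * (\<omega>\<^sub>2 (disk_dist z) / disk_dist z))"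
    using deriv_Lp by blast
  show thesis
  proof (rule that[of "1 / c * (M0 + M1)"])
    show "1 / c * (M0 + M1) > 0" using M0 M1 Cc by simp
    fix z :: complex assume z: "z \<in> unit_disk"
    define R where "R = \<omega>\<^sub>2 (disk_dist z) / disk_dist z"
    have R: "R \<ge> 0" unfolding R_def by (rule \<omega>2_pos[OF z])
    define S where "S = (\<lambda>\<theta>. norm (deriv (f 0 \<circ> \<phi>) (z * cis \<theta>)) + norm (deriv (f 1 \<circ> \<phi>) (z * cis \<theta>)))"
    have c: "continuous_on UNIV (\<lambda>\<theta>. norm (deriv (f s \<circ> \<phi>) (z * cis \<theta>)))" for s
      using rot'[OF z] by (intro continuous_intros continuous_on_compose2[OF holomorphic_on_imp_continuous_on[OF holomorphic_deriv[OF holomorphic_comp[OF f] open_ball]]])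
        (auto simp del: mem_ball_0)
    have m: "(\<lambda>\<theta>. norm (deriv (f s \<circ> \<phi>) (z * cis \<theta>))) \<in> borel_measurable borel" for s
      by (rule borel_measurable_continuous_onI[OF c])
    have "circle_Lp p S \<le> ennreal (M0 * R + M1 * R)"
      unfolding S_def using M0(1) M1(1) R M0(2)[OF z] M1(2)[OF z]
      by (intro circle_Lp_triangle[OF p _ _ m m]) (auto simp flip: R_def)
    then have "circle_Lp p (\<lambda>\<theta>. 1 / c * S \<theta>) \<le> ennreal (1 / c * (M0 * R + M1 * R))"
    proof (rule circle_Lp_cmult[OF p, rotated -1])
      show "S \<in> borel_measurable borel" unfolding S_def using m[of 0] m[of 1] by simp
      show "0 \<le> S \<theta>" for \<theta> by (simp add: S_def)
    qed (use Cc M0(1) M1(1) R in auto)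
    then have "circle_Lp p (\<lambda>\<theta>. pullback_slope \<omega>\<^sub>1 \<phi> (z * cis \<theta>)) \<le> ennreal (1 / c * (M0 * R + M1 * R))"
    proof (rule circle_Lp_mono[OF p, rotated])
      fix \<theta>
      note zr = rot'[OF z, of \<theta>]
      show "0 \<le> pullback_slope \<omega>\<^sub>1 \<phi> (z * cis \<theta>)" by (rule pullback_slope_nonneg[OF \<omega>1m zr])
      have "c * pullback_slope \<omega>\<^sub>1 \<phi> (z * cis \<theta>) \<le> S \<theta>"
        using mult_right_mono[OF low[OF self_in[OF zr]], of "norm (deriv \<phi> (z * cis \<theta>))"]
        unfolding pullback_slope_def S_def deriv_comp[OF f zr] norm_mult by (simp add: algebra_simps)
      then show "pullback_slope \<omega>\<^sub>1 \<phi> (z * cis \<theta>) \<le> 1 / c * S \<theta>" using Cc by (simp add: field_simps)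
    qed (use Cc M0 M1 R in auto)
    also have "1 / c * (M0 * R + M1 * R) = 1 / c * (M0 + M1) * R" by (simp only: distrib_right mult.assoc)
    finally show "circle_Lp p (\<lambda>\<theta>. pullback_slope \<omega>\<^sub>1 \<phi> (z * cis \<theta>)) \<le> ennreal (1 / c * (M0 + M1) * (\<omega>\<^sub>2 (disk_dist z) / disk_dist z))"
      by (simp only: R_def)
  qed
qed

end

section \<open>Poisson integrals and slow majorants\<close>

text \<open>The class enters only through these facts: \<open>\<omega>\<close> is concave and increasing, and its derivative \<open>\<omega>'\<close> is
  comparable to \<open>\<omega> s / s\<close>.\<close>
lemma class_S_tangent:
  assumes S: "\<omega> \<in> class_S"
  obtains \<omega>' :: "real \<Rightarrow> real" and K where "0 < K" "\<And>s. s \<in> {0<..1} \<Longrightarrow> 0 \<le> \<omega>' s"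
    "\<And>s. s \<in> {0<..1} \<Longrightarrow> \<omega> s \<le> K * (s * \<omega>' s)"
    "\<And>s t. s \<in> {0<..1} \<Longrightarrow> t \<in> {0..1} \<Longrightarrow> \<omega> t \<le> \<omega> s + \<omega>' s * (t - s)"
proof -
  from S obtain \<omega>' where maj: "majorant \<omega>"
    and der: "\<And>t. t \<in> {0<..1} \<Longrightarrow> (\<omega> has_real_derivative \<omega>' t) (at t within {0<..1})"
    and anti: "antimono_on {0<..1} \<omega>'" and nz: "\<And>t. t \<in> {0<..1} \<Longrightarrow> \<omega>' t \<noteq> 0"
    and bdd: "bdd_above ((\<lambda>t. \<omega> t / (t * \<omega>' t)) ` {0<..1})"
    unfolding class_S_def by blast
  note m = majorantD[OF maj]
  have nonneg: "0 \<le> \<omega>' s" if s: "s \<in> {0<..1}" for s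
  proof (rule ccontr)
    assume "\<not> 0 \<le> \<omega>' s"
    then have "\<omega>' s < 0" by simp
    from has_real_derivative_neg_dec_left[OF der[OF s] this]
    obtain d where d: "d > 0" "\<And>h. 0 < h \<Longrightarrow> s - h \<in> {0<..1} \<Longrightarrow> h < d \<Longrightarrow> \<omega> s < \<omega> (s - h)" by blast
    define h where "h = min (d/2) (s/2)"
    have "0 < h" "h < d" "s - h \<in> {0<..1}" using d(1) s by (auto simp: h_def)
    then have "\<omega> s < \<omega> (s - h)" using d(2) by blast
    moreover have "\<omega> (s - h) \<le> \<omega> s" using \<open>0 < h\<close> \<open>s - h \<in> {0<..1}\<close> by (intro m(3)) auto
    ultimately show False by simp
  qed
  have mvt: "\<exists>\<xi>. a < \<xi> \<and> \<xi> < b \<and> \<omega> b - \<omega> a = (b - a) * \<omega>' \<xi>" if ab: "0 \<le> a" "a < b" "b \<le> 1" for a b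
  proof -
    have "\<exists>l z. a < z \<and> z < b \<and> (\<omega> has_real_derivative l) (at z) \<and> \<omega> b - \<omega> a = (b - a) * l"
    proof (rule MVT[OF ab(2)])
      show "continuous_on {a..b} \<omega>" using ab by (intro continuous_on_subset[OF m(5)]) auto
      fix x assume x: "a < x" "x < b"
      have "(\<omega> has_real_derivative \<omega>' x) (at x within {0<..<1})"
        using x ab by (intro has_field_derivative_subset[OF der]) auto
      then have "(\<omega> has_real_derivative \<omega>' x) (at x)"
        using x ab by (subst (asm) at_within_open) auto
      then show "\<omega> differentiable (at x)" unfolding real_differentiable_def by blast
    qed
    then obtain l z where z: "a < z" "z < b" "(\<omega> has_real_derivative l) (at z)" "\<omega> b - \<omega> a = (b - a) * l" by blast
    have "(\<omega> has_real_derivative \<omega>' z) (at z within {0<..<1})"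
      using z ab by (intro has_field_derivative_subset[OF der]) auto
    then have "(\<omega> has_real_derivative \<omega>' z) (at z)"
      using z ab by (subst (asm) at_within_open) auto
    then have "l = \<omega>' z" using z(3) DERIV_unique by blast
    then show ?thesis using z by blast
  qed
  have le: "\<omega>' t \<le> \<omega>' s" if "0 < s" "s \<le> t" "t \<le> 1" for s t
    using anti that unfolding monotone_on_def by auto
  have tangent: "\<omega> t \<le> \<omega> s + \<omega>' s * (t - s)" if s: "s \<in> {0<..1}" and t: "t \<in> {0..1}" for s t
  proof -
    consider "t < s" | "t = s" | "s < t" by linarith
    then show ?thesis
    proof cases
      case 1
      then obtain \<xi> where \<xi>: "t < \<xi>" "\<xi> < s" "\<omega> s - \<omega> t = (s - t) * \<omega>' \<xi>" using mvt[of t s] s t by auto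
      have "(s - t) * \<omega>' s \<le> (s - t) * \<omega>' \<xi>" using \<xi> s t 1 by (intro mult_left_mono le) auto
      then show ?thesis using \<xi>(3) by (simp add: algebra_simps)
    next
      case 3
      then obtain \<xi> where \<xi>: "s < \<xi>" "\<xi> < t" "\<omega> t - \<omega> s = (t - s) * \<omega>' \<xi>" using mvt[of s t] s t by auto
      have "(t - s) * \<omega>' \<xi> \<le> (t - s) * \<omega>' s" using \<xi> s t 3 by (intro mult_left_mono le) auto
      then show ?thesis using \<xi>(3) by (simp add: algebra_simps)
    qed simp
  qed
  obtain B where B0: "\<forall>x\<in>(\<lambda>t. \<omega> t / (t * \<omega>' t)) ` {0<..1}. x \<le> B"
    using bdd unfolding bdd_above_def by (rule exE)
  have B: "\<omega> t / (t * \<omega>' t) \<le> B" if "t \<in> {0<..1}" for t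
    using bspec[OF B0 imageI[OF that]] .
  have bound: "\<omega> s \<le> max B 1 * (s * \<omega>' s)" if s: "s \<in> {0<..1}" for s
  proof -
    have pos: "0 < s * \<omega>' s" using nonneg[OF s] nz[OF s] s by simp
    then have "\<omega> s \<le> B * (s * \<omega>' s)" using B[OF s] by (simp add: divide_le_eq)
    also have "\<dots> \<le> max B 1 * (s * \<omega>' s)" using pos by (intro mult_right_mono) auto
    finally show ?thesis .
  qed
  show thesis by (rule that[of "max B 1" \<omega>', OF _ nonneg bound tangent]) auto
qed

lemma norm_cis_minus_1: "norm (cis t - 1) = 2 * \<bar>sin (t / 2)\<bar>"
proof -
  have "(norm (cis t - 1))\<^sup>2 = (cos t - 1)\<^sup>2 + (sin t)\<^sup>2" by (simp add: cmod_power2)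
  also have "\<dots> = 2 - 2 * cos t" using sin_cos_squared_add[of t] by (simp add: power2_eq_square algebra_simps)
  also have "\<dots> = (2 * \<bar>sin (t / 2)\<bar>)\<^sup>2" using cos_double_sin[of "t/2"] by (simp add: power_mult_distrib)
  finally show ?thesis by (rule power2_eq_imp_eq) auto
qed

text \<open>The constant \<open>1 / 3\<close> comes from \<open>sin x \<ge> x - x\<^sup>3 / 6\<close> and \<open>x \<le> \<pi> / 2 < 2\<close>.\<close>
lemma norm_cis_minus_1_bounds:
  shows "norm (cis t - 1) \<le> \<bar>t\<bar>" and "\<bar>t\<bar> \<le> pi \<Longrightarrow> \<bar>t\<bar> / 3 \<le> norm (cis t - 1)"
proof -
  show "norm (cis t - 1) \<le> \<bar>t\<bar>" using abs_sin_x_le_abs_x[of "t/2"] by (simp add: norm_cis_minus_1)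
  assume t: "\<bar>t\<bar> \<le> pi"
  define x where "x = \<bar>t / 2\<bar>"
  have x: "0 \<le> x" "x \<le> 2" using t pi_less_4 by (auto simp: x_def)
  have "(\<Sum>m<3. sin_coeff m * x ^ m) = x" by (simp add: sin_coeff_def numeral_3_eq_3)
  with Maclaurin_sin_bound[of x 3] have "\<bar>sin x - x\<bar> \<le> inverse (fact 3) * \<bar>x\<bar> ^ 3" by simp
  moreover have "inverse (fact 3 :: real) * \<bar>x\<bar> ^ 3 = x ^ 3 / 6"
    using x(1) by (simp add: fact_numeral)
  ultimately have "\<bar>sin x - x\<bar> \<le> x ^ 3 / 6" by (simp only:)
  moreover have "x ^ 3 \<le> 4 * x"
  proof -
    have "x * (x * x) \<le> x * (2 * 2)" using x by (intro mult_left_mono mult_mono) auto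
    then show ?thesis by (simp add: power3_eq_cube mult.assoc)
  qed
  ultimately have "x / 3 \<le> sin x" by linarith
  moreover have "\<bar>sin (t / 2)\<bar> = \<bar>sin x\<bar>" by (auto simp: x_def abs_if)
  ultimately have "x / 3 \<le> \<bar>sin (t / 2)\<bar>" by linarith
  then show "\<bar>t\<bar> / 3 \<le> norm (cis t - 1)" by (simp add: norm_cis_minus_1 x_def)
qed

text \<open>Close to \<open>1\<close> the distance \<open>|cis t - r|\<close> is at least \<open>1 - r\<close>; further away it is at least half of
  \<open>|cis t - 1|\<close>, hence at least \<open>|t| / 6\<close>.\<close>
lemma poisson_kernel_bounds:
  assumes r: "0 \<le> r" "r < 1"
  shows "poisson_kernel (of_real r) t \<le> 2 / (1 - r)"
    and "\<bar>t\<bar> \<le> pi \<Longrightarrow> t \<noteq> 0 \<Longrightarrow> poisson_kernel (of_real r) t \<le> 72 * ((1 - r) / t\<^sup>2)"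
proof -
  have num: "0 \<le> 1 - r\<^sup>2" "1 - r\<^sup>2 \<le> 2 * (1 - r)"
  proof -
    have "1 - r\<^sup>2 = (1 - r) * (1 + r)" by (simp add: power2_eq_square algebra_simps)
    moreover have "(1 - r) * (1 + r) \<le> (1 - r) * 2" using r by (intro mult_left_mono) auto
    ultimately show "0 \<le> 1 - r\<^sup>2" "1 - r\<^sup>2 \<le> 2 * (1 - r)" using r by auto
  qed
  have far: "1 - r \<le> norm (cis t - of_real r)" using norm_triangle_ineq2[of "cis t" "of_real r"] r by simp
  have pk: "poisson_kernel (of_real r) t = (1 - r\<^sup>2) / (norm (cis t - of_real r))\<^sup>2"
    using r by (simp add: poisson_kernel_def)
  have "(1 - r\<^sup>2) / (norm (cis t - of_real r))\<^sup>2 \<le> (2 * (1 - r)) / (1 - r)\<^sup>2"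
    using num far r by (intro frac_le power_mono) auto
  also have "(2 * (1 - r)) / (1 - r)\<^sup>2 = 2 / (1 - r)"
    using r by (simp only: power2_eq_square mult_divide_mult_cancel_right)
  finally show "poisson_kernel (of_real r) t \<le> 2 / (1 - r)" by (simp only: pk)
  assume t: "\<bar>t\<bar> \<le> pi" "t \<noteq> 0"
  have "norm (cis t - 1) \<le> norm (cis t - of_real r) + norm (of_real r - 1 :: complex)"
    using norm_triangle_ineq[of "cis t - of_real r" "of_real r - 1"] by simp
  moreover have "norm (of_real r - 1 :: complex) = 1 - r"
    using r by (metis abs_minus_commute abs_of_pos diff_gt_0_iff_gt norm_of_real of_real_1 of_real_diff)
  ultimately have near: "\<bar>t\<bar> / 6 \<le> norm (cis t - of_real r)"
    using norm_cis_minus_1_bounds(2)[OF t(1)] far by linarith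
  have "(1 - r\<^sup>2) / (norm (cis t - of_real r))\<^sup>2 \<le> (2 * (1 - r)) / (\<bar>t\<bar> / 6)\<^sup>2"
    using num near r t by (intro frac_le power_mono) auto
  also have "\<dots> = 72 * ((1 - r) / t\<^sup>2)" by (simp add: power_divide)
  finally show "poisson_kernel (of_real r) t \<le> 72 * ((1 - r) / t\<^sup>2)" by (simp only: pk)
qed

lemma slow_majorant_unit_interval:
  assumes "slow_majorant \<omega>"
  obtains M where "M > 0" "\<And>\<delta>. 0 < \<delta> \<Longrightarrow> \<delta> \<le> 1 \<Longrightarrow>
    ennreal \<delta> * (\<integral>\<^sup>+ t\<in>{\<delta><..}. ennreal (\<omega> t / t\<^sup>2) \<partial>lborel) \<le> ennreal (M * \<omega> \<delta>)"
proof -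
  from assms obtain \<delta>\<^sub>0 M where maj: "majorant \<omega>" and \<delta>\<^sub>0: "\<delta>\<^sub>0 > 0" and M: "M > 0"
    and *: "\<And>\<delta>. 0 < \<delta> \<Longrightarrow> \<delta> < \<delta>\<^sub>0 \<Longrightarrow>
        ennreal \<delta> * (\<integral>\<^sup>+ t\<in>{\<delta><..}. ennreal (\<omega> t / t\<^sup>2) \<partial>lborel) \<le> ennreal (M * \<omega> \<delta>)"
    unfolding slow_majorant_def by blast
  note m = majorantD[OF maj]
  define \<delta>\<^sub>1 where "\<delta>\<^sub>1 = \<delta>\<^sub>0 / 2"
  have \<delta>\<^sub>1: "0 < \<delta>\<^sub>1" "\<delta>\<^sub>1 < \<delta>\<^sub>0" using \<delta>\<^sub>0 by (auto simp: \<delta>\<^sub>1_def)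
  show thesis
  proof (rule that[of "M + 1 / \<delta>\<^sub>1 * M"])
    show "M + 1 / \<delta>\<^sub>1 * M > 0" using M \<delta>\<^sub>1 by (simp add: add_pos_pos)
    fix \<delta> :: real assume d: "0 < \<delta>" "\<delta> \<le> 1"
    have \<omega>0: "0 \<le> \<omega> \<delta>" using m(1) d by simp
    show "ennreal \<delta> * (\<integral>\<^sup>+ t\<in>{\<delta><..}. ennreal (\<omega> t / t\<^sup>2) \<partial>lborel) \<le> ennreal ((M + 1 / \<delta>\<^sub>1 * M) * \<omega> \<delta>)"
    proof (cases "\<delta> < \<delta>\<^sub>0")
      case True
      have "M * \<omega> \<delta> \<le> (M + 1 / \<delta>\<^sub>1 * M) * \<omega> \<delta>" using \<omega>0 M \<delta>\<^sub>1 by (intro mult_right_mono) auto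
      then show ?thesis using *[OF d(1) True] by (meson ennreal_leI order_trans)
    next
      case False
      define I where "I a = (\<integral>\<^sup>+ t\<in>{a<..}. ennreal (\<omega> t / t\<^sup>2) \<partial>lborel)" for a
      have "I \<delta> \<le> I \<delta>\<^sub>1" unfolding I_def using False \<delta>\<^sub>1
        by (intro nn_integral_mono) (auto simp: indicator_def)
      then have "ennreal \<delta> * I \<delta> \<le> 1 * I \<delta>\<^sub>1"
        using d by (intro mult_mono) (auto simp: ennreal_le_1)
      also have "\<dots> = ennreal (1 / \<delta>\<^sub>1) * (ennreal \<delta>\<^sub>1 * I \<delta>\<^sub>1)"
        using \<delta>\<^sub>1 by (simp flip: ennreal_mult mult.assoc)
      also have "\<dots> \<le> ennreal (1 / \<delta>\<^sub>1) * ennreal (M * \<omega> \<delta>\<^sub>1)"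
        unfolding I_def by (intro mult_left_mono *[OF \<delta>\<^sub>1]) auto
      also have "\<dots> = ennreal (1 / \<delta>\<^sub>1 * M * \<omega> \<delta>\<^sub>1)"
        using \<delta>\<^sub>1 M m(1)[of \<delta>\<^sub>1] by (simp flip: ennreal_mult)
      also have "\<dots> \<le> ennreal ((M + 1 / \<delta>\<^sub>1 * M) * \<omega> \<delta>)"
        using \<delta>\<^sub>1 M False m(1)[of \<delta>\<^sub>1] by (intro ennreal_leI mult_mono m(3)) auto
      finally show ?thesis unfolding I_def .
    qed
  qed
qed

text \<open>With \<open>d = 1 - r\<close>, the part \<open>|t| \<le> d\<close> contributes \<open>O(\<omega> d)\<close> because the kernel is at most \<open>2 / d\<close>, and each of the
  two remaining parts contributes \<open>O(d \<integral> \<omega> t / t\<^sup>2)\<close> over \<open>(d, \<infinity>)\<close>, which is \<open>O(\<omega> d)\<close> for slow \<open>\<omega>\<close>.\<close>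
lemma poisson_kernel_modulus_integral:
  assumes \<omega>: "slow_majorant \<omega>"
  obtains C where "0 \<le> C" "\<And>r. 0 \<le> r \<Longrightarrow> r < 1 \<Longrightarrow>
    (\<integral>\<^sup>+ t\<in>{-pi<..<pi}. ennreal (\<omega> (norm (cis t - 1)) * poisson_kernel (of_real r) t) \<partial>lborel) \<le> ennreal (C * \<omega> (1 - r))"
proof -
  have maj: "majorant \<omega>" using \<omega> by (simp add: slow_majorant_def)
  note m = majorantD[OF maj]
  obtain M where M: "M > 0" and slow: "\<And>\<delta>. 0 < \<delta> \<Longrightarrow> \<delta> \<le> 1 \<Longrightarrow>
    ennreal \<delta> * (\<integral>\<^sup>+ t\<in>{\<delta><..}. ennreal (\<omega> t / t\<^sup>2) \<partial>lborel) \<le> ennreal (M * \<omega> \<delta>)"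
    using slow_majorant_unit_interval[OF \<omega>] by metis
  show thesis
  proof (rule that[of "4 + 72 * M + 72 * M"])
    show "0 \<le> 4 + 72 * M + 72 * M" using M by simp
    fix r :: real assume r: "0 \<le> r" "r < 1"
    define d where "d = 1 - r"
    have d: "0 < d" "d \<le> 1" using r by (auto simp: d_def)
    have \<omega>0: "0 \<le> \<omega> d" using m(1) d by simp
    \<comment> \<open>The tail integrand. The part \<open>t < - d\<close> is its value at \<open>- t\<close>, written as \<open>0 + (-1) * t\<close> to match the rule
      for affine substitutions.\<close>
    define W where "W t = ennreal (\<omega> t / t\<^sup>2) * indicator {d<..} t" for t
    have W: "W \<in> borel_measurable borel"
    proof -
      have "continuous_on {d<..} (\<lambda>t. \<omega> t / t / t)"
        using d by (intro continuous_intros continuous_on_majorant_ratio[OF maj]) auto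
      then have "(\<lambda>t. ennreal (indicator {d<..} t *\<^sub>R (\<omega> t / t / t))) \<in> borel_measurable borel"
        by (intro measurable_compose[OF borel_measurable_continuous_on_indicator measurable_ennreal]) auto
      also have "(\<lambda>t. ennreal (indicator {d<..} t *\<^sub>R (\<omega> t / t / t))) = W"
        by (auto simp: W_def indicator_def power2_eq_square fun_eq_iff)
      finally show ?thesis .
    qed
    have \<omega>le: "\<omega> (norm (cis t - 1)) \<le> \<omega> \<bar>t\<bar>" for t
      using norm_cis_minus_1_bounds(1)[of t] by (intro m(3)) auto
    have pk0: "0 \<le> poisson_kernel (of_real r) t" for t
      using poisson_kernel_pos[of "of_real r" t] r by (simp add: less_imp_le)
    have far: "ennreal (\<omega> (norm (cis t - 1)) * poisson_kernel (of_real r) t) \<le> ennreal 72 * (ennreal d * ennreal (\<omega> \<bar>t\<bar> / t\<^sup>2))"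
      if t: "\<bar>t\<bar> \<le> pi" "d < \<bar>t\<bar>" for t
    proof -
      have "\<omega> (norm (cis t - 1)) * poisson_kernel (of_real r) t \<le> \<omega> \<bar>t\<bar> * (72 * ((1 - r) / t\<^sup>2))"
        using t d m(1)[of "\<bar>t\<bar>"] by (intro mult_mono \<omega>le poisson_kernel_bounds(2)[OF r] pk0) auto
      also have "\<dots> = 72 * (d * (\<omega> \<bar>t\<bar> / t\<^sup>2))" by (simp add: d_def)
      finally have "ennreal (\<omega> (norm (cis t - 1)) * poisson_kernel (of_real r) t) \<le> ennreal (72 * (d * (\<omega> \<bar>t\<bar> / t\<^sup>2)))"
        by (rule ennreal_leI)
      also have "\<dots> = ennreal 72 * (ennreal d * ennreal (\<omega> \<bar>t\<bar> / t\<^sup>2))"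
        using d m(1)[of "\<bar>t\<bar>"] by (subst ennreal_mult, simp, simp, subst ennreal_mult) auto
      finally show ?thesis .
    qed
    have near: "ennreal (\<omega> (norm (cis t - 1)) * poisson_kernel (of_real r) t) \<le> ennreal (\<omega> d * (2 / d))"
      if t: "\<bar>t\<bar> \<le> d" for t
    proof (rule ennreal_leI)
      have "\<omega> \<bar>t\<bar> \<le> \<omega> d" using t by (intro m(3)) auto
      then have "\<omega> (norm (cis t - 1)) \<le> \<omega> d" using \<omega>le[of t] by linarith
      then show "\<omega> (norm (cis t - 1)) * poisson_kernel (of_real r) t \<le> \<omega> d * (2 / d)"
        using poisson_kernel_bounds(1)[OF r, of t] \<omega>0 pk0 unfolding d_def[symmetric] by (intro mult_mono) auto
    qed
    have "(\<integral>\<^sup>+ t\<in>{-pi<..<pi}. ennreal (\<omega> (norm (cis t - 1)) * poisson_kernel (of_real r) t) \<partial>lborel)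
      \<le> (\<integral>\<^sup>+ t. (ennreal (\<omega> d * (2 / d)) * indicator {-d..d} t + ennreal 72 * (ennreal d * W t)) + ennreal 72 * (ennreal d * W (0 + (-1) * t)) \<partial>lborel)"
    proof (intro nn_integral_mono)
      fix t
      consider "\<bar>t\<bar> \<ge> pi" | "\<bar>t\<bar> < pi" "\<bar>t\<bar> \<le> d" | "\<bar>t\<bar> < pi" "d < t" | "\<bar>t\<bar> < pi" "t < - d" by linarith
      then show "ennreal (\<omega> (norm (cis t - 1)) * poisson_kernel (of_real r) t) * indicator {-pi<..<pi} t
        \<le> (ennreal (\<omega> d * (2 / d)) * indicator {-d..d} t + ennreal 72 * (ennreal d * W t)) + ennreal 72 * (ennreal d * W (0 + (-1) * t))"
      proof cases
        case 1
        then have "t \<notin> {-pi<..<pi}" by auto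
        then show ?thesis by simp
      next
        case 2
        then have "t \<in> {-d..d}" by auto
        have "ennreal (\<omega> (norm (cis t - 1)) * poisson_kernel (of_real r) t) * indicator {-pi<..<pi} t \<le> ennreal (\<omega> d * (2 / d)) * indicator {-d..d} t"
          using near[OF 2(2)] \<open>t \<in> {-d..d}\<close> by (auto simp: indicator_def)
        then show ?thesis by (simp add: add_increasing2 add.assoc)
      next
        case 3
        then have "ennreal (\<omega> (norm (cis t - 1)) * poisson_kernel (of_real r) t) * indicator {-pi<..<pi} t \<le> ennreal 72 * (ennreal d * W t)"
          using far[of t] d by (auto simp: indicator_def W_def)
        then show ?thesis by (simp add: add_increasing2 add_increasing)
      next
        case 4
        then have "ennreal (\<omega> (norm (cis t - 1)) * poisson_kernel (of_real r) t) * indicator {-pi<..<pi} t \<le> ennreal 72 * (ennreal d * W (0 + (-1) * t))"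
          using far[of t] d by (auto simp: indicator_def W_def)
        then show ?thesis by (simp add: add_increasing)
      qed
    qed
    also have "\<dots> = ennreal (\<omega> d * (2 / d)) * emeasure lborel {-d..d} + ennreal 72 * (ennreal d * (\<integral>\<^sup>+ t. W t \<partial>lborel))
       + ennreal 72 * (ennreal d * (\<integral>\<^sup>+ t. W (0 + (-1) * t) \<partial>lborel))"
      using W by (simp add: nn_integral_add nn_integral_cmult)
    also have "(\<integral>\<^sup>+ t. W (0 + (-1) * t) \<partial>lborel) = (\<integral>\<^sup>+ t. W t \<partial>lborel)"
      using nn_integral_real_affine[OF W, of "-1" 0] by simp
    also have "ennreal (\<omega> d * (2 / d)) * emeasure lborel {-d..d} + ennreal 72 * (ennreal d * (\<integral>\<^sup>+ t. W t \<partial>lborel))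
       + ennreal 72 * (ennreal d * (\<integral>\<^sup>+ t. W t \<partial>lborel)) \<le> ennreal (4 * \<omega> d) + ennreal 72 * ennreal (M * \<omega> d) + ennreal 72 * ennreal (M * \<omega> d)"
    proof (intro add_mono mult_left_mono)
      have "ennreal (\<omega> d * (2 / d)) * emeasure lborel {-d..d} = ennreal (\<omega> d * (2 / d)) * ennreal (2 * d)"
        using d by simp
      also have "\<dots> = ennreal (4 * \<omega> d)" using d \<omega>0 by (simp flip: ennreal_mult)
      finally show "ennreal (\<omega> d * (2 / d)) * emeasure lborel {-d..d} \<le> ennreal (4 * \<omega> d)" by simp
      show "ennreal d * (\<integral>\<^sup>+ t. W t \<partial>lborel) \<le> ennreal (M * \<omega> d)" using slow[OF d] unfolding W_def .
      then show "ennreal d * (\<integral>\<^sup>+ t. W t \<partial>lborel) \<le> ennreal (M * \<omega> d)" .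
    qed auto
    also have "ennreal 72 * ennreal (M * \<omega> d) = ennreal (72 * (M * \<omega> d))"
      using M \<omega>0 by (intro ennreal_mult[symmetric]) auto
    also have "ennreal (4 * \<omega> d) + ennreal (72 * (M * \<omega> d)) + ennreal (72 * (M * \<omega> d))
        = ennreal (4 * \<omega> d + 72 * (M * \<omega> d) + 72 * (M * \<omega> d))"
    proof -
      have "0 \<le> 4 * \<omega> d" "0 \<le> 72 * (M * \<omega> d)" using M \<omega>0 by auto
      then show ?thesis by (simp only: ennreal_plus add_nonneg_nonneg)
    qed
    also have "4 * \<omega> d + 72 * (M * \<omega> d) + 72 * (M * \<omega> d) = (4 + 72 * M + 72 * M) * \<omega> d"
      by (simp only: distrib_right mult.assoc)
    finally show "(\<integral>\<^sup>+ t\<in>{-pi<..<pi}. ennreal (\<omega> (norm (cis t - 1)) * poisson_kernel (of_real r) t) \<partial>lborel)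
       \<le> ennreal ((4 + 72 * M + 72 * M) * \<omega> (1 - r))" by (simp only: d_def)
  qed
qed

lemma integral_circle_rotate:
  fixes f :: "complex \<Rightarrow> real"
  assumes c: "continuous_on unit_circle f" and nn: "\<And>\<xi>. \<xi> \<in> unit_circle \<Longrightarrow> 0 \<le> f \<xi>"
  shows "integral {0..2*pi} (\<lambda>t. f (cis t)) = integral {-pi..pi} (\<lambda>t. f (cis (t + \<alpha>)))"
proof -
  have ct: "continuous_on UNIV (\<lambda>t. f (cis (t + \<beta>)))" for \<beta>
    by (intro continuous_on_compose2[OF c]) (auto intro!: continuous_intros)
  have nn_Icc: "(\<integral>\<^sup>+ t\<in>{a..b}. ennreal (f (cis (t + \<beta>))) \<partial>lborel) = ennreal (integral {a..b} (\<lambda>t. f (cis (t + \<beta>))))" for a b \<beta>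
  proof -
    have "AE x in lborel. x \<noteq> a \<and> x \<noteq> b"
      using AE_lborel_singleton[of a] AE_lborel_singleton[of b] by eventually_elim simp
    then have "(\<integral>\<^sup>+ t\<in>{a..b}. ennreal (f (cis (t + \<beta>))) \<partial>lborel) = (\<integral>\<^sup>+ t\<in>{a<..<b}. ennreal (f (cis (t + \<beta>))) \<partial>lborel)"
      by (intro nn_integral_cong_AE, elim eventually_mono) (auto simp: indicator_def)
    also have "\<dots> = ennreal (integral {a..b} (\<lambda>t. f (cis (t + \<beta>))))"
      using nn by (intro nn_integral_Ioo_continuous continuous_on_subset[OF ct]) auto
    finally show ?thesis .
  qed
  have nonneg: "0 \<le> integral {a..b} (\<lambda>t. f (cis (t + \<beta>)))" for a b \<beta>
    using nn by (intro integral_nonneg integrable_continuous_real continuous_on_subset[OF ct]) auto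
  have "(\<lambda>\<theta>. ennreal (f (cis \<theta>))) \<in> borel_measurable borel"
    using borel_measurable_continuous_onI[OF ct[of 0]] by simp
  from nn_integral_circle_rotate[where f="\<lambda>z. ennreal (f z)" and a="-pi" and \<alpha>=\<alpha>, OF this]
  have "(\<integral>\<^sup>+ t\<in>{-pi..pi}. ennreal (f (cis (t + \<alpha>))) \<partial>lborel) = (\<integral>\<^sup>+ t\<in>{0..2*pi}. ennreal (f (cis (t + 0))) \<partial>lborel)"
    by simp
  then have "ennreal (integral {-pi..pi} (\<lambda>t. f (cis (t + \<alpha>)))) = ennreal (integral {0..2*pi} (\<lambda>t. f (cis (t + 0))))"
    unfolding nn_Icc .
  then have "integral {-pi..pi} (\<lambda>t. f (cis (t + \<alpha>))) = integral {0..2*pi} (\<lambda>t. f (cis (t + 0)))"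
    by (simp only: ennreal_inj[OF nonneg nonneg])
  then show ?thesis by simp
qed

text \<open>The kernel has mean \<open>1\<close>, so the constant moves under the integral; a rotation then carries \<open>e\<close> to \<open>1\<close>.\<close>
lemma poisson_minus_const_le:
  assumes u: "continuous_on unit_circle u" and r: "0 \<le> r" "r < 1" and e: "e \<in> unit_circle"
  shows "\<bar>poisson u (of_real r * e) - c\<bar>
     \<le> 1 / (2 * pi) * integral {-pi..pi} (\<lambda>t. \<bar>u (cis t * e) - c\<bar> * poisson_kernel (of_real r) t)"
proof -
  define w where "w = of_real r * e"
  have w: "norm w = r" "norm w < 1" using r e by (auto simp: w_def norm_mult)
  have uc: "continuous_on UNIV (\<lambda>t. u (cis t))"
    by (rule continuous_on_compose2[OF u]) (auto intro!: continuous_intros)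
  have uc': "continuous_on {0..2*pi} (\<lambda>t. u (cis t))" using uc by (rule continuous_on_subset) simp
  have pkc: "continuous_on {0..2*pi} (poisson_kernel w)"
    using continuous_on_poisson_kernel[of "{0..2*pi}" "\<lambda>_. w" "\<lambda>t. t"] w by simp
  have int1: "(\<lambda>t. u (cis t) * poisson_kernel w t) integrable_on {0..2*pi}"
    by (intro integrable_continuous_real continuous_on_mult uc' pkc)
  have intc: "((\<lambda>t. c * poisson_kernel w t) has_integral c * (2 * pi)) {0..2*pi}"
    by (intro has_integral_mult_right integral_poisson_kernel w)
  have "2 * pi * (poisson u w - c) = integral {0..2*pi} (\<lambda>t. u (cis t) * poisson_kernel w t) - integral {0..2*pi} (\<lambda>t. c * poisson_kernel w t)"
    using poisson_eq_integral[of u, OF uc w(2)] integral_unique[OF intc] by (simp add: field_simps)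
  also have "\<dots> = integral {0..2*pi} (\<lambda>t. (u (cis t) - c) * poisson_kernel w t)"
    by (simp only: left_diff_distrib integral_diff[OF int1 has_integral_integrable[OF intc]])
  finally have "\<bar>2 * pi * (poisson u w - c)\<bar> = norm (integral {0..2*pi} (\<lambda>t. (u (cis t) - c) * poisson_kernel w t))"
    by simp
  also have "\<dots> \<le> integral {0..2*pi} (\<lambda>t. \<bar>u (cis t) - c\<bar> * poisson_kernel w t)"
    using poisson_kernel_pos[OF w(2)]
    by (intro integral_norm_bound_integral integrable_continuous_real continuous_intros uc' pkc)
      (auto simp: abs_mult less_imp_le)
  also have "\<dots> = integral {0..2*pi} (\<lambda>t. \<bar>u (cis t) - c\<bar> * ((1 - (norm w)\<^sup>2) / (norm (cis t - w))\<^sup>2))"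
    by (simp add: poisson_kernel_def)
  also have "\<dots> = integral {-pi..pi} (\<lambda>t. \<bar>u (cis (t + Arg e)) - c\<bar> * ((1 - (norm w)\<^sup>2) / (norm (cis (t + Arg e) - w))\<^sup>2))"
    (is "_ = ?I")
  proof (rule integral_circle_rotate[where f = "\<lambda>\<xi>. \<bar>u \<xi> - c\<bar> * ((1 - (norm w)\<^sup>2) / (norm (\<xi> - w))\<^sup>2)"])
    show "continuous_on unit_circle (\<lambda>\<xi>. \<bar>u \<xi> - c\<bar> * ((1 - (norm w)\<^sup>2) / (norm (\<xi> - w))\<^sup>2))"
      using w(2) by (intro continuous_intros u) auto
    show "0 \<le> \<bar>u \<xi> - c\<bar> * ((1 - (norm w)\<^sup>2) / (norm (\<xi> - w))\<^sup>2)" for \<xi>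
      using w(2) by (intro mult_nonneg_nonneg divide_nonneg_nonneg) (auto simp: abs_square_le_1)
  qed
  also have "?I = integral {-pi..pi} (\<lambda>t. \<bar>u (cis t * e) - c\<bar> * poisson_kernel (of_real r) t)"
  proof (intro integral_cong)
    fix t
    have ce: "cis (Arg e) = e" using e by (subst cis_Arg) (auto simp: sgn_eq)
    have "cis (t + Arg e) = cis t * e" using ce by (simp flip: cis_mult)
    moreover have "norm (cis t * e - w) = norm (cis t - of_real r)"
    proof -
      have "cis t * e - w = (cis t - of_real r) * e" by (simp add: w_def algebra_simps)
      then show ?thesis using e by (simp add: norm_mult)
    qed
    ultimately show "\<bar>u (cis (t + Arg e)) - c\<bar> * ((1 - (norm w)\<^sup>2) / (norm (cis (t + Arg e) - w))\<^sup>2)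
        = \<bar>u (cis t * e) - c\<bar> * poisson_kernel (of_real r) t"
      using w(1) r by (simp add: poisson_kernel_def)
  qed
  finally have "2 * pi * \<bar>poisson u w - c\<bar> \<le> integral {-pi..pi} (\<lambda>t. \<bar>u (cis t * e) - c\<bar> * poisson_kernel (of_real r) t)"
    by (simp only: abs_mult) simp
  then show ?thesis unfolding w_def by (simp add: field_simps)
qed

text \<open>After a rotation, \<open>P u - u\<close> at \<open>r e\<close> is a weighted mean of the increments of \<open>u\<close> along
  the circle. Minkowski's inequality moves the norm inside, where the hypothesis
  bounds the increments by \<open>\<omega>\<close>.\<close>
lemma poisson_Lp_approximation:
  assumes p: "1 \<le> p" and \<omega>: "slow_majorant \<omega>" and u: "continuous_on unit_circle u" and M: "0 \<le> M"
    and osc: "\<And>\<xi>\<^sub>1 \<xi>\<^sub>2. \<xi>\<^sub>1 \<in> unit_circle \<Longrightarrow> \<xi>\<^sub>2 \<in> unit_circle \<Longrightarrow>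
      circle_Lp p (\<lambda>\<theta>. \<bar>u (cis \<theta> * \<xi>\<^sub>1) - u (cis \<theta> * \<xi>\<^sub>2)\<bar>) \<le> ennreal (M * \<omega> (dist \<xi>\<^sub>1 \<xi>\<^sub>2))"
  obtains C where "0 \<le> C" "\<And>r e. 0 \<le> r \<Longrightarrow> r < 1 \<Longrightarrow> e \<in> unit_circle \<Longrightarrow>
      circle_Lp p (\<lambda>\<theta>. \<bar>poisson u (cis \<theta> * (of_real r * e)) - u (cis \<theta> * e)\<bar>) \<le> ennreal (C * \<omega> (1 - r))"
proof -
  have maj: "majorant \<omega>" using \<omega> by (simp add: slow_majorant_def)
  note m = majorantD[OF maj]
  obtain C\<^sub>0 where C\<^sub>0: "0 \<le> C\<^sub>0" and ker: "\<And>r. 0 \<le> r \<Longrightarrow> r < 1 \<Longrightarrow>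
    (\<integral>\<^sup>+ t\<in>{-pi<..<pi}. ennreal (\<omega> (norm (cis t - 1)) * poisson_kernel (of_real r) t) \<partial>lborel) \<le> ennreal (C\<^sub>0 * \<omega> (1 - r))"
    using poisson_kernel_modulus_integral[OF \<omega>] by metis
  show thesis
  proof (rule that[of "1 / (2 * pi) * (M * C\<^sub>0)"])
    show "0 \<le> 1 / (2 * pi) * (M * C\<^sub>0)" using M C\<^sub>0 by simp
    fix r :: real and e assume r: "0 \<le> r" "r < 1" and e: "e \<in> unit_circle"
    have \<omega>0: "0 \<le> \<omega> (1 - r)" using m(1) r by simp
    have circ: "cis \<theta> * \<xi> \<in> unit_circle" if "\<xi> \<in> unit_circle" for \<theta> \<xi> using that by (simp add: norm_mult)
    have pkc: "continuous_on S (\<lambda>x. poisson_kernel (of_real r) (f x))" if "continuous_on S f" for f and S :: "'z::topological_space set"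
      using that r by (intro continuous_intros) auto
    define g where "g t \<theta> = \<bar>u (cis \<theta> * (cis t * e)) - u (cis \<theta> * e)\<bar> * poisson_kernel (of_real r) t" for t \<theta>
    have cg: "continuous_on ({-pi..pi} \<times> UNIV) (\<lambda>(t, \<theta>). g t \<theta>)"
      unfolding g_def split_beta' using circ[OF circ[OF e]] circ[OF e]
      by (intro continuous_intros pkc continuous_on_compose2[OF u]) auto
    have pk0: "0 \<le> poisson_kernel (of_real r) t" for t
      using poisson_kernel_pos[of "of_real r" t] r by (simp add: less_imp_le)
    have c\<omega>: "continuous_on UNIV (\<lambda>t. \<omega> (norm (cis t - 1)) * poisson_kernel (of_real r) t)"
      by (intro continuous_intros pkc continuous_on_compose2[OF m(5)]) auto
    have "circle_Lp p (\<lambda>\<theta>. integral {-pi..pi} (\<lambda>t. g t \<theta>)) \<le> ennreal (M * C\<^sub>0 * \<omega> (1 - r))"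
    proof (rule circle_Lp_integral_le[OF p cg])
      show "0 \<le> g t \<theta>" for t \<theta> unfolding g_def using pk0 by simp
      show "continuous_on {-pi<..<pi} (\<lambda>t. M * (\<omega> (norm (cis t - 1)) * poisson_kernel (of_real r) t))"
        by (intro continuous_on_mult_left continuous_on_subset[OF c\<omega>]) simp
      show "0 \<le> M * (\<omega> (norm (cis t - 1)) * poisson_kernel (of_real r) t)" for t
        using M m(1) pk0 by simp
      show "circle_Lp p (g t) \<le> ennreal (M * (\<omega> (norm (cis t - 1)) * poisson_kernel (of_real r) t))" for t
      proof -
        have "cis t * e - e = (cis t - 1) * e" by (simp add: algebra_simps)
        then have dist: "dist (cis t * e) e = norm (cis t - 1)" using e by (simp add: dist_norm norm_mult)
        have cu: "continuous_on UNIV (\<lambda>\<theta>. \<bar>u (cis \<theta> * (cis t * e)) - u (cis \<theta> * e)\<bar>)"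
          using circ[OF circ[OF e]] circ[OF e] by (intro continuous_intros continuous_on_compose2[OF u]) auto
        have "circle_Lp p (\<lambda>\<theta>. poisson_kernel (of_real r) t * \<bar>u (cis \<theta> * (cis t * e)) - u (cis \<theta> * e)\<bar>)
          \<le> ennreal (poisson_kernel (of_real r) t * (M * \<omega> (norm (cis t - 1))))"
          using osc[OF circ[OF e] e, of t] M m(1) pk0 unfolding dist
          by (intro circle_Lp_cmult[OF p] borel_measurable_continuous_onI[OF cu]) auto
        moreover have "(\<lambda>\<theta>. poisson_kernel (of_real r) t * \<bar>u (cis \<theta> * (cis t * e)) - u (cis \<theta> * e)\<bar>) = g t"
          by (simp add: g_def fun_eq_iff mult.commute)
        ultimately show ?thesis by (simp add: mult_ac)
      qed
      have "(\<integral>\<^sup>+ t\<in>{-pi<..<pi}. ennreal (M * (\<omega> (norm (cis t - 1)) * poisson_kernel (of_real r) t)) \<partial>lborel)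
        = (\<integral>\<^sup>+ t. ennreal M * (ennreal (\<omega> (norm (cis t - 1)) * poisson_kernel (of_real r) t) * indicator {-pi<..<pi} t) \<partial>lborel)"
        using M m(1) pk0 by (intro nn_integral_cong) (simp add: ennreal_mult mult.assoc)
      also have "\<dots> = ennreal M * (\<integral>\<^sup>+ t\<in>{-pi<..<pi}. ennreal (\<omega> (norm (cis t - 1)) * poisson_kernel (of_real r) t) \<partial>lborel)"
        using borel_measurable_continuous_onI[OF c\<omega>] by (intro nn_integral_cmult) auto
      also have "\<dots> \<le> ennreal M * ennreal (C\<^sub>0 * \<omega> (1 - r))" by (intro mult_left_mono ker r) simp
      also have "\<dots> = ennreal (M * C\<^sub>0 * \<omega> (1 - r))" using M C\<^sub>0 \<omega>0 by (simp add: mult.assoc flip: ennreal_mult)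
      finally show "(\<integral>\<^sup>+ t\<in>{-pi<..<pi}. ennreal (M * (\<omega> (norm (cis t - 1)) * poisson_kernel (of_real r) t)) \<partial>lborel)
         \<le> ennreal (M * C\<^sub>0 * \<omega> (1 - r))" .
      show "0 \<le> M * C\<^sub>0 * \<omega> (1 - r)" using M C\<^sub>0 \<omega>0 by simp
    qed
    then have "circle_Lp p (\<lambda>\<theta>. 1 / (2 * pi) * integral {-pi..pi} (\<lambda>t. g t \<theta>)) \<le> ennreal (1 / (2 * pi) * (M * C\<^sub>0 * \<omega> (1 - r)))"
      using M C\<^sub>0 \<omega>0 pk0
      by (intro circle_Lp_cmult[OF p] integral_slice_nonneg[OF cg]
          borel_measurable_continuous_onI[OF continuous_on_integral_param[OF cg]]) (auto simp: g_def)
    then have "circle_Lp p (\<lambda>\<theta>. \<bar>poisson u (cis \<theta> * (of_real r * e)) - u (cis \<theta> * e)\<bar>) \<le> ennreal (1 / (2 * pi) * (M * C\<^sub>0 * \<omega> (1 - r)))"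
    proof (rule circle_Lp_mono[OF p, rotated])
      fix \<theta>
      show "\<bar>poisson u (cis \<theta> * (of_real r * e)) - u (cis \<theta> * e)\<bar> \<le> 1 / (2 * pi) * integral {-pi..pi} (\<lambda>t. g t \<theta>)"
        using poisson_minus_const_le[OF u r circ[OF e, of \<theta>], of "u (cis \<theta> * e)"]
        by (simp add: g_def mult_ac)
    qed (use M C\<^sub>0 \<omega>0 in auto)
    then show "circle_Lp p (\<lambda>\<theta>. \<bar>poisson u (cis \<theta> * (of_real r * e)) - u (cis \<theta> * e)\<bar>) \<le> ennreal (1 / (2 * pi) * (M * C\<^sub>0) * \<omega> (1 - r))"
      by (simp only: mult.assoc)
  qed
qed

section \<open>The majorant of the boundary distance along the symbol\<close>

lemma majorant_secant_le:
  assumes \<omega>: "majorant \<omega>" and st: "0 < s" "0 < t"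
  shows "\<bar>\<omega> t - \<omega> s\<bar> \<le> max (\<omega> s / s) (\<omega> t / t) * \<bar>t - s\<bar>"
proof -
  have main: "\<bar>\<omega> b - \<omega> a\<bar> \<le> (\<omega> a / a) * \<bar>b - a\<bar>" if ab: "0 < a" "a \<le> b" for a b
  proof -
    have "\<omega> b / b \<le> \<omega> a / a" using majorantD(4)[OF \<omega> ab] .
    then have "\<omega> b \<le> (\<omega> a / a) * b" using ab by (simp add: divide_le_eq)
    moreover have "(\<omega> a / a) * (b - a) = (\<omega> a / a) * b - \<omega> a" using ab by (simp add: right_diff_distrib)
    moreover have "\<omega> a \<le> \<omega> b" using ab by (intro majorantD(3)[OF \<omega>]) auto
    ultimately show ?thesis using ab by simp
  qed
  show ?thesis
  proof (cases "s \<le> t")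
    case True
    have "(\<omega> s / s) * \<bar>t - s\<bar> \<le> max (\<omega> s / s) (\<omega> t / t) * \<bar>t - s\<bar>" by (intro mult_right_mono) auto
    then show ?thesis using main[OF st(1) True] by linarith
  next
    case False
    have "(\<omega> t / t) * \<bar>s - t\<bar> \<le> max (\<omega> s / s) (\<omega> t / t) * \<bar>s - t\<bar>" by (intro mult_right_mono) auto
    then show ?thesis using main[OF st(2), of s] False by (simp add: abs_minus_commute)
  qed
qed

lemma osc_of_real:
  "osc (ereal p) (\<lambda>z. complex_of_real (u z)) z\<^sub>1 z\<^sub>2 = circle_Lp p (\<lambda>\<eta>. \<bar>u (cis \<eta> * z\<^sub>1) - u (cis \<eta> * z\<^sub>2)\<bar>)"
  by (simp add: osc_def flip: of_real_diff)

lemma circle_Lp_bounded: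
  assumes p: "1 \<le> p" and g: "\<And>\<theta>. 0 \<le> g \<theta>" "\<And>\<theta>. g \<theta> \<le> K"
  shows "circle_Lp p g \<le> ennreal (K * (2 * pi) powr (1 / p))"
proof -
  have K: "0 \<le> K" using g[of 0] by linarith
  have "(\<integral>\<^sup>+ \<theta>\<in>{0..2 * pi}. ennreal (g \<theta> powr p) \<partial>lborel) \<le> (\<integral>\<^sup>+ \<theta>\<in>{0..2 * pi}. ennreal (K powr p) \<partial>lborel)"
    using p g by (intro nn_integral_mono mult_right_mono ennreal_leI powr_mono2) auto
  also have "\<dots> = ennreal (K powr p) * ennreal (2 * pi)" by (simp add: nn_integral_cmult)
  also have "\<dots> = ennreal ((K * (2 * pi) powr (1 / p)) powr p)"
    using K p by (simp add: powr_mult powr_powr ennreal_mult)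
  finally show ?thesis using p K by (subst circle_Lp_le_iff) auto
qed

locale closed_disk_self_map = disk_self_map +
  assumes cont: "continuous_on closed_unit_disk \<phi>"
begin

lemma norm_le_1: "z \<in> closed_unit_disk \<Longrightarrow> norm (\<phi> z) \<le> 1"
proof -
  have "\<phi> ` closure unit_disk \<subseteq> closed_unit_disk"
    using cont self by (intro image_closure_subset) (auto simp: closure_ball)
  then show "z \<in> closed_unit_disk \<Longrightarrow> norm (\<phi> z) \<le> 1"
    by (simp add: closure_ball image_subset_iff)
qed

definition dist_comp :: "(real \<Rightarrow> real) \<Rightarrow> complex \<Rightarrow> real" where
  "dist_comp \<omega> z = \<omega> (disk_dist (\<phi> z))"

lemma continuous_dist_comp:
  assumes "majorant \<omega>" shows "continuous_on closed_unit_disk (dist_comp \<omega>)"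
  unfolding dist_comp_def disk_dist_def
  using norm_le_1 by (intro continuous_on_compose2[OF majorantD(5)[OF assms]] continuous_intros cont) auto

lemma dist_comp_nonneg:
  assumes "majorant \<omega>" "z \<in> closed_unit_disk" shows "0 \<le> dist_comp \<omega> z"
  unfolding dist_comp_def using norm_le_1[OF assms(2)] by (intro majorantD(1)[OF assms(1)]) (simp add: disk_dist_def)

text \<open>Secants of \<open>\<omega>\<close> have slope at most \<open>\<omega> s / s\<close> at their left end \<open>s\<close>, and \<open>1 - |\<phi>|\<close> changes at most as fast
  as \<open>\<phi>\<close>. Differences are estimated rather than derivatives, because \<open>|\<phi>|\<close> is not differentiable at simple zeros
  of \<open>\<phi>\<close>.\<close>
lemma slope_le_dist_comp:
  assumes \<omega>: "majorant \<omega>"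
  shows "slope_le (\<lambda>z. complex_of_real (dist_comp \<omega> z)) (pullback_slope \<omega> \<phi>)"
  unfolding slope_le_def
proof (intro ballI allI impI)
  fix z :: complex and e :: real assume z: "z \<in> unit_disk" and e: "e > 0"
  define R where "R w = \<omega> (disk_dist (\<phi> w)) / disk_dist (\<phi> w)" for w
  define D where "D = norm (deriv \<phi> z)"
  have R0: "0 \<le> R w" if "w \<in> unit_disk" for w
    using disk_dist_pos[OF that] majorantD(1)[OF \<omega>] by (simp add: R_def)
  have D0: "0 \<le> D" by (simp add: D_def)
  \<comment> \<open>Chosen so that \<open>(R z + e1) (D + e1) \<le> R z D + e\<close>.\<close>
  define e1 where "e1 = min 1 (e / (R z + D + 1))"
  have e1: "0 < e1" "e1 \<le> 1" using e R0[OF z] D0 by (auto simp: e1_def)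
  have small: "(R z + e1) * (D + e1) \<le> R z * D + e"
  proof -
    have "e1 * (R z + D + e1) \<le> e1 * (R z + D + 1)" using e1 by (intro mult_left_mono) auto
    also have "\<dots> \<le> e / (R z + D + 1) * (R z + D + 1)"
      using R0[OF z] D0 by (intro mult_right_mono) (auto simp: e1_def)
    also have "\<dots> = e" using R0[OF z] D0 by simp
    finally show ?thesis by (simp add: algebra_simps)
  qed
  have "continuous_on unit_disk R"
    unfolding R_def by (intro continuous_on_majorant_ratio[OF \<omega> continuous_disk_dist] disk_dist_pos)
  then have "isCont R z" using z by (simp add: continuous_on_eq_continuous_at del: mem_ball_0)
  then obtain d1 where d1: "d1 > 0" "\<And>w. dist w z < d1 \<Longrightarrow> dist (R w) (R z) < e1"
    using e1 unfolding continuous_at_eps_delta by blast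
  obtain d2 where d2: "d2 > 0" "\<And>a b. a \<in> ball z d2 \<Longrightarrow> b \<in> ball z d2 \<Longrightarrow> norm (\<phi> b - \<phi> a) \<le> (D + e1) * norm (b - a)"
    using slope_le_holomorphic[OF hol] z e1 unfolding slope_le_def D_def by blast
  obtain d3 where d3: "d3 > 0" "ball z d3 \<subseteq> unit_disk" using z open_ball openE by blast
  show "\<exists>\<delta>>0. \<forall>a\<in>ball z \<delta>. \<forall>b\<in>ball z \<delta>.
      norm (complex_of_real (dist_comp \<omega> b) - complex_of_real (dist_comp \<omega> a)) \<le> (pullback_slope \<omega> \<phi> z + e) * norm (b - a)"
  proof (intro exI conjI ballI)
    show "min d1 (min d2 d3) > 0" using d1 d2 d3 by simp
    fix a b assume ab: "a \<in> ball z (min d1 (min d2 d3))" "b \<in> ball z (min d1 (min d2 d3))"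
    then have ab': "a \<in> unit_disk" "b \<in> unit_disk" using d3 by auto
    have "\<bar>dist_comp \<omega> b - dist_comp \<omega> a\<bar> \<le> max (R a) (R b) * \<bar>disk_dist (\<phi> b) - disk_dist (\<phi> a)\<bar>"
      unfolding dist_comp_def R_def using disk_dist_pos ab' by (intro majorant_secant_le[OF \<omega>]) blast+
    also have "\<dots> \<le> (R z + e1) * ((D + e1) * norm (b - a))"
    proof (intro mult_mono)
      have "dist (R a) (R z) < e1" "dist (R b) (R z) < e1" using ab by (auto intro!: d1 simp: dist_commute)
      then show "max (R a) (R b) \<le> R z + e1" by (auto simp: dist_real_def)
      have "\<bar>disk_dist (\<phi> b) - disk_dist (\<phi> a)\<bar> \<le> norm (\<phi> b - \<phi> a)"
        using norm_triangle_ineq3[of "\<phi> b" "\<phi> a"] by (simp add: disk_dist_def abs_minus_commute)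
      also have "\<dots> \<le> (D + e1) * norm (b - a)" using ab by (intro d2) auto
      finally show "\<bar>disk_dist (\<phi> b) - disk_dist (\<phi> a)\<bar> \<le> (D + e1) * norm (b - a)" .
    qed (use R0[OF z] e1 in auto)
    also have "\<dots> = ((R z + e1) * (D + e1)) * norm (b - a)" by (simp only: mult.assoc)
    also have "\<dots> \<le> (R z * D + e) * norm (b - a)" by (intro mult_right_mono small) simp
    also have "R z * D = pullback_slope \<omega> \<phi> z" by (simp add: pullback_slope_def R_def D_def)
    finally show "norm (complex_of_real (dist_comp \<omega> b) - complex_of_real (dist_comp \<omega> a)) \<le> (pullback_slope \<omega> \<phi> z + e) * norm (b - a)"
      by (simp flip: of_real_diff)
  qed
qed

text \<open>On the open disk this is the path argument. Dilations \<open>r z\<close> with \<open>r\<close> tending to \<open>1\<close> and Fatou's lemma extend the bound to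
  the closed disk, since \<open>\<omega>\<^sub>2\<close> increases.\<close>
lemma slope_bound_imp_Lambda_closed:
  assumes p: "1 \<le> p" and \<omega>\<^sub>1: "majorant \<omega>\<^sub>1" and \<omega>\<^sub>2: "fast_majorant \<omega>\<^sub>2"
    and M: "0 \<le> M" "\<And>z. z \<in> unit_disk \<Longrightarrow>
      circle_Lp p (\<lambda>\<theta>. pullback_slope \<omega>\<^sub>1 \<phi> (z * cis \<theta>)) \<le> ennreal (M * (\<omega>\<^sub>2 (disk_dist z) / disk_dist z))"
  shows "(\<lambda>z. complex_of_real (dist_comp \<omega>\<^sub>1 z)) \<in> Lambda \<omega>\<^sub>2 (ereal p) closed_unit_disk"
proof -
  let ?u = "dist_comp \<omega>\<^sub>1"
  have \<omega>2m: "majorant \<omega>\<^sub>2" using \<omega>\<^sub>2 by (simp add: fast_majorant_def)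
  obtain C where C: "C > 0" and open_bd: "\<And>z\<^sub>1 z\<^sub>2. z\<^sub>1 \<in> unit_disk \<Longrightarrow> z\<^sub>2 \<in> unit_disk \<Longrightarrow>
        osc (ereal p) (\<lambda>z. complex_of_real (?u z)) z\<^sub>1 z\<^sub>2 \<le> ennreal (C * \<omega>\<^sub>2 (dist z\<^sub>1 z\<^sub>2))"
    using slope_le_imp_Lambda_p[OF p \<omega>\<^sub>2 slope_le_dist_comp[OF \<omega>\<^sub>1] continuous_pullback_slope[OF \<omega>\<^sub>1]
        pullback_slope_nonneg[OF \<omega>\<^sub>1] M] by metis
  have closed_bd: "osc (ereal p) (\<lambda>z. complex_of_real (?u z)) z\<^sub>1 z\<^sub>2 \<le> ennreal (C * \<omega>\<^sub>2 (dist z\<^sub>1 z\<^sub>2))"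
    if z: "z\<^sub>1 \<in> closed_unit_disk" "z\<^sub>2 \<in> closed_unit_disk" for z\<^sub>1 z\<^sub>2
    unfolding osc_of_real
  proof (rule circle_Lp_Fatou[OF p])
    define r where "r n = 1 - 1 / real (n + 2)" for n
    have r: "0 \<le> r n" "r n < 1" for n by (auto simp: r_def field_simps)
    have "r \<longlonglongrightarrow> 1 - 0"
      unfolding r_def by (intro tendsto_diff tendsto_const LIMSEQ_ignore_initial_segment[OF lim_1_over_n])
    then have rlim: "r \<longlonglongrightarrow> 1" by simp
    have in_disk: "cis \<theta> * (of_real (r n) * z) \<in> unit_disk" if "z \<in> closed_unit_disk" for \<theta> z n
    proof -
      have "norm (cis \<theta> * (of_real (r n) * z)) \<le> r n * 1"
        using that r[of n] unfolding norm_mult norm_of_real by (simp add: mult_left_le)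
      then show ?thesis using r[of n] by simp
    qed
    have in_closed: "cis \<theta> * z \<in> closed_unit_disk" if "z \<in> closed_unit_disk" for \<theta> z
      using that by (simp add: norm_mult)
    have in_closed': "cis \<theta> * (of_real (r n) * z) \<in> closed_unit_disk" if "z \<in> closed_unit_disk" for \<theta> z n
      by (rule subsetD[OF ball_subset_cball in_disk[OF that]])
    define g where "g n \<theta> = \<bar>?u (cis \<theta> * (of_real (r n) * z\<^sub>1)) - ?u (cis \<theta> * (of_real (r n) * z\<^sub>2))\<bar>" for n \<theta>
    note cu = continuous_dist_comp[OF \<omega>\<^sub>1]
    show "0 \<le> C * \<omega>\<^sub>2 (dist z\<^sub>1 z\<^sub>2)" using C majorantD(1)[OF \<omega>2m] by simp
    show "g n \<in> borel_measurable borel" for n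
      unfolding g_def using in_closed'[OF z(1)] in_closed'[OF z(2)]
      by (intro borel_measurable_continuous_onI continuous_intros continuous_on_compose2[OF cu])
        (auto simp del: mem_cball_0)
    show "0 \<le> g n \<theta>" for n \<theta> by (simp add: g_def)
    show "circle_Lp p (g n) \<le> ennreal (C * \<omega>\<^sub>2 (dist z\<^sub>1 z\<^sub>2))" for n
    proof -
      have "circle_Lp p (g n) \<le> ennreal (C * \<omega>\<^sub>2 (dist (of_real (r n) * z\<^sub>1) (of_real (r n) * z\<^sub>2)))"
        using open_bd[of "of_real (r n) * z\<^sub>1" "of_real (r n) * z\<^sub>2"] in_disk[OF z(1), of 0 n] in_disk[OF z(2), of 0 n]
        by (simp add: osc_of_real g_def[abs_def])
      also have "dist (of_real (r n) * z\<^sub>1) (of_real (r n) * z\<^sub>2) = r n * dist z\<^sub>1 z\<^sub>2"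
        using r[of n] unfolding dist_norm by (simp add: norm_mult flip: right_diff_distrib)
      also have "ennreal (C * \<omega>\<^sub>2 (r n * dist z\<^sub>1 z\<^sub>2)) \<le> ennreal (C * \<omega>\<^sub>2 (dist z\<^sub>1 z\<^sub>2))"
        using C r[of n] by (intro ennreal_leI mult_left_mono majorantD(3)[OF \<omega>2m]) (auto simp: mult_left_le_one_le)
      finally show ?thesis .
    qed
    show "(\<lambda>n. g n \<theta>) \<longlonglongrightarrow> \<bar>?u (cis \<theta> * z\<^sub>1) - ?u (cis \<theta> * z\<^sub>2)\<bar>" for \<theta>
    proof -
      have lim: "(\<lambda>n. ?u (cis \<theta> * (of_real (r n) * z))) \<longlonglongrightarrow> ?u (cis \<theta> * z)" if "z \<in> closed_unit_disk" for z
      proof (rule continuous_on_tendsto_compose[OF cu])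
        have "(\<lambda>n. cis \<theta> * (of_real (r n) * z)) \<longlonglongrightarrow> cis \<theta> * (of_real 1 * z)"
          by (intro tendsto_intros rlim)
        then show "(\<lambda>n. cis \<theta> * (of_real (r n) * z)) \<longlonglongrightarrow> cis \<theta> * z" by simp
        show "cis \<theta> * z \<in> closed_unit_disk" by (rule in_closed[OF that])
        show "\<forall>\<^sub>F n in sequentially. cis \<theta> * (of_real (r n) * z) \<in> closed_unit_disk"
          by (intro always_eventually allI in_closed'[OF that])
      qed
      show ?thesis unfolding g_def by (intro tendsto_intros lim z)
    qed
  qed simp
  have "continuous_on closed_unit_disk (\<lambda>z. complex_of_real (?u z))"
    by (intro continuous_intros continuous_dist_comp \<omega>\<^sub>1)
  then have "(\<lambda>z. complex_of_real (?u z)) \<in> borel_measurable (restrict_space borel closed_unit_disk)"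
    by (rule borel_measurable_continuous_on_restrict)
  with C closed_bd show ?thesis unfolding Lambda_def by blast
qed

lemma dist_comp_Lp_circle:
  assumes p: "1 \<le> p" and \<omega>: "majorant \<omega>"
  shows "(\<lambda>z. complex_of_real (dist_comp \<omega> z)) \<in> Lp_circle (ereal p)"
proof -
  have c: "continuous_on UNIV (\<lambda>\<eta>. complex_of_real (dist_comp \<omega> (cis \<eta>)))"
    by (intro continuous_intros continuous_on_compose2[OF continuous_dist_comp[OF \<omega>]]) auto
  have m: "(\<lambda>\<eta>. complex_of_real (dist_comp \<omega> (cis \<eta>))) \<in> borel_measurable (lebesgue_on {0..2*pi})"
    by (intro continuous_imp_measurable_on_sets_lebesgue continuous_on_subset[OF c]) auto
  have b: "\<bar>dist_comp \<omega> (cis \<eta>)\<bar> \<le> \<omega> 1" for \<eta>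
  proof -
    have "disk_dist (\<phi> (cis \<eta>)) \<le> 1" "0 \<le> disk_dist (\<phi> (cis \<eta>))"
      using norm_le_1[of "cis \<eta>"] by (auto simp: disk_dist_def)
    then have "dist_comp \<omega> (cis \<eta>) \<le> \<omega> 1" unfolding dist_comp_def by (intro majorantD(3)[OF \<omega>])
    then show ?thesis using dist_comp_nonneg[OF \<omega>, of "cis \<eta>"] by simp
  qed
  have "circle_Lp p (\<lambda>\<eta>. \<bar>dist_comp \<omega> (cis \<eta>)\<bar>) \<le> ennreal (\<omega> 1 * (2 * pi) powr (1 / p))"
    using b by (intro circle_Lp_bounded[OF p]) auto
  then have "circle_Lp p (\<lambda>\<eta>. \<bar>dist_comp \<omega> (cis \<eta>)\<bar>) < \<infinity>"
    by (rule order_le_less_trans) simp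
  then show ?thesis using m by (simp add: Lp_circle_def)
qed

text \<open>Integrate the tangent of \<open>\<omega>\<close> at \<open>s = 1 - |\<phi> z|\<close> against the Poisson kernel. The linear term is not
  positive, since \<open>\<omega>' s \<ge> 0\<close> and \<open>|\<phi> z|\<close> is at most the Poisson integral of \<open>|\<phi>|\<close>.\<close>
lemma poisson_dist_comp_le:
  assumes S: "\<omega> \<in> class_S" and z: "z \<in> unit_disk"
  shows "poisson (dist_comp \<omega>) z \<le> dist_comp \<omega> z"
proof -
  have maj: "majorant \<omega>" using S by (simp add: class_S_def)
  obtain \<omega>' K where \<omega>'0: "\<And>s. s \<in> {0<..1} \<Longrightarrow> 0 \<le> \<omega>' s"
    and tangent: "\<And>s t. s \<in> {0<..1} \<Longrightarrow> t \<in> {0..1} \<Longrightarrow> \<omega> t \<le> \<omega> s + \<omega>' s * (t - s)"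
    using class_S_tangent[OF S] by metis
  define s where "s = disk_dist (\<phi> z)"
  have s: "s \<in> {0<..1}" using disk_dist_pos[OF z] by (auto simp: s_def disk_dist_def)
  have nz: "norm z < 1" using z by simp
  have pk: "0 \<le> poisson_kernel z t" for t using poisson_kernel_pos[OF nz, of t] by simp
  have pkc: "continuous_on {0..2*pi} (poisson_kernel z)"
    using continuous_on_poisson_kernel[of "{0..2*pi}" "\<lambda>_. z" "\<lambda>t. t"] nz by simp
  have uc: "continuous_on UNIV (\<lambda>t. dist_comp \<omega> (cis t))"
    by (intro continuous_on_compose2[OF continuous_dist_comp[OF maj]]) (auto intro!: continuous_intros)
  have \<phi>c: "continuous_on {0..2*pi} (\<lambda>t. \<phi> (cis t))"
    by (intro continuous_on_compose2[OF cont]) (auto intro!: continuous_intros)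
  have nint: "(\<lambda>t. norm (\<phi> (cis t)) * poisson_kernel z t) integrable_on {0..2*pi}"
    by (intro integrable_continuous_real continuous_intros \<phi>c pkc)
  have pf: "((\<lambda>t. \<phi> (cis t) * of_real (poisson_kernel z t)) has_integral 2 * of_real pi * \<phi> z) {0..2*pi}"
    by (rule poisson_formula[OF cont hol nz])
  have "norm (2 * of_real pi * \<phi> z) \<le> integral {0..2*pi} (\<lambda>t. norm (\<phi> (cis t)) * poisson_kernel z t)"
    unfolding integral_unique[OF pf, symmetric]
    by (rule integral_norm_bound_integral[OF has_integral_integrable[OF pf] nint]) (simp add: norm_mult pk)
  then have mean: "2 * pi * norm (\<phi> z) \<le> integral {0..2*pi} (\<lambda>t. norm (\<phi> (cis t)) * poisson_kernel z t)"
    by (simp add: norm_mult)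
  define a where "a = \<omega> s + \<omega>' s * (1 - s)"
  have I: "((\<lambda>t. a * poisson_kernel z t - \<omega>' s * (norm (\<phi> (cis t)) * poisson_kernel z t)) has_integral
      a * (2 * pi) - \<omega>' s * integral {0..2*pi} (\<lambda>t. norm (\<phi> (cis t)) * poisson_kernel z t)) {0..2*pi}"
    by (intro has_integral_diff has_integral_mult_right integral_poisson_kernel nz integrable_integral nint)
  have "integral {0..2*pi} (\<lambda>t. dist_comp \<omega> (cis t) * poisson_kernel z t)
     \<le> integral {0..2*pi} (\<lambda>t. a * poisson_kernel z t - \<omega>' s * (norm (\<phi> (cis t)) * poisson_kernel z t))"
  proof (rule integral_le)
    show "(\<lambda>t. dist_comp \<omega> (cis t) * poisson_kernel z t) integrable_on {0..2*pi}"
      by (intro integrable_continuous_real continuous_on_mult pkc continuous_on_subset[OF uc]) simp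
    show "(\<lambda>t. a * poisson_kernel z t - \<omega>' s * (norm (\<phi> (cis t)) * poisson_kernel z t)) integrable_on {0..2*pi}"
      using I by (rule has_integral_integrable)
    fix t
    have "disk_dist (\<phi> (cis t)) \<in> {0..1}" using norm_le_1[of "cis t"] by (simp add: disk_dist_def)
    from tangent[OF s this] have "dist_comp \<omega> (cis t) \<le> a - \<omega>' s * norm (\<phi> (cis t))"
      by (simp add: dist_comp_def a_def disk_dist_def algebra_simps)
    from mult_right_mono[OF this pk[of t]]
    show "dist_comp \<omega> (cis t) * poisson_kernel z t \<le> a * poisson_kernel z t - \<omega>' s * (norm (\<phi> (cis t)) * poisson_kernel z t)"
      by (simp add: algebra_simps)
  qed
  also have "\<dots> = a * (2 * pi) - \<omega>' s * integral {0..2*pi} (\<lambda>t. norm (\<phi> (cis t)) * poisson_kernel z t)"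
    using I by (rule integral_unique)
  also have "\<dots> \<le> a * (2 * pi) - \<omega>' s * (2 * pi * norm (\<phi> z))"
    using mult_left_mono[OF mean \<omega>'0[OF s]] by simp
  also have "\<dots> = 2 * pi * \<omega> s" by (simp add: a_def s_def disk_dist_def algebra_simps)
  finally have "integral {0..2*pi} (\<lambda>t. dist_comp \<omega> (cis t) * poisson_kernel z t) \<le> 2 * pi * \<omega> s" .
  moreover have "2 * pi * poisson (dist_comp \<omega>) z = integral {0..2*pi} (\<lambda>t. dist_comp \<omega> (cis t) * poisson_kernel z t)"
    using poisson_eq_integral[OF uc nz] by simp
  ultimately have "2 * pi * poisson (dist_comp \<omega>) z \<le> 2 * pi * \<omega> s" by (simp only:)
  then show ?thesis by (simp add: dist_comp_def s_def)
qed

text \<open>Multiply \<open>\<phi>\<close> by a unimodular constant so that its value at the point in question is \<open>|\<phi>|\<close>. Its real part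
  is then at most \<open>|\<phi>|\<close>, with equality at that point. By the tangent inequality its positive increments, multiplied by
  \<open>\<omega>' s\<close>, are at most the decrements of \<open>\<omega> (1 - |\<phi>|)\<close>. The rotation by \<open>cis \<theta>\<close> is applied to the function rather
  than to the circle, so that means over \<open>\<theta>\<close> can be taken.\<close>
lemma pullback_slope_le_oscillation:
  assumes tangent: "\<And>s t. s \<in> {0<..1} \<Longrightarrow> t \<in> {0..1} \<Longrightarrow> \<omega> t \<le> \<omega> s + \<omega>' s * (t - s)"
    and \<omega>'0: "\<And>s. s \<in> {0<..1} \<Longrightarrow> 0 \<le> \<omega>' s"
    and K: "0 < K" "\<And>s. s \<in> {0<..1} \<Longrightarrow> \<omega> s \<le> K * (s * \<omega>' s)"
    and maj: "majorant \<omega>" and z: "z \<in> unit_disk" and \<rho>: "\<rho> = disk_dist z / 2"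
  shows "pullback_slope \<omega> \<phi> (z * cis \<theta>) \<le> 2 * K / (pi * \<rho>) *
    integral {0..2*pi} (\<lambda>t. max 0 (dist_comp \<omega> (cis \<theta> * z) - dist_comp \<omega> (cis \<theta> * (z + of_real \<rho> * cis t))))"
proof -
  note half = half_radius_disk[OF z, folded \<rho>]
  have rot: "cis \<theta> * w \<in> unit_disk" if "w \<in> unit_disk" for w using that by (simp add: norm_mult)
  define c where "c = (if \<phi> (cis \<theta> * z) = 0 then 1 else cnj (sgn (\<phi> (cis \<theta> * z))))"
  have c: "norm c = 1" "c * \<phi> (cis \<theta> * z) = of_real (norm (\<phi> (cis \<theta> * z)))"
  proof -
    show "norm c = 1" by (auto simp: c_def norm_sgn)
    show "c * \<phi> (cis \<theta> * z) = of_real (norm (\<phi> (cis \<theta> * z)))"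
    proof (cases "\<phi> (cis \<theta> * z) = 0")
      case False
      have "cnj w * w = of_real (norm w * norm w)" for w
        using complex_norm_square[of w] by (simp add: power2_eq_square mult.commute)
      then show ?thesis using False by (simp add: c_def sgn_eq field_simps)
    qed simp
  qed
  define s where "s = disk_dist (\<phi> (cis \<theta> * z))"
  have s: "s \<in> {0<..1}" using disk_dist_pos[OF rot[OF z]] by (auto simp: s_def disk_dist_def)
  define f where "f w = c * \<phi> (cis \<theta> * w)" for w
  have f: "f holomorphic_on unit_disk" unfolding f_def
    by (intro holomorphic_intros rotated_holomorphic(1)[OF hol])
  have nd: "norm (deriv f z) = norm (deriv \<phi> (z * cis \<theta>))"
  proof -
    have "deriv f z = c * deriv (\<lambda>w. \<phi> (cis \<theta> * w)) z"
      unfolding f_def using holomorphic_on_imp_differentiable_at[OF rotated_holomorphic(1)[OF hol] open_ball z]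
      by (rule deriv_cmult)
    then show ?thesis using c(1) rotated_holomorphic(2)[OF hol z] by (simp add: norm_mult)
  qed
  have cf: "continuous_on (cball z \<rho>) f" "f holomorphic_on ball z \<rho>"
    using half(1) ball_subset_cball[of z \<rho>]
    by (auto intro!: holomorphic_on_imp_continuous_on holomorphic_on_subset[OF f] simp del: mem_ball_0)
  define U where "U t = max 0 (dist_comp \<omega> (cis \<theta> * z) - dist_comp \<omega> (cis \<theta> * (z + of_real \<rho> * cis t)))" for t
  have cpath: "continuous_on {0..2*pi} (\<lambda>t. f (z + of_real \<rho> * cis t))"
    using half(3) by (intro continuous_on_compose2[OF holomorphic_on_imp_continuous_on[OF f]])
      (auto intro!: continuous_intros simp del: mem_ball_0)
  have cU: "continuous_on {0..2*pi} U"
  proof -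
    have "cis \<theta> * (z + of_real \<rho> * cis t) \<in> closed_unit_disk" for t
      using rot[OF half(3), of t] by simp
    then show ?thesis unfolding U_def
      by (intro continuous_intros continuous_on_compose2[OF continuous_dist_comp[OF maj]]) auto
  qed
  have "\<omega>' s * norm (deriv \<phi> (z * cis \<theta>)) \<le> \<omega>' s * (2 / (pi * \<rho>) *
      integral {0..2*pi} (\<lambda>t. max 0 (Re (f (z + of_real \<rho> * cis t)) - Re (f z))))"
    unfolding nd[symmetric] by (intro mult_left_mono norm_deriv_le_Re_pos_mean cf half(2) \<omega>'0 s)
  also have "\<dots> = 2 / (pi * \<rho>) * integral {0..2*pi} (\<lambda>t. \<omega>' s * max 0 (Re (f (z + of_real \<rho> * cis t)) - Re (f z)))"
    by simp
  also have "\<dots> \<le> 2 / (pi * \<rho>) * integral {0..2*pi} U"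
  proof (intro mult_left_mono integral_le)
    show "(\<lambda>t. \<omega>' s * max 0 (Re (f (z + of_real \<rho> * cis t)) - Re (f z))) integrable_on {0..2*pi}"
      by (intro integrable_continuous_real continuous_intros cpath)
    show "U integrable_on {0..2*pi}" by (intro integrable_continuous_real cU)
    fix t
    define b where "b = cis \<theta> * (z + of_real \<rho> * cis t)"
    have "b \<in> unit_disk" unfolding b_def by (rule rot[OF half(3)])
    then have "disk_dist (\<phi> b) \<in> {0..1}" using disk_dist_pos[of b] by (auto simp: disk_dist_def)
    from tangent[OF s this] have "\<omega>' s * (s - disk_dist (\<phi> b)) \<le> dist_comp \<omega> (cis \<theta> * z) - dist_comp \<omega> b"
      by (simp add: dist_comp_def s_def algebra_simps)
    moreover have "Re (f (z + of_real \<rho> * cis t)) - Re (f z) \<le> s - disk_dist (\<phi> b)"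
    proof -
      have "Re (f (z + of_real \<rho> * cis t)) \<le> norm (\<phi> b)"
        using complex_Re_le_cmod[of "c * \<phi> b"] c(1) by (simp add: f_def b_def norm_mult)
      moreover have "Re (f z) = norm (\<phi> (cis \<theta> * z))" using c(2) by (simp add: f_def)
      ultimately show ?thesis by (simp add: s_def disk_dist_def)
    qed
    ultimately have "\<omega>' s * (Re (f (z + of_real \<rho> * cis t)) - Re (f z)) \<le> dist_comp \<omega> (cis \<theta> * z) - dist_comp \<omega> b"
      using mult_left_mono[OF _ \<omega>'0[OF s]] order_trans by blast
    then show "\<omega>' s * max 0 (Re (f (z + of_real \<rho> * cis t)) - Re (f z)) \<le> U t"
      unfolding U_def b_def by (auto simp: max_def)
  qed (use half(2) in auto)
  finally have main: "\<omega>' s * norm (deriv \<phi> (z * cis \<theta>)) \<le> 2 / (pi * \<rho>) * integral {0..2*pi} U" .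
  have "\<omega> s / s \<le> K * \<omega>' s" using K(2)[OF s] s by (simp add: divide_le_eq mult_ac)
  then have "norm (deriv \<phi> (z * cis \<theta>)) * (\<omega> s / s) \<le> norm (deriv \<phi> (z * cis \<theta>)) * (K * \<omega>' s)"
    by (intro mult_left_mono) auto
  also have "\<dots> = K * (\<omega>' s * norm (deriv \<phi> (z * cis \<theta>)))" by (simp only: mult_ac)
  also have "\<dots> \<le> K * (2 / (pi * \<rho>) * integral {0..2*pi} U)" using K(1) by (intro mult_left_mono main) simp
  also have "\<dots> = 2 * K / (pi * \<rho>) * integral {0..2*pi} U" by simp
  finally show ?thesis by (simp add: pullback_slope_def s_def U_def[abs_def] mult.commute[of z])
qed

end

section \<open>The Poisson defect\<close>

context closed_disk_self_map
begin

text \<open>The decrements of \<open>u\<close> over a circle of radius \<open>d z / 2\<close> are at most \<open>D = |P u z - P u \<zeta>| + (u z - P u z)\<close>.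
  The first term is estimated through the boundary: both \<open>z\<close> and \<open>\<zeta>\<close> are within \<open>3 d / 2\<close> of the circle, so \<open>P u\<close> is
  compared with \<open>u\<close> at their radial projections, whose distance is at most \<open>3 d\<close>. The second term is
  the hypothesis, which says nothing about \<open>r = 0\<close>; the origin is reached by Fatou's lemma.\<close>
lemma poisson_defect_imp_slope_bound:
  assumes p: "1 \<le> p" and S: "\<omega>\<^sub>1 \<in> class_S" and \<omega>\<^sub>2: "slow_majorant \<omega>\<^sub>2"
    and M: "0 \<le> M" "\<And>\<xi>\<^sub>1 \<xi>\<^sub>2. \<xi>\<^sub>1 \<in> unit_circle \<Longrightarrow> \<xi>\<^sub>2 \<in> unit_circle \<Longrightarrow>
      circle_Lp p (\<lambda>\<theta>. \<bar>dist_comp \<omega>\<^sub>1 (cis \<theta> * \<xi>\<^sub>1) - dist_comp \<omega>\<^sub>1 (cis \<theta> * \<xi>\<^sub>2)\<bar>) \<le> ennreal (M * \<omega>\<^sub>2 (dist \<xi>\<^sub>1 \<xi>\<^sub>2))"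
    and M': "0 \<le> M'" "\<And>r. 0 < r \<Longrightarrow> r < 1 \<Longrightarrow>
      circle_Lp p (\<lambda>\<theta>. dist_comp \<omega>\<^sub>1 (of_real r * cis \<theta>) - poisson (dist_comp \<omega>\<^sub>1) (of_real r * cis \<theta>)) \<le> ennreal (M' * \<omega>\<^sub>2 (1 - r))"
  obtains C where "0 \<le> C" "\<And>z. z \<in> unit_disk \<Longrightarrow>
      circle_Lp p (\<lambda>\<theta>. pullback_slope \<omega>\<^sub>1 \<phi> (z * cis \<theta>)) \<le> ennreal (C * (\<omega>\<^sub>2 (disk_dist z) / disk_dist z))"
proof -
  have maj1: "majorant \<omega>\<^sub>1" using S by (simp add: class_S_def)
  have maj2: "majorant \<omega>\<^sub>2" using \<omega>\<^sub>2 by (simp add: slow_majorant_def)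
  note m2 = majorantD[OF maj2]
  obtain \<omega>' K where K: "0 < K" and \<omega>'0: "\<And>s. s \<in> {0<..1} \<Longrightarrow> 0 \<le> \<omega>' s"
    and K': "\<And>s. s \<in> {0<..1} \<Longrightarrow> \<omega>\<^sub>1 s \<le> K * (s * \<omega>' s)"
    and tangent: "\<And>s t. s \<in> {0<..1} \<Longrightarrow> t \<in> {0..1} \<Longrightarrow> \<omega>\<^sub>1 t \<le> \<omega>\<^sub>1 s + \<omega>' s * (t - s)"
    using class_S_tangent[OF S] by metis
  define u where "u = dist_comp \<omega>\<^sub>1"
  define P where "P = poisson u"
  have cu: "continuous_on closed_unit_disk u" unfolding u_def by (rule continuous_dist_comp[OF maj1])
  have cu_circle: "continuous_on unit_circle u" using cu by (rule continuous_on_subset) auto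
  have cP: "continuous_on unit_disk P"
    unfolding P_def by (intro continuous_on_poisson continuous_on_compose2[OF cu]) (auto intro!: continuous_intros)
  have P_le: "P w \<le> u w" if "w \<in> unit_disk" for w
    unfolding P_def u_def by (rule poisson_dist_comp_le[OF S that])
  have osc_u: "circle_Lp p (\<lambda>\<theta>. \<bar>u (cis \<theta> * \<xi>\<^sub>1) - u (cis \<theta> * \<xi>\<^sub>2)\<bar>) \<le> ennreal (M * \<omega>\<^sub>2 (dist \<xi>\<^sub>1 \<xi>\<^sub>2))"
    if "\<xi>\<^sub>1 \<in> unit_circle" "\<xi>\<^sub>2 \<in> unit_circle" for \<xi>\<^sub>1 \<xi>\<^sub>2
    unfolding u_def by (rule M(2)[OF that])
  obtain C\<^sub>0 where C\<^sub>0: "0 \<le> C\<^sub>0" and approx: "\<And>r e. 0 \<le> r \<Longrightarrow> r < 1 \<Longrightarrow> e \<in> unit_circle \<Longrightarrow>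
      circle_Lp p (\<lambda>\<theta>. \<bar>P (cis \<theta> * (of_real r * e)) - u (cis \<theta> * e)\<bar>) \<le> ennreal (C\<^sub>0 * \<omega>\<^sub>2 (1 - r))"
  proof (rule poisson_Lp_approximation[OF p \<omega>\<^sub>2 cu_circle M(1) osc_u])
    fix C assume "0 \<le> C" "\<And>r e. 0 \<le> r \<Longrightarrow> r < 1 \<Longrightarrow> e \<in> unit_circle \<Longrightarrow>
      circle_Lp p (\<lambda>\<theta>. \<bar>poisson u (cis \<theta> * (of_real r * e)) - u (cis \<theta> * e)\<bar>) \<le> ennreal (C * \<omega>\<^sub>2 (1 - r))"
    then show thesis by (rule that[unfolded P_def])
  qed
  define dir where "dir w = (if w = 0 then 1 else sgn w)" for w :: complex
  have dir: "dir w \<in> unit_circle" "of_real (norm w) * dir w = w" for w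
  proof -
    show "dir w \<in> unit_circle" by (simp add: dir_def norm_sgn)
    show "of_real (norm w) * dir w = w" by (simp add: dir_def sgn_eq)
  qed
  have dist_dir: "dist (dir w) w = 1 - norm w" if "w \<in> unit_disk" for w
  proof -
    have "dir w - w = of_real (1 - norm w) * dir w" using dir(2)[of w] by (simp add: left_diff_distrib)
    then have "norm (dir w - w) = \<bar>1 - norm w\<bar> * norm (dir w)" by (simp only: norm_mult norm_of_real)
    then show ?thesis using dir(1)[of w] that by (simp add: dist_norm)
  qed
  have rot: "cis \<theta> * w \<in> unit_disk" if "w \<in> unit_disk" for \<theta> w using that by (simp add: norm_mult)
  have rotc: "cis \<theta> * w \<in> closed_unit_disk" if "w \<in> unit_disk \<or> w \<in> unit_circle" for \<theta> w
    using that by (auto simp: norm_mult)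
  have dir_closed: "dir w \<in> closed_unit_disk" for w using dir(1)[of w] by simp
  have cu_rot: "continuous_on UNIV (\<lambda>\<theta>. u (cis \<theta> * w))" if "w \<in> closed_unit_disk" for w
    using that by (intro continuous_on_compose2[OF cu] continuous_intros) (auto simp: norm_mult)
  have cP_rot: "continuous_on UNIV (\<lambda>\<theta>. P (cis \<theta> * w))" if "w \<in> unit_disk" for w
    using that by (intro continuous_on_compose2[OF cP] continuous_intros) (auto simp: norm_mult)
  define C\<^sub>1 where "C\<^sub>1 = C\<^sub>0 + M * 3 + C\<^sub>0 * 3 + M'"
  have C\<^sub>1: "0 \<le> C\<^sub>1" using C\<^sub>0 M(1) M'(1) by (simp add: C\<^sub>1_def)
  have punctured: "circle_Lp p (\<lambda>\<theta>. pullback_slope \<omega>\<^sub>1 \<phi> (z * cis \<theta>)) \<le> ennreal (8 * K * C\<^sub>1 * (\<omega>\<^sub>2 (disk_dist z) / disk_dist z))"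
    if z: "z \<in> unit_disk" and z0: "z \<noteq> 0" for z
  proof -
    define d where "d = disk_dist z"
    define \<rho> where "\<rho> = disk_dist z / 2"
    note half = half_radius_disk[OF z, folded \<rho>_def]
    have d: "0 < d" "d = 1 - norm z" using z by (auto simp: d_def disk_dist_def)
    have \<omega>0: "0 \<le> \<omega>\<^sub>2 d" using m2(1) d by simp
    have \<omega>3: "\<omega>\<^sub>2 x \<le> 3 * \<omega>\<^sub>2 d" if "0 \<le> x" "x \<le> 3 * d" for x
      using m2(3)[OF that] majorant_scale[OF maj2, of 3 d] d by linarith
    define D where "D t \<theta> = \<bar>P (cis \<theta> * z) - P (cis \<theta> * (z + of_real \<rho> * cis t))\<bar> + (u (cis \<theta> * z) - P (cis \<theta> * z))" for t \<theta>
    have D0: "0 \<le> D t \<theta>" for t \<theta> unfolding D_def using P_le[OF rot[OF z]] by simp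
    have cD: "continuous_on ({0..2*pi} \<times> UNIV) (\<lambda>(t, \<theta>). D t \<theta>)"
      unfolding D_def split_beta' using rot[OF half(3)] rot[OF z] rotc z
      by (intro continuous_intros continuous_on_compose2[OF cP] continuous_on_compose2[OF cu]) (auto simp del: mem_ball_0 mem_cball_0)
    have D_Lp: "circle_Lp p (D t) \<le> ennreal (C\<^sub>1 * \<omega>\<^sub>2 d)" for t
    proof -
      define \<zeta> where "\<zeta> = z + of_real \<rho> * cis t"
      have \<zeta>: "\<zeta> \<in> unit_disk" "dist \<zeta> z = \<rho>" unfolding \<zeta>_def by (rule half)+
      have d\<zeta>: "0 \<le> 1 - norm \<zeta>" "1 - norm \<zeta> \<le> d + \<rho>"
      proof -
        show "0 \<le> 1 - norm \<zeta>" using \<zeta>(1) by simp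
        have "norm z \<le> norm \<zeta> + norm (z - \<zeta>)" by (metis add.commute norm_triangle_sub)
        then show "1 - norm \<zeta> \<le> d + \<rho>" using \<zeta>(2) d(2) by (simp add: dist_norm norm_minus_commute)
      qed
      have \<rho>d: "\<rho> = d / 2" by (simp add: \<rho>_def d_def)
      define g1 where "g1 \<theta> = \<bar>P (cis \<theta> * (of_real (norm z) * dir z)) - u (cis \<theta> * dir z)\<bar>" for \<theta>
      define g2 where "g2 \<theta> = \<bar>u (cis \<theta> * dir z) - u (cis \<theta> * dir \<zeta>)\<bar>" for \<theta>
      define g3 where "g3 \<theta> = \<bar>P (cis \<theta> * (of_real (norm \<zeta>) * dir \<zeta>)) - u (cis \<theta> * dir \<zeta>)\<bar>" for \<theta>
      define g4 where "g4 \<theta> = u (cis \<theta> * z) - P (cis \<theta> * z)" for \<theta>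
      have 1: "circle_Lp p g1 \<le> ennreal (C\<^sub>0 * \<omega>\<^sub>2 d)"
        using approx[of "norm z" "dir z"] z dir(1) d by (simp add: g1_def[abs_def])
      have 2: "circle_Lp p g2 \<le> ennreal (M * 3 * \<omega>\<^sub>2 d)"
      proof -
        have "circle_Lp p g2 \<le> ennreal (M * \<omega>\<^sub>2 (dist (dir z) (dir \<zeta>)))"
          using M(2)[OF dir(1) dir(1), of z \<zeta>] by (simp add: g2_def[abs_def] u_def)
        also have "\<dots> \<le> ennreal (M * (3 * \<omega>\<^sub>2 d))"
        proof (intro ennreal_leI mult_left_mono \<omega>3 M(1))
          have "dist (dir z) (dir \<zeta>) \<le> dist (dir z) z + dist z \<zeta> + dist \<zeta> (dir \<zeta>)"
            using dist_triangle[of "dir z" "dir \<zeta>" z] dist_triangle[of z "dir \<zeta>" \<zeta>] by linarith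
          also have "\<dots> = d + \<rho> + (1 - norm \<zeta>)"
            using dist_dir[OF z] dist_dir[OF \<zeta>(1)] \<zeta>(2) d by (simp add: dist_commute)
          also have "\<dots> \<le> 3 * d" using d\<zeta>(2) \<rho>d by linarith
          finally show "dist (dir z) (dir \<zeta>) \<le> 3 * d" .
        qed simp
        finally show ?thesis by (simp only: mult.assoc)
      qed
      have 3: "circle_Lp p g3 \<le> ennreal (C\<^sub>0 * 3 * \<omega>\<^sub>2 d)"
      proof -
        have "circle_Lp p g3 \<le> ennreal (C\<^sub>0 * \<omega>\<^sub>2 (1 - norm \<zeta>))"
          using approx[of "norm \<zeta>" "dir \<zeta>"] \<zeta>(1) dir(1) by (simp add: g3_def[abs_def])
        also have "\<dots> \<le> ennreal (C\<^sub>0 * (3 * \<omega>\<^sub>2 d))"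
          using d\<zeta> \<rho>d d(1) by (intro ennreal_leI mult_left_mono \<omega>3 C\<^sub>0) auto
        finally show ?thesis by (simp only: mult.assoc)
      qed
      have 4: "circle_Lp p g4 \<le> ennreal (M' * \<omega>\<^sub>2 d)"
      proof -
        define G where "G \<xi> = u (of_real (norm z) * \<xi>) - P (of_real (norm z) * \<xi>)" for \<xi>
        have in_disk: "of_real (norm z) * cis \<theta> \<in> unit_disk" for \<theta> using z by (simp add: norm_mult)
        note in_closed = subsetD[OF ball_subset_cball in_disk]
        have "circle_Lp p (\<lambda>\<theta>. G (cis \<theta>)) \<le> ennreal (M' * \<omega>\<^sub>2 d)"
          using M'(2)[of "norm z"] z z0 d by (simp add: G_def u_def P_def)
        moreover have "continuous_on UNIV (\<lambda>\<theta>. G (cis \<theta>))"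
          unfolding G_def using in_disk in_closed
          by (intro continuous_intros continuous_on_compose2[OF cP] continuous_on_compose2[OF cu])
            (auto simp del: mem_ball_0 mem_cball_0)
        ultimately have "circle_Lp p (\<lambda>\<theta>. G (cis (\<theta> + Arg z))) \<le> ennreal (M' * \<omega>\<^sub>2 d)"
          using M'(1) \<omega>0 by (intro circle_Lp_rotate[OF _ p] borel_measurable_continuous_onI) auto
        moreover have "G (cis (\<theta> + Arg z)) = g4 \<theta>" for \<theta>
        proof -
          have "of_real (norm z) * cis (Arg z) = z" using rcis_cmod_Arg[of z] by (simp add: rcis_def)
          then have "of_real (norm z) * cis (\<theta> + Arg z) = cis \<theta> * z" by (simp add: mult_ac flip: cis_mult)
          then show ?thesis by (simp add: G_def g4_def)
        qed
        ultimately show ?thesis by simp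
      qed
      have nn: "0 \<le> g1 \<theta>" "0 \<le> g2 \<theta>" "0 \<le> g3 \<theta>" "0 \<le> g4 \<theta>" for \<theta>
        using P_le[OF rot[OF z]] by (auto simp: g1_def g2_def g3_def g4_def)
      have c: "continuous_on UNIV g1" "continuous_on UNIV g2" "continuous_on UNIV g3" "continuous_on UNIV g4"
        unfolding g1_def[abs_def] g2_def[abs_def] g3_def[abs_def] g4_def[abs_def] dir(2)
        by (intro continuous_on_diff continuous_on_rabs cu_rot cP_rot dir_closed z \<zeta>(1)
            subsetD[OF ball_subset_cball z])+
      note ms = c[THEN borel_measurable_continuous_onI]
      have "circle_Lp p (\<lambda>\<theta>. g1 \<theta> + g2 \<theta>) \<le> ennreal (C\<^sub>0 * \<omega>\<^sub>2 d + M * 3 * \<omega>\<^sub>2 d)"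
        using C\<^sub>0 M(1) \<omega>0 by (intro circle_Lp_triangle[OF p _ _ ms(1) ms(2) nn(1) nn(2) 1 2]) auto
      then have "circle_Lp p (\<lambda>\<theta>. (g1 \<theta> + g2 \<theta>) + g3 \<theta>) \<le> ennreal ((C\<^sub>0 * \<omega>\<^sub>2 d + M * 3 * \<omega>\<^sub>2 d) + C\<^sub>0 * 3 * \<omega>\<^sub>2 d)"
        using C\<^sub>0 M(1) \<omega>0 ms nn by (intro circle_Lp_triangle[OF p _ _ _ ms(3) _ nn(3) _ 3]) auto
      then have "circle_Lp p (\<lambda>\<theta>. ((g1 \<theta> + g2 \<theta>) + g3 \<theta>) + g4 \<theta>) \<le> ennreal (((C\<^sub>0 * \<omega>\<^sub>2 d + M * 3 * \<omega>\<^sub>2 d) + C\<^sub>0 * 3 * \<omega>\<^sub>2 d) + M' * \<omega>\<^sub>2 d)"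
        using C\<^sub>0 M(1) M'(1) \<omega>0 ms nn by (intro circle_Lp_triangle[OF p _ _ _ ms(4) _ nn(4) _ 4]) auto
      also have "((C\<^sub>0 * \<omega>\<^sub>2 d + M * 3 * \<omega>\<^sub>2 d) + C\<^sub>0 * 3 * \<omega>\<^sub>2 d) + M' * \<omega>\<^sub>2 d = C\<^sub>1 * \<omega>\<^sub>2 d"
        by (simp add: C\<^sub>1_def distrib_right)
      finally show ?thesis
      proof (rule circle_Lp_mono[OF p, rotated])
        show "D t \<theta> \<le> g1 \<theta> + g2 \<theta> + g3 \<theta> + g4 \<theta>" for \<theta>
          unfolding D_def g1_def g2_def g3_def g4_def dir(2) \<zeta>_def[symmetric] by linarith
      qed (use D0 C\<^sub>1 \<omega>0 in auto)
    qed
    have "circle_Lp p (\<lambda>\<theta>. integral {0..2*pi} (\<lambda>t. D t \<theta>)) \<le> ennreal (2 * pi * (C\<^sub>1 * \<omega>\<^sub>2 d))"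
    proof (rule circle_Lp_integral_le[OF p cD D0])
      show "(\<integral>\<^sup>+ t\<in>{0<..<2*pi}. ennreal (C\<^sub>1 * \<omega>\<^sub>2 d) \<partial>lborel) \<le> ennreal (2 * pi * (C\<^sub>1 * \<omega>\<^sub>2 d))"
        using C\<^sub>1 \<omega>0 by (simp add: nn_integral_cmult ennreal_mult'[symmetric] mult.commute)
    qed (use D_Lp C\<^sub>1 \<omega>0 in auto)
    then have "circle_Lp p (\<lambda>\<theta>. 2 * K / (pi * \<rho>) * integral {0..2*pi} (\<lambda>t. D t \<theta>))
        \<le> ennreal (2 * K / (pi * \<rho>) * (2 * pi * (C\<^sub>1 * \<omega>\<^sub>2 d)))"
      using half(2) C\<^sub>1 \<omega>0 K
      by (intro circle_Lp_cmult[OF p] integral_slice_nonneg[OF cD D0]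
          borel_measurable_continuous_onI[OF continuous_on_integral_param[OF cD]]) auto
    also have "2 * K / (pi * \<rho>) * (2 * pi * (C\<^sub>1 * \<omega>\<^sub>2 d)) = 8 * K * C\<^sub>1 * (\<omega>\<^sub>2 (disk_dist z) / disk_dist z)"
      by (simp add: \<rho>_def d_def)
    finally show ?thesis
    proof (rule circle_Lp_mono[OF p, rotated])
      fix \<theta>
      show "0 \<le> pullback_slope \<omega>\<^sub>1 \<phi> (z * cis \<theta>)"
        using rot[OF z, of \<theta>] by (intro pullback_slope_nonneg[OF maj1]) (simp add: mult.commute)
      have "pullback_slope \<omega>\<^sub>1 \<phi> (z * cis \<theta>) \<le> 2 * K / (pi * \<rho>) *
          integral {0..2*pi} (\<lambda>t. max 0 (u (cis \<theta> * z) - u (cis \<theta> * (z + of_real \<rho> * cis t))))"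
        unfolding u_def by (rule pullback_slope_le_oscillation[OF tangent \<omega>'0 K K' maj1 z \<rho>_def])
      also have "\<dots> \<le> 2 * K / (pi * \<rho>) * integral {0..2*pi} (\<lambda>t. D t \<theta>)"
      proof (intro mult_left_mono integral_le)
        show "(\<lambda>t. max 0 (u (cis \<theta> * z) - u (cis \<theta> * (z + of_real \<rho> * cis t)))) integrable_on {0..2*pi}"
          using rotc half(3)
          by (intro integrable_continuous_real continuous_intros continuous_on_compose2[OF cu]) (auto simp del: mem_ball_0 mem_cball_0)
        show "(\<lambda>t. D t \<theta>) integrable_on {0..2*pi}"
          by (intro integrable_continuous_real continuous_on_slice[OF cD])
        show "max 0 (u (cis \<theta> * z) - u (cis \<theta> * (z + of_real \<rho> * cis t))) \<le> D t \<theta>" for t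
          using P_le[OF rot[OF z, of \<theta>]] P_le[OF rot[OF half(3), of \<theta> t]] unfolding D_def by linarith
      qed (use K half(2) in auto)
      finally show "pullback_slope \<omega>\<^sub>1 \<phi> (z * cis \<theta>) \<le> 2 * K / (pi * \<rho>) * integral {0..2*pi} (\<lambda>t. D t \<theta>)" .
    next
      show "0 \<le> 8 * K * C\<^sub>1 * (\<omega>\<^sub>2 (disk_dist z) / disk_dist z)"
        using K C\<^sub>1 \<omega>0 d(1) unfolding d_def by (intro mult_nonneg_nonneg divide_nonneg_nonneg) auto
    qed
  qed
  have origin: "circle_Lp p (\<lambda>\<theta>. pullback_slope \<omega>\<^sub>1 \<phi> (0 * cis \<theta>)) \<le> ennreal (8 * K * C\<^sub>1 * (\<omega>\<^sub>2 1 / 1))"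
  proof -
    define r where "r n = 1 / real (n + 2)" for n
    have r: "0 < r n" "r n < 1" for n by (auto simp: r_def field_simps)
    have rlim: "r \<longlonglongrightarrow> 0" 
      unfolding r_def by (rule LIMSEQ_ignore_initial_segment[OF lim_1_over_n])
    have in_disk: "of_real (r n) * cis \<theta> \<in> unit_disk" for n \<theta> using r[of n] by (simp add: norm_mult)
    define g where "g n \<theta> = pullback_slope \<omega>\<^sub>1 \<phi> (of_real (r n) * cis \<theta>)" for n \<theta>
    note ck = continuous_pullback_slope[OF maj1]
    define Cn where "Cn n = 8 * K * C\<^sub>1 * (\<omega>\<^sub>2 (1 - r n) / (1 - r n))" for n
    show ?thesis
    proof (rule circle_Lp_Fatou[OF p, where g = g and Cn = Cn])
      show "0 \<le> g n \<theta>" for n \<theta> unfolding g_def by (rule pullback_slope_nonneg[OF maj1 in_disk])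
      show "g n \<in> borel_measurable borel" for n
        unfolding g_def using in_disk by (intro borel_measurable_continuous_onI continuous_on_compose2[OF ck] continuous_intros) auto
      show "(\<lambda>n. g n \<theta>) \<longlonglongrightarrow> pullback_slope \<omega>\<^sub>1 \<phi> (0 * cis \<theta>)" for \<theta>
        unfolding g_def
      proof (rule continuous_on_tendsto_compose[OF ck])
        have "(\<lambda>n. of_real (r n) * cis \<theta>) \<longlonglongrightarrow> of_real 0 * cis \<theta>" by (intro tendsto_intros rlim)
        then show "(\<lambda>n. of_real (r n) * cis \<theta>) \<longlonglongrightarrow> 0 * cis \<theta>" by simp
      qed (use in_disk in auto)
      show "0 \<le> Cn n" for n
        unfolding Cn_def using K C\<^sub>1 m2(1) r[of n] by (intro mult_nonneg_nonneg divide_nonneg_nonneg) auto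
      show "circle_Lp p (g n) \<le> ennreal (Cn n)" for n
        using punctured[of "of_real (r n)"] r[of n] by (simp add: g_def[abs_def] Cn_def disk_dist_def)
      have "(\<lambda>n. \<omega>\<^sub>2 (1 - r n) / (1 - r n)) \<longlonglongrightarrow> \<omega>\<^sub>2 1 / 1"
      proof (rule continuous_on_tendsto_compose[where f = "\<lambda>t. \<omega>\<^sub>2 t / t" and s = "{0<..}"])
        show "continuous_on {0<..} (\<lambda>t. \<omega>\<^sub>2 t / t)"
          by (intro continuous_on_majorant_ratio[OF maj2]) (auto intro!: continuous_intros)
        have "(\<lambda>n. 1 - r n) \<longlonglongrightarrow> 1 - 0" by (intro tendsto_intros rlim)
        then show "(\<lambda>n. 1 - r n) \<longlonglongrightarrow> 1" by simp
      qed (use r in auto)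
      then show "Cn \<longlonglongrightarrow> 8 * K * C\<^sub>1 * (\<omega>\<^sub>2 1 / 1)" unfolding Cn_def by (rule tendsto_mult_left)
    qed
  qed
  show thesis
  proof (rule that[of "8 * K * C\<^sub>1"])
    show "0 \<le> 8 * K * C\<^sub>1" using K C\<^sub>1 by simp
    fix z :: complex assume z: "z \<in> unit_disk"
    show "circle_Lp p (\<lambda>\<theta>. pullback_slope \<omega>\<^sub>1 \<phi> (z * cis \<theta>)) \<le> ennreal (8 * K * C\<^sub>1 * (\<omega>\<^sub>2 (disk_dist z) / disk_dist z))"
    proof (cases "z = 0")
      case True
      then show ?thesis using origin by (simp add: disk_dist_def)
    next
      case False
      then show ?thesis by (rule punctured[OF z])
    qed
  qed
qed

text \<open>The defect \<open>u - P u\<close> at \<open>r \<xi>\<close> is at most the positive part of \<open>u (r \<xi>) - u \<xi>\<close> plus the error \<open>|P u (r \<xi>) - u \<xi>|\<close>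
  of the approximation.\<close>
lemma radial_increment_imp_poisson_defect:
  assumes p: "1 \<le> p" and S: "\<omega>\<^sub>1 \<in> class_S" and \<omega>\<^sub>2: "slow_majorant \<omega>\<^sub>2"
    and M: "0 \<le> M" "\<And>\<xi>\<^sub>1 \<xi>\<^sub>2. \<xi>\<^sub>1 \<in> unit_circle \<Longrightarrow> \<xi>\<^sub>2 \<in> unit_circle \<Longrightarrow>
      circle_Lp p (\<lambda>\<theta>. \<bar>dist_comp \<omega>\<^sub>1 (cis \<theta> * \<xi>\<^sub>1) - dist_comp \<omega>\<^sub>1 (cis \<theta> * \<xi>\<^sub>2)\<bar>) \<le> ennreal (M * \<omega>\<^sub>2 (dist \<xi>\<^sub>1 \<xi>\<^sub>2))"
    and M': "0 \<le> M'" "\<And>r. 0 < r \<Longrightarrow> r < 1 \<Longrightarrow>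
      circle_Lp p (\<lambda>\<theta>. max (dist_comp \<omega>\<^sub>1 (of_real r * cis \<theta>) - dist_comp \<omega>\<^sub>1 (cis \<theta>)) 0) \<le> ennreal (M' * \<omega>\<^sub>2 (1 - r))"
  obtains C where "0 < C" "\<And>r. 0 < r \<Longrightarrow> r < 1 \<Longrightarrow>
      circle_Lp p (\<lambda>\<theta>. dist_comp \<omega>\<^sub>1 (of_real r * cis \<theta>) - poisson (dist_comp \<omega>\<^sub>1) (of_real r * cis \<theta>)) \<le> ennreal (C * \<omega>\<^sub>2 (1 - r))"
proof -
  have maj1: "majorant \<omega>\<^sub>1" using S by (simp add: class_S_def)
  have maj2: "majorant \<omega>\<^sub>2" using \<omega>\<^sub>2 by (simp add: slow_majorant_def)
  define u where "u = dist_comp \<omega>\<^sub>1"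
  define P where "P = poisson u"
  have cu: "continuous_on closed_unit_disk u" unfolding u_def by (rule continuous_dist_comp[OF maj1])
  have cu_circle: "continuous_on unit_circle u" using cu by (rule continuous_on_subset) auto
  have cP: "continuous_on unit_disk P"
    unfolding P_def by (intro continuous_on_poisson continuous_on_compose2[OF cu]) (auto intro!: continuous_intros)
  have osc_u: "circle_Lp p (\<lambda>\<theta>. \<bar>u (cis \<theta> * \<xi>\<^sub>1) - u (cis \<theta> * \<xi>\<^sub>2)\<bar>) \<le> ennreal (M * \<omega>\<^sub>2 (dist \<xi>\<^sub>1 \<xi>\<^sub>2))"
    if "\<xi>\<^sub>1 \<in> unit_circle" "\<xi>\<^sub>2 \<in> unit_circle" for \<xi>\<^sub>1 \<xi>\<^sub>2
    unfolding u_def by (rule M(2)[OF that])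
  obtain C\<^sub>0 where C\<^sub>0: "0 \<le> C\<^sub>0" and approx: "\<And>r e. 0 \<le> r \<Longrightarrow> r < 1 \<Longrightarrow> e \<in> unit_circle \<Longrightarrow>
      circle_Lp p (\<lambda>\<theta>. \<bar>P (cis \<theta> * (of_real r * e)) - u (cis \<theta> * e)\<bar>) \<le> ennreal (C\<^sub>0 * \<omega>\<^sub>2 (1 - r))"
  proof (rule poisson_Lp_approximation[OF p \<omega>\<^sub>2 cu_circle M(1) osc_u])
    fix C assume "0 \<le> C" "\<And>r e. 0 \<le> r \<Longrightarrow> r < 1 \<Longrightarrow> e \<in> unit_circle \<Longrightarrow>
      circle_Lp p (\<lambda>\<theta>. \<bar>poisson u (cis \<theta> * (of_real r * e)) - u (cis \<theta> * e)\<bar>) \<le> ennreal (C * \<omega>\<^sub>2 (1 - r))"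
    then show thesis by (rule that[unfolded P_def])
  qed
  show thesis
  proof (rule that[of "M' + C\<^sub>0 + 1"])
    show "0 < M' + C\<^sub>0 + 1" using C\<^sub>0 M'(1) by simp
    fix r :: real assume r: "0 < r" "r < 1"
    have \<omega>0: "0 \<le> \<omega>\<^sub>2 (1 - r)" using majorantD(1)[OF maj2] r by simp
    define g1 where "g1 \<theta> = max (u (of_real r * cis \<theta>) - u (cis \<theta>)) 0" for \<theta>
    define g2 where "g2 \<theta> = \<bar>P (of_real r * cis \<theta>) - u (cis \<theta>)\<bar>" for \<theta>
    have in_disk: "of_real r * cis \<theta> \<in> unit_disk" for \<theta> using r by (simp add: norm_mult)
    have 1: "circle_Lp p g1 \<le> ennreal (M' * \<omega>\<^sub>2 (1 - r))" using M'(2)[OF r] by (simp add: g1_def[abs_def] u_def)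
    have 2: "circle_Lp p g2 \<le> ennreal (C\<^sub>0 * \<omega>\<^sub>2 (1 - r))"
      using approx[of r 1] r by (simp add: g2_def[abs_def] mult.commute)
    have "continuous_on UNIV (\<lambda>\<theta>. u (of_real r * cis \<theta>))"
      using subsetD[OF ball_subset_cball in_disk]
      by (intro continuous_on_compose2[OF cu] continuous_intros) (auto simp del: mem_cball_0)
    moreover have "continuous_on UNIV (\<lambda>\<theta>. u (cis \<theta>))"
      by (intro continuous_on_compose2[OF cu] continuous_intros) auto
    moreover have "continuous_on UNIV (\<lambda>\<theta>. P (of_real r * cis \<theta>))"
      using in_disk by (intro continuous_on_compose2[OF cP] continuous_intros) (auto simp del: mem_ball_0)
    ultimately have c: "continuous_on UNIV g1" "continuous_on UNIV g2"
      unfolding g1_def[abs_def] g2_def[abs_def]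
      by (auto intro!: continuous_on_max continuous_on_diff continuous_on_rabs)
    have "circle_Lp p (\<lambda>\<theta>. g1 \<theta> + g2 \<theta>) \<le> ennreal (M' * \<omega>\<^sub>2 (1 - r) + C\<^sub>0 * \<omega>\<^sub>2 (1 - r))"
      using M'(1) C\<^sub>0 \<omega>0 by (intro circle_Lp_triangle[OF p _ _ c[THEN borel_measurable_continuous_onI] _ _ 1 2]) (auto simp: g1_def g2_def)
    also have "\<dots> \<le> ennreal ((M' + C\<^sub>0 + 1) * \<omega>\<^sub>2 (1 - r))"
      using \<omega>0 by (intro ennreal_leI) (simp add: distrib_right)
    finally have "circle_Lp p (\<lambda>\<theta>. u (of_real r * cis \<theta>) - P (of_real r * cis \<theta>)) \<le> ennreal ((M' + C\<^sub>0 + 1) * \<omega>\<^sub>2 (1 - r))"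
    proof (rule circle_Lp_mono[OF p, rotated])
      show "0 \<le> u (of_real r * cis \<theta>) - P (of_real r * cis \<theta>)" for \<theta>
        using poisson_dist_comp_le[OF S in_disk] by (simp add: u_def P_def)
      show "u (of_real r * cis \<theta>) - P (of_real r * cis \<theta>) \<le> g1 \<theta> + g2 \<theta>" for \<theta>
        unfolding g1_def g2_def by linarith
    qed (use M'(1) C\<^sub>0 \<omega>0 in auto)
    then show "circle_Lp p (\<lambda>\<theta>. dist_comp \<omega>\<^sub>1 (of_real r * cis \<theta>) - poisson (dist_comp \<omega>\<^sub>1) (of_real r * cis \<theta>)) \<le> ennreal ((M' + C\<^sub>0 + 1) * \<omega>\<^sub>2 (1 - r))"
      by (simp add: u_def P_def)
  qed
qed

end

theorem theorem2p11:
  fixes p :: real and \<omega>\<^sub>1 \<omega>\<^sub>2 :: "real \<Rightarrow> real" and \<phi> :: "complex \<Rightarrow> complex"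
  assumes "1 \<le> p"
    and "fast_majorant \<omega>\<^sub>1" and "fast_majorant \<omega>\<^sub>2"
    and "\<phi> holomorphic_on unit_disk" and "\<phi> ` unit_disk \<subseteq> unit_disk"
  defines "F1 \<equiv> \<phi> \<in> comp_symbols (Lambda \<omega>\<^sub>1 \<infinity> unit_disk \<inter> harmonic_disk)
                                  (Lambda \<omega>\<^sub>2 (ereal p) unit_disk \<inter> harmonic_disk)"
    and "F2 \<equiv> \<exists>M>0. \<forall>z\<in>unit_disk.
           circle_Lp p (\<lambda>\<theta>. norm (deriv \<phi> (z * cis \<theta>)) *
               (\<omega>\<^sub>1 (disk_dist (\<phi> (z * cis \<theta>))) / disk_dist (\<phi> (z * cis \<theta>))))
           \<le> ennreal (M * (\<omega>\<^sub>2 (disk_dist z) / disk_dist z))"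
    and "F3 \<equiv> (\<lambda>z. complex_of_real (\<omega>\<^sub>1 (disk_dist (\<phi> z))))
                 \<in> Lambda \<omega>\<^sub>2 (ereal p) closed_unit_disk"
    and "F4 \<equiv> (\<lambda>z. complex_of_real (\<omega>\<^sub>1 (disk_dist (\<phi> z)))) \<in> Lambda_circle \<omega>\<^sub>2 (ereal p) \<and>
           (\<exists>M>0. \<forall>r\<in>{0<..<1}.
             circle_Lp p (\<lambda>\<theta>. max (\<omega>\<^sub>1 (disk_dist (\<phi> (complex_of_real r * cis \<theta>)))
                                   - \<omega>\<^sub>1 (disk_dist (\<phi> (cis \<theta>)))) 0)
             \<le> ennreal (M * \<omega>\<^sub>2 (disk_dist (complex_of_real r))))"
    and "F5 \<equiv> (\<lambda>z. complex_of_real (\<omega>\<^sub>1 (disk_dist (\<phi> z)))) \<in> Lambda_circle \<omega>\<^sub>2 (ereal p) \<and>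
           (\<exists>M>0. \<forall>r\<in>{0<..<1}.
             circle_Lp p (\<lambda>\<theta>. \<omega>\<^sub>1 (disk_dist (\<phi> (complex_of_real r * cis \<theta>)))
                 - poisson (\<lambda>z. \<omega>\<^sub>1 (disk_dist (\<phi> z))) (complex_of_real r * cis \<theta>))
             \<le> ennreal (M * \<omega>\<^sub>2 (disk_dist (complex_of_real r))))"
  shows "(F1 \<longleftrightarrow> F2) \<and>
    (continuous_on closed_unit_disk \<phi> \<and> \<omega>\<^sub>1 \<in> class_S \<and> regular_majorant \<omega>\<^sub>2 \<longrightarrow>
       (F1 \<longleftrightarrow> F3) \<and> (F1 \<longleftrightarrow> F4) \<and> (F1 \<longleftrightarrow> F5))"
proof -
  interpret disk_self_map \<phi> by unfold_locales fact+
  have maj1: "majorant \<omega>\<^sub>1" and maj2: "majorant \<omega>\<^sub>2" using assms(2,3) by (auto simp: fast_majorant_def)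
  have F2_eq: "F2 \<longleftrightarrow> (\<exists>M>0. \<forall>z\<in>unit_disk.
      circle_Lp p (\<lambda>\<theta>. pullback_slope \<omega>\<^sub>1 \<phi> (z * cis \<theta>)) \<le> ennreal (M * (\<omega>\<^sub>2 (disk_dist z) / disk_dist z)))"
    unfolding F2_def pullback_slope_def ..
  have F12: "F1 \<longleftrightarrow> F2"
  proof
    assume F1
    then show F2 unfolding F1_def F2_eq
      using composition_imp_slope_bound[OF assms(1,2) maj2] by metis
  next
    assume F2
    then obtain M where M: "M > 0" "\<And>z. z \<in> unit_disk \<Longrightarrow>
      circle_Lp p (\<lambda>\<theta>. pullback_slope \<omega>\<^sub>1 \<phi> (z * cis \<theta>)) \<le> ennreal (M * (\<omega>\<^sub>2 (disk_dist z) / disk_dist z))"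
      unfolding F2_eq by blast
    show F1 unfolding F1_def
      by (rule slope_bound_imp_composition[OF assms(1) maj1 assms(3) less_imp_le[OF M(1)] M(2)])
  qed
  have "(F2 \<longrightarrow> F3) \<and> (F3 \<longrightarrow> F4) \<and> (F4 \<longrightarrow> F5) \<and> (F5 \<longrightarrow> F2)"
    if hyps: "continuous_on closed_unit_disk \<phi>" "\<omega>\<^sub>1 \<in> class_S" "regular_majorant \<omega>\<^sub>2"
  proof -
    interpret closed_disk_self_map \<phi> by unfold_locales (rule hyps)
    have slow: "slow_majorant \<omega>\<^sub>2" using hyps(3) by (simp add: regular_majorant_def)
    let ?u = "dist_comp \<omega>\<^sub>1"
    have u: "(\<lambda>z. \<omega>\<^sub>1 (disk_dist (\<phi> z))) = ?u" by (simp add: dist_comp_def fun_eq_iff)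
    note u_app = fun_cong[OF u]
    have dr: "disk_dist (complex_of_real r) = 1 - r" if "0 < r" for r using that by (simp add: disk_dist_def)
    have F3_eq: "F3 \<longleftrightarrow> (\<lambda>z. complex_of_real (?u z)) \<in> Lambda \<omega>\<^sub>2 (ereal p) closed_unit_disk"
      unfolding F3_def u_app ..
    define circle where "circle \<longleftrightarrow> (\<exists>M>0. \<forall>\<xi>\<^sub>1\<in>unit_circle. \<forall>\<xi>\<^sub>2\<in>unit_circle.
        circle_Lp p (\<lambda>\<theta>. \<bar>?u (cis \<theta> * \<xi>\<^sub>1) - ?u (cis \<theta> * \<xi>\<^sub>2)\<bar>) \<le> ennreal (M * \<omega>\<^sub>2 (dist \<xi>\<^sub>1 \<xi>\<^sub>2)))"
    have circle_eq: "(\<lambda>z. complex_of_real (\<omega>\<^sub>1 (disk_dist (\<phi> z)))) \<in> Lambda_circle \<omega>\<^sub>2 (ereal p) \<longleftrightarrow> circle"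
      unfolding Lambda_circle_def circle_def u_app using dist_comp_Lp_circle[OF assms(1) maj1] by (simp add: osc_of_real)
    have F4_eq: "F4 \<longleftrightarrow> circle \<and> (\<exists>M>0. \<forall>r\<in>{0<..<1}.
        circle_Lp p (\<lambda>\<theta>. max (?u (of_real r * cis \<theta>) - ?u (cis \<theta>)) 0) \<le> ennreal (M * \<omega>\<^sub>2 (1 - r)))"
      unfolding F4_def circle_eq unfolding u_app by (simp add: dr)
    have F5_eq: "F5 \<longleftrightarrow> circle \<and> (\<exists>M>0. \<forall>r\<in>{0<..<1}.
        circle_Lp p (\<lambda>\<theta>. ?u (of_real r * cis \<theta>) - poisson ?u (of_real r * cis \<theta>)) \<le> ennreal (M * \<omega>\<^sub>2 (1 - r)))"
      unfolding F5_def circle_eq unfolding u u_app by (simp add: dr)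
    have F23: "F3" if F2
    proof -
      from that obtain M where M: "M > 0" "\<And>z. z \<in> unit_disk \<Longrightarrow>
        circle_Lp p (\<lambda>\<theta>. pullback_slope \<omega>\<^sub>1 \<phi> (z * cis \<theta>)) \<le> ennreal (M * (\<omega>\<^sub>2 (disk_dist z) / disk_dist z))"
        unfolding F2_eq by blast
      show F3 unfolding F3_eq
        by (rule slope_bound_imp_Lambda_closed[OF assms(1) maj1 assms(3) less_imp_le[OF M(1)] M(2)])
    qed
    have F34: "F4" if F3
    proof -
      from that have "\<exists>M>0. \<forall>z\<^sub>1\<in>closed_unit_disk. \<forall>z\<^sub>2\<in>closed_unit_disk.
          circle_Lp p (\<lambda>\<theta>. \<bar>?u (cis \<theta> * z\<^sub>1) - ?u (cis \<theta> * z\<^sub>2)\<bar>) \<le> ennreal (M * \<omega>\<^sub>2 (dist z\<^sub>1 z\<^sub>2))"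
        unfolding F3_eq Lambda_def mem_Collect_eq osc_of_real by (rule conjunct2)
      then obtain M where M: "M > 0" and "\<forall>z\<^sub>1\<in>closed_unit_disk. \<forall>z\<^sub>2\<in>closed_unit_disk.
          circle_Lp p (\<lambda>\<theta>. \<bar>?u (cis \<theta> * z\<^sub>1) - ?u (cis \<theta> * z\<^sub>2)\<bar>) \<le> ennreal (M * \<omega>\<^sub>2 (dist z\<^sub>1 z\<^sub>2))"
        by (elim exE conjE)
      then have bd: "circle_Lp p (\<lambda>\<theta>. \<bar>?u (cis \<theta> * z\<^sub>1) - ?u (cis \<theta> * z\<^sub>2)\<bar>) \<le> ennreal (M * \<omega>\<^sub>2 (dist z\<^sub>1 z\<^sub>2))"
        if "z\<^sub>1 \<in> closed_unit_disk" "z\<^sub>2 \<in> closed_unit_disk" for z\<^sub>1 z\<^sub>2 using that by (simp only: Ball_def)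
      have "circle" unfolding circle_def
        by (intro exI[of _ M] conjI ballI M bd) (simp_all only: subsetD[OF sphere_cball])
      moreover have "circle_Lp p (\<lambda>\<theta>. max (?u (of_real r * cis \<theta>) - ?u (cis \<theta>)) 0) \<le> ennreal (M * \<omega>\<^sub>2 (1 - r))"
        if r: "r \<in> {0<..<1}" for r
      proof -
        have "circle_Lp p (\<lambda>\<theta>. \<bar>?u (cis \<theta> * of_real r) - ?u (cis \<theta> * 1)\<bar>) \<le> ennreal (M * \<omega>\<^sub>2 (dist (of_real r) (1 :: complex)))"
          using r by (intro bd) auto
        also have "dist (of_real r) (1 :: complex) = 1 - r"
          using r by (metis abs_minus_commute abs_of_pos diff_gt_0_iff_gt dist_norm greaterThanLessThan_iff norm_of_real of_real_1 of_real_diff)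
        finally show ?thesis
        proof (rule circle_Lp_mono[OF assms(1), rotated])
          show "max (?u (of_real r * cis \<theta>) - ?u (cis \<theta>)) 0 \<le> \<bar>?u (cis \<theta> * of_real r) - ?u (cis \<theta> * 1)\<bar>" for \<theta>
            by (simp add: mult.commute)
        qed (use M r majorantD(1)[OF maj2] in auto)
      qed
      ultimately show F4 unfolding F4_eq using M by blast
    qed
    have F45: "F5" if F4
    proof -
      from that obtain M M' where M: "M > 0" and "\<forall>\<xi>\<^sub>1\<in>unit_circle. \<forall>\<xi>\<^sub>2\<in>unit_circle.
          circle_Lp p (\<lambda>\<theta>. \<bar>?u (cis \<theta> * \<xi>\<^sub>1) - ?u (cis \<theta> * \<xi>\<^sub>2)\<bar>) \<le> ennreal (M * \<omega>\<^sub>2 (dist \<xi>\<^sub>1 \<xi>\<^sub>2))"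
        and M': "M' > 0" and "\<forall>r\<in>{0<..<1}.
          circle_Lp p (\<lambda>\<theta>. max (?u (of_real r * cis \<theta>) - ?u (cis \<theta>)) 0) \<le> ennreal (M' * \<omega>\<^sub>2 (1 - r))"
        unfolding F4_eq circle_def by (elim exE conjE)
      then have M2: "\<And>\<xi>\<^sub>1 \<xi>\<^sub>2. \<xi>\<^sub>1 \<in> unit_circle \<Longrightarrow> \<xi>\<^sub>2 \<in> unit_circle \<Longrightarrow>
          circle_Lp p (\<lambda>\<theta>. \<bar>?u (cis \<theta> * \<xi>\<^sub>1) - ?u (cis \<theta> * \<xi>\<^sub>2)\<bar>) \<le> ennreal (M * \<omega>\<^sub>2 (dist \<xi>\<^sub>1 \<xi>\<^sub>2))"
        and M'2: "\<And>r. 0 < r \<Longrightarrow> r < 1 \<Longrightarrow>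
          circle_Lp p (\<lambda>\<theta>. max (?u (of_real r * cis \<theta>) - ?u (cis \<theta>)) 0) \<le> ennreal (M' * \<omega>\<^sub>2 (1 - r))"
        by (simp_all only: Ball_def greaterThanLessThan_iff)
      obtain C where C: "0 < C" "\<And>r. 0 < r \<Longrightarrow> r < 1 \<Longrightarrow>
          circle_Lp p (\<lambda>\<theta>. ?u (of_real r * cis \<theta>) - poisson ?u (of_real r * cis \<theta>)) \<le> ennreal (C * \<omega>\<^sub>2 (1 - r))"
      proof (rule radial_increment_imp_poisson_defect[OF assms(1) hyps(2) slow less_imp_le[OF M] M2 less_imp_le[OF M'] M'2])
        fix C assume "0 < C" "\<And>r. 0 < r \<Longrightarrow> r < 1 \<Longrightarrow>
          circle_Lp p (\<lambda>\<theta>. ?u (of_real r * cis \<theta>) - poisson ?u (of_real r * cis \<theta>)) \<le> ennreal (C * \<omega>\<^sub>2 (1 - r))"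
        then show thesis by (rule that)
      qed
      have circle using that unfolding F4_eq by (rule conjunct1)
      with C show F5 unfolding F5_eq by (intro conjI exI[of _ C] ballI) (simp_all only: greaterThanLessThan_iff)
    qed
    have F52: "F2" if F5
    proof -
      from that obtain M M' where M: "M > 0" and "\<forall>\<xi>\<^sub>1\<in>unit_circle. \<forall>\<xi>\<^sub>2\<in>unit_circle.
          circle_Lp p (\<lambda>\<theta>. \<bar>?u (cis \<theta> * \<xi>\<^sub>1) - ?u (cis \<theta> * \<xi>\<^sub>2)\<bar>) \<le> ennreal (M * \<omega>\<^sub>2 (dist \<xi>\<^sub>1 \<xi>\<^sub>2))"
        and M': "M' > 0" and "\<forall>r\<in>{0<..<1}.
          circle_Lp p (\<lambda>\<theta>. ?u (of_real r * cis \<theta>) - poisson ?u (of_real r * cis \<theta>)) \<le> ennreal (M' * \<omega>\<^sub>2 (1 - r))"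
        unfolding F5_eq circle_def by (elim exE conjE)
      then have M2: "\<And>\<xi>\<^sub>1 \<xi>\<^sub>2. \<xi>\<^sub>1 \<in> unit_circle \<Longrightarrow> \<xi>\<^sub>2 \<in> unit_circle \<Longrightarrow>
          circle_Lp p (\<lambda>\<theta>. \<bar>?u (cis \<theta> * \<xi>\<^sub>1) - ?u (cis \<theta> * \<xi>\<^sub>2)\<bar>) \<le> ennreal (M * \<omega>\<^sub>2 (dist \<xi>\<^sub>1 \<xi>\<^sub>2))"
        and M'2: "\<And>r. 0 < r \<Longrightarrow> r < 1 \<Longrightarrow>
          circle_Lp p (\<lambda>\<theta>. ?u (of_real r * cis \<theta>) - poisson ?u (of_real r * cis \<theta>)) \<le> ennreal (M' * \<omega>\<^sub>2 (1 - r))"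
        by (simp_all only: Ball_def greaterThanLessThan_iff)
      obtain C where C: "0 \<le> C" "\<And>z. z \<in> unit_disk \<Longrightarrow>
          circle_Lp p (\<lambda>\<theta>. pullback_slope \<omega>\<^sub>1 \<phi> (z * cis \<theta>)) \<le> ennreal (C * (\<omega>\<^sub>2 (disk_dist z) / disk_dist z))"
      proof (rule poisson_defect_imp_slope_bound[OF assms(1) hyps(2) slow less_imp_le[OF M] M2 less_imp_le[OF M'] M'2])
        fix C assume "0 \<le> C" "\<And>z. z \<in> unit_disk \<Longrightarrow>
          circle_Lp p (\<lambda>\<theta>. pullback_slope \<omega>\<^sub>1 \<phi> (z * cis \<theta>)) \<le> ennreal (C * (\<omega>\<^sub>2 (disk_dist z) / disk_dist z))"
        then show thesis by (rule that)
      qed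
      show F2 unfolding F2_eq
      proof (intro exI[of _ "C + 1"] conjI ballI)
        show "C + 1 > 0" using C(1) by simp
        fix z :: complex assume z: "z \<in> unit_disk"
        have "0 \<le> \<omega>\<^sub>2 (disk_dist z) / disk_dist z" using z majorantD(1)[OF maj2] by (simp add: disk_dist_def)
        then have "C * (\<omega>\<^sub>2 (disk_dist z) / disk_dist z) \<le> (C + 1) * (\<omega>\<^sub>2 (disk_dist z) / disk_dist z)"
          by (intro mult_right_mono) auto
        then show "circle_Lp p (\<lambda>\<theta>. pullback_slope \<omega>\<^sub>1 \<phi> (z * cis \<theta>)) \<le> ennreal ((C + 1) * (\<omega>\<^sub>2 (disk_dist z) / disk_dist z))"
          using C(2)[OF z] by (meson ennreal_leI order_trans)
      qed
    qed
    show ?thesis using F23 F34 F45 F52 by blast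
  qed
  with F12 show ?thesis by blast
qed

end
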